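(* Let $p$ be a prime number, let $q=p$ if $p$ is odd and $q=4$ if $p=2$. Let $\chi$ be an even Dirichlet character of conductor $f$. Let $S$ be any finite (possibly empty) set of primes not containing $p$, and set $S^+=S\cup\{p\}$. Let $F$ be a positive multiple of $q$, of $f$ and of all primes in $S$. Let $c>1$ be an integer with $(c,F)=1$. Then for every $s\in\mathbb{C}_p$ with $|s|<qp^{-1/(p-1)}$, $$-(1-\chi(c)\langle c\rangle^{1-s})\cdot\prod_{l\in S}\left(1-\chi\omega^{-1}(l)\langle l\rangle^{-s}\right)\cdot L_p(s,\chi)=\sum_{\substack{a=1\\ (a,S^+)=1}}^{F}\chi\omega^{-1}(a)\,\frac{\epsilon_{a,c,F}}{\langle a\rangle^{s}}+\delta(F/(qp)),$$ where $(a,S^+)=1$ means that $a$ is not divisible by any prime in $S^+$, and $\delta(F/(qp))$ denotes a term (depending on $s$) of $p$-adic absolute value at most $|F/(qp)|$. (At $s=1$ the expression $(1-\chi(c)\langle c\rangle^{1-s})L_p(s,\chi)$ is understood as the value of this analytic function there, the singularity being removable when $\chi=1$.)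
   Context: $|\cdot|$ is the absolute value on $\mathbb{C}_p$ with $|p|=1/p$. Dirichlet characters are primitive and take values in $\mathbb{C}_p$ (via a fixed embedding of $\overline{\mathbb{Q}}$), with $\chi(a)=0$ if $(a,f)>1$. $\omega$ is the Teichmüller character of conductor $q$: for $p\nmid a$, $\omega(a)$ is the root of unity in $\mathbb{Z}_p$ (of order dividing $p-1$ if $p$ is odd, $\pm1$ if $p=2$) with $\omega(a)\equiv a \bmod q$. For $p\nmid a$, $\langle a\rangle=a/\omega(a)\in 1+q\mathbb{Z}_p$, $\chi\omega^{-1}(a)=\chi(a)\omega(a)^{-1}$, and $\langle a\rangle^{s}=\sum_{j\ge0}\binom{s}{j}(\langle a\rangle-1)^j$ for $|s|<qp^{-1/(p-1)}$. The $p$-adic $L$-function $L_p(s,\chi)$ is the meromorphic function on $\{s\in\mathbb{C}_p: |s|<qp^{-1/(p-1)}\}$ (analytic if $\chi\ne1$; for $\chi=1$ analytic except for a simple pole at $s=1$) characterized by $L_p(1-n,\chi)=-(1-\chi\omega^{-n}(p)p^{n-1})\frac{B_{n,\chi\omega^{-n}}}{n}$ for all integers $n\ge1$ (here $\chi\omega^{-n}$ denotes the associated primitive character and $B_{n,\psi}$ are generalized Bernoulli numbers). It is known to be given explicitly, for any positive multiple $F$ of $q$ and $f$, by $L_p(s,\chi)=\frac1F\frac1{s-1}\sum_{1\le a\le F,\,p\nmid a}\chi(a)\langle a\rangle^{1-s}\sum_{j\ge0}\binom{1-s}{j}(F/a)^jB_j$, where $B_j$ are the Bernoulli numbers ($B_1=-1/2$).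 For a positive integer $m$, $\{x\}_m$ denotes the unique representative of $x$ modulo $m$ in $\{0,1,\dots,m-1\}$. For integers $a$, $c>1$ and $F\geq 1$ with $(c,F)=1$, $\epsilon_{a,c,F}=\frac{c-1}{2}-\{-aF^{-1}\}_c$, where $F^{-1}$ is the inverse of $F$ modulo $c$. *)

theory Defs
  imports "HOL-Analysis.Elementary_Topology" "HOL-Computational_Algebra.Computational_Algebra"
    "HOL-Number_Theory.Number_Theory"
begin

section \<open>The field of \<open>p\<close>-adic complex numbers\<close>

text \<open>
  The field \<open>\<complex>\<^sub>p\<close> is given by its universal description, which determines it up to
  isometric isomorphism: the completion of an algebraic closure of a completion of the
  rationals for the \<open>p\<close>-adic absolute value.  The library's \<^const>\<open>norm\<close> is reserved for
  real vector spaces, so the absolute value is the distance to \<open>0\<close>; the locale requires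
  the metric to be translation invariant.  Completeness is part of the class
  \<open>complete_space\<close>, and limits and infinite sums are those of the metric topology.
  The field is a type, so the locale predicate takes it as an argument \<open>TYPE('a)\<close>.
\<close>

definition pabs :: "'a::{zero,metric_space} \<Rightarrow> real" where
  "pabs x = dist x 0"

definition padic_int_set :: "'a::{field_char_0,complete_space} set" where
  "padic_int_set = closure \<int>"

definition padic_num_set :: "'a::{field_char_0,complete_space} set" where
  "padic_num_set = closure \<rat>"

text \<open>The elements that are algebraic over \<open>\<rat>\<^sub>p\<close>.\<close>

definition padic_alg_set :: "'a::{field_char_0,complete_space} set" where
  "padic_alg_set = {x. \<exists>P. P \<noteq> 0 \<and> (\<forall>i. poly.coeff P i \<in> padic_num_set) \<and> poly P x = 0}"

locale padic_complex_field =
  fixes p :: nat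
  assumes prime_p: "prime p"
    and dist_abs: "\<And>x y :: 'a::{field_char_0,complete_space}. dist x y = pabs (x - y)"
    and abs_mult: "\<And>x y :: 'a. pabs (x * y) = pabs x * pabs y"
    and abs_ultrametric: "\<And>x y :: 'a. pabs (x + y) \<le> max (pabs x) (pabs y)"
    and abs_p: "pabs (of_nat p :: 'a) = 1 / real p"
    and alg_closed: "\<And>P :: 'a poly. degree P > 0 \<Longrightarrow>
          (\<And>i. poly.coeff P i \<in> padic_alg_set) \<Longrightarrow> \<exists>x \<in> padic_alg_set. poly P x = 0"
    and alg_dense: "closure (padic_alg_set :: 'a set) = UNIV"

definition q_of :: "nat \<Rightarrow> nat" where
  "q_of p = (if p = 2 then 4 else p)"

definition padic_disk :: "nat \<Rightarrow> 'a::{field_char_0,complete_space} set" where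
  "padic_disk p = {s. pabs s < real (q_of p) * real p powr (- 1 / (real p - 1))}"

definition analytic_on_padic_disk ::
    "nat \<Rightarrow> ('a::{field_char_0,complete_space} \<Rightarrow> 'a) \<Rightarrow> bool" where
  "analytic_on_padic_disk p g \<longleftrightarrow>
     (\<exists>b :: nat \<Rightarrow> 'a. \<forall>s \<in> padic_disk p. (\<lambda>j. b j * s ^ j) sums g s)"


section \<open>Dirichlet characters and the Teichmueller character\<close>

definition dirichlet_char_mod :: "nat \<Rightarrow> (int \<Rightarrow> 'a::field_char_0) \<Rightarrow> bool" where
  "dirichlet_char_mod m chi \<longleftrightarrow>
     m > 0 \<and> chi 1 = 1 \<and> (\<forall>a b. chi (a * b) = chi a * chi b) \<and>
     (\<forall>a. chi (a + int m) = chi a) \<and> (\<forall>a. \<not> coprime a (int m) \<longrightarrow> chi a = 0)"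

text \<open>Primitive characters of conductor \<open>f\<close>: not induced from any proper divisor of \<open>f\<close>.\<close>

definition dirichlet_char :: "nat \<Rightarrow> (int \<Rightarrow> 'a::field_char_0) \<Rightarrow> bool" where
  "dirichlet_char f chi \<longleftrightarrow> dirichlet_char_mod f chi \<and>
     (\<forall>d. d dvd f \<and> d < f \<longrightarrow>
        (\<exists>a. coprime a (int f) \<and> [a = 1] (mod int d) \<and> chi a \<noteq> 1))"

text \<open>
  \<open>totient (q_of p)\<close> is \<open>p - 1\<close> for odd \<open>p\<close> and \<open>2\<close> for \<open>p = 2\<close>; the congruence modulo \<open>q\<close>
  in \<open>\<int>\<^sub>p\<close> is expressed by the absolute value.
\<close>

definition teich :: "nat \<Rightarrow> int \<Rightarrow> 'a::{field_char_0,complete_space}" where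
  "teich p a =
     (if int p dvd a then 0
      else (THE z. z \<in> padic_int_set \<and> z ^ totient (q_of p) = 1 \<and>
                   pabs (z - of_int a) \<le> pabs (of_nat (q_of p) :: 'a)))"

definition angle :: "nat \<Rightarrow> int \<Rightarrow> 'a::{field_char_0,complete_space}" where
  "angle p a = of_int a / teich p a"

definition angle_pow ::
    "nat \<Rightarrow> int \<Rightarrow> 'a \<Rightarrow> 'a::{field_char_0,complete_space}" where
  "angle_pow p a s = (\<Sum>j. (s gchoose j) * (angle p a - 1) ^ j)"


section \<open>The \<open>p\<close>-adic \<open>L\<close>-function\<close>

text \<open>
  Generalized Bernoulli numbers of a character of conductor \<open>g\<close>:
  \<open>(\<Sum>a=1..g. \<psi> a * t * exp (a * t) / (exp (g * t) - 1)) = (\<Sum>n. B n * t ^ n / fact n)\<close>.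
\<close>

definition gen_bernoulli :: "nat \<Rightarrow> nat \<Rightarrow> (int \<Rightarrow> 'a::field_char_0) \<Rightarrow> 'a" where
  "gen_bernoulli n g \<psi> = fact n *
     fps_nth (\<Sum>a=1..g. fps_const (\<psi> (int a)) * fps_X * fps_exp (of_nat a) /
                         (fps_exp (of_nat g) - 1)) n"

text \<open>
  \<open>\<psi>\<close>, of conductor \<open>g\<close>, is the primitive character associated with \<open>chi \<omega>\<^sup>-\<^sup>n\<close>.  The integers
  \<open>a\<close> with \<open>chi a \<noteq> 0\<close> are those prime to the conductor of \<open>chi\<close>.
\<close>

definition primitive_twist ::
    "nat \<Rightarrow> (int \<Rightarrow> 'a::{field_char_0,complete_space}) \<Rightarrow> nat
       \<Rightarrow> nat \<Rightarrow> (int \<Rightarrow> 'a) \<Rightarrow> bool" where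
  "primitive_twist p chi n g \<psi> \<longleftrightarrow> dirichlet_char g \<psi> \<and>
     (\<forall>a. \<not> int p dvd a \<and> chi a \<noteq> 0 \<longrightarrow> \<psi> a = chi a / teich p a ^ n)"

definition is_padic_L ::
    "nat \<Rightarrow> (int \<Rightarrow> 'a::{field_char_0,complete_space}) \<Rightarrow> ('a \<Rightarrow> 'a) \<Rightarrow> bool" where
  "is_padic_L p chi L \<longleftrightarrow>
     (if chi = (\<lambda>_. 1)
      then \<exists>r g. r \<noteq> 0 \<and> analytic_on_padic_disk p g \<and>
                 (\<forall>s \<in> padic_disk p. s \<noteq> 1 \<longrightarrow> L s = r / (s - 1) + g s)
      else analytic_on_padic_disk p L) \<and>
     (\<forall>n g \<psi>. n \<ge> 1 \<and> primitive_twist p chi n g \<psi> \<longrightarrow>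
        L (1 - of_nat n) =
          - (1 - \<psi> (int p) * of_nat p ^ (n - 1)) * (gen_bernoulli n g \<psi> / of_nat n))"

text \<open>
  The conditions determine the values on the disk, except at the pole \<open>s = 1\<close> for trivial
  \<open>chi\<close>; the arbitrary choice only concerns the remaining arguments.
\<close>

definition padic_L ::
    "nat \<Rightarrow> (int \<Rightarrow> 'a) \<Rightarrow> 'a \<Rightarrow> 'a::{field_char_0,complete_space}" where
  "padic_L p chi = (SOME L. is_padic_L p chi L)"

text \<open>
  The analytic function \<open>(1 - chi(c) \<langle>c\<rangle>\<^sup>1\<^sup>-\<^sup>s) L\<^sub>p(s, chi)\<close>, with its (possibly removable)
  singularity at \<open>s = 1\<close> filled in by the limit.
\<close>

definition regularized_padic_L ::
    "nat \<Rightarrow> (int \<Rightarrow> 'a) \<Rightarrow> int \<Rightarrow> 'a \<Rightarrow> 'a::{field_char_0,complete_space}" where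
  "regularized_padic_L p chi c s =
     (let H = (\<lambda>t. (1 - chi c * angle_pow p c (1 - t)) * padic_L p chi t)
      in if s = 1 then Lim (at 1) H else H s)"

definition eps :: "int \<Rightarrow> int \<Rightarrow> int \<Rightarrow> 'a::field_char_0" where
  "eps a c F = (of_int c - 1) / 2 - of_int ((- a * modular_inverse c F) mod c)"

end

theory Submission
  imports Defs
begin

text \<open>
  In closed form, \<open>L\<^sub>p(s, chi)\<close> is \<open>1 / (F (s - 1))\<close> times a sum over \<open>a \<le> F\<close> prime to \<open>p\<close> of
  binomial series in \<open>1 - s\<close> with Bernoulli numbers as coefficients.  Such series are power series
  on the disk, so the closed form has the required analyticity, and its values at \<open>1 - n\<close> follow from
  the finite binomial theorem and the distribution relation of the Bernoulli polynomials.  It is the only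
  candidate, since a function analytic apart from a pole at \<open>1\<close> is determined by its values at
  points accumulating at \<open>1\<close>.

  Up to an error of size \<open>|F / (q p)|\<close> only the two terms \<open>B\<^sub>0 = 1\<close> and \<open>B\<^sub>1 = - 1 / 2\<close> of the
  closed form matter.  For \<open>a c = r + F k\<close> one has \<open>\<langle>a c\<rangle> = \<langle>r\<rangle> (1 + F k / r)\<close>, and
  multiplication by \<open>c\<close> permutes the residues; comparing first-order terms therefore leaves
  \<open>\<Sum> chi \<omega>\<^sup>-\<^sup>1(r) \<langle>r\<rangle>\<^sup>-\<^sup>s ((c - 1) / 2 - k)\<close>, and \<open>k\<close> is the digit \<open>{- r F\<^sup>-\<^sup>1}\<^sub>c\<close>.
  The Euler factors at the primes \<open>l \<in> S\<close> are then removed one at a time by splitting off the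
  multiples of \<open>l\<close>, which form the same sum for \<open>F / l\<close>.
\<close>

section \<open>Ultrametric analysis\<close>

text \<open>The constant q p in the error has a definite origin. The prefactor 1/F of the closed
  form costs one power of |F|, so the expansions below it have to be correct up to order F^2. On the
  disk a binomial coefficient of order k grows at most like q^k, which costs one factor q in a
  remainder. Bernoulli numbers, and 1/2, have absolute value at most p, which costs the factor p.
  Since |q p| = 1/(q p), the resulting bound q p |F| is |F/(q p)|.

  The prefactor 1/(s - 1) is the real obstacle: |s - 1| may be arbitrarily small, so no estimate may
  be divided by it. The factor 1 - s is therefore extracted from the series before anything is
  estimated, at the price of denominators k + 1, which a sharp bound for 1/k! gives back. The value
  at s = 1 is reached by continuity. Neither this passage nor the removal of Euler factors worsens
  the bound, because ultrametric errors do not add up.\<close>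

context padic_complex_field
begin

abbreviation nrm :: "'a \<Rightarrow> real" where
  "nrm \<equiv> pabs"

lemma nrm_nonneg [simp]: "0 \<le> nrm x"
  by (simp add: pabs_def)

lemma nrm_eq_0_iff [simp]: "nrm x = 0 \<longleftrightarrow> x = 0"
  by (simp add: pabs_def)

lemma nrm_0 [simp]: "nrm 0 = 0"
  by simp

lemma nrm_pos_iff [simp]: "0 < nrm x \<longleftrightarrow> x \<noteq> 0"
  by (simp add: pabs_def)

lemma nrm_1 [simp]: "nrm 1 = 1"
  using abs_mult[of 1 1] by simp

lemma nrm_minus [simp]: "nrm (- x) = nrm x"
proof -
  have "nrm (-1) * nrm (-1) = 1"
    using abs_mult[of "-1" "-1"] by simp
  hence "nrm (-1) = 1"
    using nrm_nonneg[of "-1"] by (simp add: square_eq_1_iff)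
  thus ?thesis
    using abs_mult[of "-1" x] by simp
qed

lemma nrm_minus_commute: "nrm (x - y) = nrm (y - x)"
  by (metis minus_diff_eq nrm_minus)

lemma nrm_power: "nrm (x ^ n) = nrm x ^ n"
  by (induction n) (auto simp: abs_mult)

lemma nrm_inverse: "nrm (inverse x) = inverse (nrm x)"
proof (cases "x = 0")
  case False
  hence "nrm x * nrm (inverse x) = 1"
    by (simp flip: abs_mult)
  thus ?thesis
    by (metis inverse_unique)
qed auto

lemma nrm_divide: "nrm (x / y) = nrm x / nrm y"
  by (simp add: divide_inverse abs_mult nrm_inverse)

lemma nrm_prod: "nrm (prod f A) = (\<Prod>i\<in>A. nrm (f i))"
  by (induction A rule: infinite_finite_induct) (auto simp: abs_mult)

lemma nrm_add_le: "nrm x \<le> M \<Longrightarrow> nrm y \<le> M \<Longrightarrow> nrm (x + y) \<le> M"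
  using abs_ultrametric[of x y] by simp

lemma nrm_diff_le: "nrm x \<le> M \<Longrightarrow> nrm y \<le> M \<Longrightarrow> nrm (x - y) \<le> M"
  using nrm_add_le[of x M "-y"] by simp

lemma nrm_sum_le:
  assumes "\<And>i. i \<in> A \<Longrightarrow> nrm (f i) \<le> M" and "0 \<le> M"
  shows "nrm (sum f A) \<le> M"
  using assms by (induction A rule: infinite_finite_induct) (auto intro: nrm_add_le)

lemma nrm_mult_le_1: "nrm x \<le> 1 \<Longrightarrow> nrm y \<le> M \<Longrightarrow> nrm (x * y) \<le> M"
  unfolding abs_mult by (metis mult_left_le_one_le nrm_nonneg order_trans)

lemma nrm_of_nat_le_1: "nrm (of_nat n) \<le> 1"
  by (induction n) (auto intro: nrm_add_le)

lemma nrm_of_int_le_1: "nrm (of_int n) \<le> 1"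
  by (cases n rule: int_cases2) (auto simp: nrm_of_nat_le_1)

lemma nrm_of_int_mod_le:
  assumes "[a = b] (mod m)"
  shows "nrm (of_int a - of_int b) \<le> nrm (of_int m)"
proof -
  obtain k where "a - b = m * k"
    using assms by (auto simp: cong_iff_dvd_diff)
  hence "(of_int a - of_int b :: 'a) = of_int k * of_int m"
    by (metis of_int_diff of_int_mult mult.commute)
  thus ?thesis
    using nrm_mult_le_1[OF nrm_of_int_le_1] by simp
qed

lemma p_gt_1: "p > 1"
  using prime_p prime_gt_1_nat by blast

text \<open>In a Bezout relation \<open>a * u + int p * w = 1\<close> the second summand has
  absolute value below 1, so the first must have absolute value at least 1.\<close>

lemma nrm_of_int_eq_1:
  assumes "\<not> int p dvd a"
  shows "nrm (of_int a) = 1"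
proof (rule antisym[OF nrm_of_int_le_1])
  have "coprime a (int p)"
    using assms prime_p by (metis coprime_commute prime_imp_coprime prime_nat_int_transfer)
  then obtain u w where uw: "a * u + int p * w = 1"
    by (metis bezout_int coprime_imp_gcd_eq_1 mult.commute)
  have "nrm (of_int a * of_int u + of_nat p * of_int w) = 1"
    using arg_cong[OF uw, of "\<lambda>x. nrm (of_int x)"] by simp
  moreover have "nrm (of_nat p * of_int w) < 1"
  proof -
    have "nrm (of_nat p * of_int w) \<le> 1 / real p"
      using nrm_mult_le_1[OF nrm_of_int_le_1[of w], of "of_nat p" "1 / real p"] abs_p
      by (simp add: mult.commute)
    also have "\<dots> < 1" using p_gt_1 by simp
    finally show ?thesis .
  qed
  moreover have "nrm (of_int a * of_int u) \<le> nrm (of_int a)"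
    using nrm_mult_le_1[OF nrm_of_int_le_1[of u], of "of_int a" "nrm (of_int a)"]
    by (simp add: mult.commute)
  ultimately show "1 \<le> nrm (of_int a)"
    using abs_ultrametric[of "of_int a * of_int u" "of_nat p * of_int w"] by simp
qed

lemma nrm_of_nat_eq_1: "\<not> p dvd n \<Longrightarrow> nrm (of_nat n) = 1"
  using nrm_of_int_eq_1[of "int n"] by simp

lemma nrm_power_diff_le:
  assumes "nrm x \<le> 1" "nrm y \<le> 1"
  shows "nrm (x ^ n - y ^ n) \<le> nrm (x - y)"
proof (induction n)
  case (Suc n)
  have "x ^ Suc n - y ^ Suc n = x * (x ^ n - y ^ n) + y ^ n * (x - y)"
    by (simp add: algebra_simps)
  also have "nrm \<dots> \<le> nrm (x - y)"
    using Suc assms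
    by (intro nrm_add_le nrm_mult_le_1) (auto simp: nrm_power power_le_one)
  finally show ?case .
qed auto

section \<open>Limits and series for the ultrametric absolute value\<close>

lemma tendsto_iff_nrm: "(X \<longlonglongrightarrow> l) \<longleftrightarrow> (\<lambda>n. nrm (X n - l)) \<longlonglongrightarrow> 0"
  using tendsto_dist_iff[of X l sequentially] by (simp add: dist_abs)

lemma sums_iff_nrm: "f sums (t :: 'a) \<longleftrightarrow> (\<lambda>n. nrm (sum f {..<n} - t)) \<longlonglongrightarrow> 0"
  unfolding sums_def by (rule tendsto_iff_nrm)

lemma tendsto_nrm_le:
  assumes "\<And>n. nrm (x n) \<le> max (a n) (b n)" "a \<longlonglongrightarrow> 0" "b \<longlonglongrightarrow> 0"
  shows "(\<lambda>n. nrm (x n)) \<longlonglongrightarrow> 0"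
proof (rule tendsto_sandwich[of "\<lambda>_. 0"])
  show "(\<lambda>n. max (a n) (b n)) \<longlonglongrightarrow> 0"
    using tendsto_max[OF assms(2,3)] by simp
qed (use assms(1) in auto)

lemma padic_sums_add:
  assumes "f sums (a :: 'a)" "g sums b"
  shows "(\<lambda>n. f n + g n) sums (a + b)"
  unfolding sums_iff_nrm
proof (rule tendsto_nrm_le)
  show "nrm ((\<Sum>n<n. f n + g n) - (a + b)) \<le>
      max (nrm (sum f {..<n} - a)) (nrm (sum g {..<n} - b))" for n
    using abs_ultrametric[of "sum f {..<n} - a" "sum g {..<n} - b"]
    by (simp add: sum.distrib algebra_simps)
qed (use assms in \<open>simp_all add: sums_iff_nrm\<close>)

lemma padic_sums_mult:
  assumes "f sums (a :: 'a)"
  shows "(\<lambda>n. c * f n) sums (c * a)"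
proof -
  have "(\<lambda>n. nrm c * nrm (sum f {..<n} - a)) \<longlonglongrightarrow> 0"
    using assms unfolding sums_iff_nrm by (rule tendsto_mult_right_zero)
  thus ?thesis
    unfolding sums_iff_nrm by (simp flip: abs_mult add: sum_distrib_left algebra_simps)
qed

lemma padic_sums_mult2: "f sums (a :: 'a) \<Longrightarrow> (\<lambda>n. f n * c) sums (a * c)"
  using padic_sums_mult[of f a c] by (simp add: mult.commute)

lemma padic_sums_minus: "f sums (a :: 'a) \<Longrightarrow> (\<lambda>n. - f n) sums (- a)"
  using padic_sums_mult[of f a "-1"] by simp

lemma padic_sums_diff:
  "f sums (a :: 'a) \<Longrightarrow> g sums b \<Longrightarrow> (\<lambda>n. f n - g n) sums (a - b)"
  using padic_sums_add[OF _ padic_sums_minus] by fastforce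

lemma padic_sums_sum:
  assumes "\<And>i. i \<in> A \<Longrightarrow> f i sums (t i :: 'a)"
  shows "(\<lambda>n. \<Sum>i\<in>A. f i n) sums (\<Sum>i\<in>A. t i)"
  using assms by (induction A rule: infinite_finite_induct) (auto intro: padic_sums_add)

lemma padic_sums_Suc_iff:
  "(\<lambda>n. f (Suc n)) sums t \<longleftrightarrow> f sums (f 0 + t :: 'a)"
proof -
  have "f sums (f 0 + t) \<longleftrightarrow> (\<lambda>n. sum f {..<Suc n}) \<longlonglongrightarrow> f 0 + t"
    unfolding sums_def by (rule filterlim_sequentially_Suc[of "\<lambda>n. sum f {..<n}", symmetric])
  also have "\<dots> \<longleftrightarrow> (\<lambda>n. f (Suc n)) sums t"
    unfolding sums_def tendsto_iff_nrm by (simp add: sum.lessThan_Suc_shift del: sum.lessThan_Suc)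
  finally show ?thesis by simp
qed

lemma padic_sums_imp_tendsto_0:
  assumes "f sums (a :: 'a)"
  shows "(\<lambda>n. nrm (f n)) \<longlonglongrightarrow> 0"
proof -
  let ?d = "\<lambda>n. nrm (sum f {..<n} - a)"
  have d: "?d \<longlonglongrightarrow> 0"
    using assms by (simp add: sums_iff_nrm)
  have "nrm (f n) \<le> max (?d (Suc n)) (?d n)" for n
    using abs_ultrametric[of "sum f {..<Suc n} - a" "- (sum f {..<n} - a)"]
    by (simp only: nrm_minus) (simp add: algebra_simps)
  thus ?thesis
    using LIMSEQ_Suc[OF d] d by (rule tendsto_nrm_le)
qed

text \<open>A block of terms is no larger than its largest term, so null terms already make the
  partial sums Cauchy.\<close>

lemma padic_summable:
  assumes "(\<lambda>n. nrm (f n)) \<longlonglongrightarrow> 0"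
  shows "summable (f :: nat \<Rightarrow> 'a)"
proof -
  have "Cauchy (\<lambda>n. sum f {..<n})"
  proof (rule metric_CauchyI)
    fix e :: real assume e: "e > 0"
    have "eventually (\<lambda>n. nrm (f n) < e / 2) sequentially"
      using order_tendstoD(2)[OF assms, of "e / 2"] e by simp
    then obtain N where N: "\<And>n. n \<ge> N \<Longrightarrow> nrm (f n) < e / 2"
      by (auto simp: eventually_sequentially)
    have *: "dist (sum f {..<m}) (sum f {..<n}) < e" if "m \<ge> n" "n \<ge> N" for m n
    proof -
      have "{..<m} = {..<n} \<union> {n..<m}" using that by auto
      hence "sum f {..<m} - sum f {..<n} = sum f {n..<m}"
        by (simp add: sum.union_disjoint ivl_disj_int)
      moreover have "nrm (sum f {n..<m}) \<le> e / 2"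
        using that e N by (intro nrm_sum_le) (auto intro: less_imp_le)
      ultimately show ?thesis using e by (simp add: dist_abs)
    qed
    show "\<exists>N. \<forall>m\<ge>N. \<forall>n\<ge>N. dist (sum f {..<m}) (sum f {..<n}) < e"
      by (metis * dist_commute nle_le)
  qed
  hence "convergent (\<lambda>n. sum f {..<n})"
    by (rule Cauchy_convergent)
  thus ?thesis
    by (simp add: summable_iff_convergent)
qed

lemma nrm_limit_le:
  assumes "X \<longlonglongrightarrow> (l :: 'a)" "\<And>n. n \<ge> N \<Longrightarrow> nrm (X n) \<le> M"
  shows "nrm l \<le> M"
proof (rule LIMSEQ_le_const2)
  show "(\<lambda>n. nrm (X n)) \<longlonglongrightarrow> nrm l"
    using tendsto_dist[OF assms(1) tendsto_const[of 0]] by (simp add: pabs_def)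
qed (use assms(2) in auto)

lemma nrm_sums_le:
  assumes "f sums (a :: 'a)" "\<And>n. nrm (f n) \<le> M"
  shows "nrm a \<le> M"
  using assms(1) unfolding sums_def
proof (rule nrm_limit_le)
  show "nrm (sum f {..<n}) \<le> M" for n
    using assms(2) order_trans[OF nrm_nonneg assms(2)] by (intro nrm_sum_le)
qed

text \<open>The single rearrangement behind every product and re-expansion of series below. Decay in
  i + k, uniform over the plane, makes small whatever part of the first n rows lies outside the
  triangle i + k < n, and that triangle is what the first n diagonals add up to.\<close>

lemma padic_double_sum:
  fixes f :: "nat \<Rightarrow> nat \<Rightarrow> 'a"
  assumes small: "\<And>e. e > 0 \<Longrightarrow> \<exists>N. \<forall>i k. i + k \<ge> N \<longrightarrow> nrm (f i k) \<le> e"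
    and rows: "\<And>i. f i sums g i"
  shows "\<exists>t. g sums t \<and> (\<lambda>n. \<Sum>i\<le>n. f i (n - i)) sums t"
proof -
  let ?D = "\<lambda>n. \<Sum>i\<le>n. f i (n - i)"
  have "(\<lambda>n. nrm (?D n)) \<longlonglongrightarrow> 0"
  proof (rule LIMSEQ_I)
    fix r :: real assume r: "r > 0"
    from small[of "r/2"] r obtain N where N: "\<And>i k. i + k \<ge> N \<Longrightarrow> nrm (f i k) \<le> r/2"
      by auto
    have "nrm (?D n) \<le> r/2" if "n \<ge> N" for n
      using that r by (intro nrm_sum_le N) auto
    thus "\<exists>N. \<forall>n\<ge>N. norm (nrm (?D n) - 0) < r"
      using r by (intro exI[of _ N]) force
  qed
  then obtain t where t: "?D sums t"
    by (metis padic_summable summable_sums)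
  have lim: "(\<lambda>n. nrm (sum g {..<n} - sum ?D {..<n})) \<longlonglongrightarrow> 0"
  proof (rule LIMSEQ_I)
    fix r :: real assume r: "r > 0"
    from small[of "r/2"] r obtain N where N: "\<And>i k. i + k \<ge> N \<Longrightarrow> nrm (f i k) \<le> r/2"
      by auto
    have "nrm (sum g {..<n} - sum ?D {..<n}) \<le> r/2" if n: "n \<ge> N" for n
    proof -
      have "sum ?D {..<n} = (\<Sum>i<n. \<Sum>k<n-i. f i k)"
      proof -
        have "{(i, k). i + k < n} = Sigma {..<n} (\<lambda>i. {..<n-i})" by auto
        thus ?thesis
          using sum.triangle_reindex[of f n] by (simp add: sum.Sigma)
      qed
      hence "sum g {..<n} - sum ?D {..<n} = (\<Sum>i<n. g i - (\<Sum>k<n-i. f i k))"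
        by (simp add: sum_subtractf)
      also have "nrm \<dots> \<le> r/2"
      proof (rule nrm_sum_le)
        fix i assume i: "i \<in> {..<n}"
        have lim: "(\<lambda>m. sum (f i) {..<m} - (\<Sum>k<n-i. f i k)) \<longlonglongrightarrow> g i - (\<Sum>k<n-i. f i k)"
          using rows[of i] unfolding sums_def tendsto_iff_nrm by simp
        show "nrm (g i - (\<Sum>k<n-i. f i k)) \<le> r/2"
        proof (rule nrm_limit_le[OF lim])
          fix m assume m: "m \<ge> n - i"
          have "{..<m} = {..<n-i} \<union> {n-i..<m}" using m by auto
          hence "sum (f i) {..<m} - (\<Sum>k<n-i. f i k) = sum (f i) {n-i..<m}"
            by (simp add: sum.union_disjoint ivl_disj_int)
          also have "nrm \<dots> \<le> r/2"
            using n r i by (intro nrm_sum_le N) auto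
          finally show "nrm (sum (f i) {..<m} - (\<Sum>k<n-i. f i k)) \<le> r/2" .
        qed
      qed (use r in auto)
      finally show ?thesis .
    qed
    thus "\<exists>N. \<forall>n\<ge>N. norm (nrm (sum g {..<n} - sum ?D {..<n}) - 0) < r"
      using r by (intro exI[of _ N]) force
  qed
  have "nrm (sum g {..<n} - t) \<le>
      max (nrm (sum g {..<n} - sum ?D {..<n})) (nrm (sum ?D {..<n} - t))" for n
    using abs_ultrametric[of "sum g {..<n} - sum ?D {..<n}" "sum ?D {..<n} - t"] by simp
  from tendsto_nrm_le[OF this lim] have "g sums t"
    using t unfolding sums_iff_nrm by simp
  thus ?thesis using t by blast
qed

end

section \<open>Binomial series with \<open>p\<close>-adic exponents\<close>

context padic_complex_field
begin

abbreviation q :: nat where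
  "q \<equiv> q_of p"

text \<open>By Legendre's formula \<open>rt ^ n\<close> describes the growth of
  \<open>1 / nrm (fact n)\<close>. Hence the quotient \<open>rad\<close> of q by \<open>rt\<close>
  is the radius of the disk: binomial series in an element of absolute value at most 1/q converge
  for exponents below it.\<close>

definition rt :: real where
  "rt = real p powr (1 / (real p - 1))"

definition rad :: real where
  "rad = real q / rt"

lemma rt_gt_1: "rt > 1"
  using p_gt_1 by (simp add: rt_def)

lemma rt_power: "rt ^ (p - 1) = real p"
proof -
  have "rt ^ (p - 1) = rt powr real (p - 1)"
    using rt_gt_1 by (intro powr_realpow[symmetric]) auto
  also have "\<dots> = real p powr (1 / (real p - 1) * real (p - 1))"
    unfolding rt_def powr_powr ..
  also have "1 / (real p - 1) * real (p - 1) = 1"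
    using p_gt_1 by (simp add: of_nat_diff)
  finally show ?thesis using p_gt_1 by simp
qed

lemma q_gt_1: "q > 1" and p_dvd_q: "p dvd q" and q_pos: "q > 0"
  using p_gt_1 by (auto simp: q_of_def)

lemma rad_gt_1: "rad > 1"
proof (cases "p = 2")
  case True
  thus ?thesis unfolding rad_def rt_def by (simp add: q_of_def)
next
  case False
  hence "p > 2" using p_gt_1 by simp
  hence "rt < real p powr 1"
    unfolding rt_def by (intro powr_less_mono) auto
  thus ?thesis using False rt_gt_1 by (simp add: rad_def q_of_def)
qed

lemma padic_disk_iff: "s \<in> padic_disk p \<longleftrightarrow> nrm s < rad"
  by (simp add: padic_disk_def rad_def rt_def powr_minus divide_inverse)

lemma nrm_q: "nrm (of_nat q) = 1 / real q"
proof (cases "p = 2")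
  case True
  have "nrm (of_nat 2 * of_nat 2) = 1 / real 2 * (1 / real 2)"
    using abs_p unfolding abs_mult True by (simp only:)
  thus ?thesis using True by (simp add: q_of_def)
qed (use abs_p in \<open>simp add: q_of_def\<close>)

lemma nrm_fact_mult_add: "r < p \<Longrightarrow> nrm (fact (p * m + r)) = nrm (fact (p * m))"
proof (induction r)
  case (Suc r)
  have "\<not> p dvd p * m + Suc r"
    using Suc.prems dvd_add_right_iff[of p "p * m" "Suc r"] by (auto dest: dvd_imp_le)
  hence "nrm (of_nat (p * m + Suc r)) = 1"
    by (rule nrm_of_nat_eq_1)
  moreover have "(fact (p * m + Suc r) :: 'a) = of_nat (p * m + Suc r) * fact (p * m + r)"
    by simp
  ultimately show ?case
    using Suc by (simp add: abs_mult del: of_nat_Suc of_nat_add fact_Suc)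
qed auto

lemma nrm_fact_mult: "nrm (fact (p * m)) = nrm (fact m) / real p ^ m"
proof (induction m)
  case (Suc m)
  have "p * Suc m = Suc (p * m + (p - 1))"
    using p_gt_1 by simp
  hence "(fact (p * Suc m) :: 'a) = of_nat (p * Suc m) * fact (p * m + (p - 1))"
    by (metis fact_Suc)
  also have "nrm \<dots> = nrm (of_nat p * of_nat (Suc m)) * nrm (fact (p * m))"
    unfolding abs_mult of_nat_mult using nrm_fact_mult_add[of "p - 1" m] p_gt_1 by simp
  also have "\<dots> = nrm (of_nat (Suc m) * fact m) / real p ^ Suc m"
    by (simp add: Suc abs_mult abs_p del: of_nat_Suc)
  finally show ?case by simp
qed auto

text \<open>A factor prime to p leaves \<open>nrm (fact n)\<close> unchanged, and passing from m to
  p m divides it by p^m = rt^((p - 1) m), which is exactly the growth of the exponent n - 1.\<close>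

lemma nrm_fact_ge:
  assumes "n > 0"
  shows "1 \<le> nrm (fact n) * rt ^ (n - 1)"
  using assms
proof (induction n rule: less_induct)
  case (less n)
  show ?case
  proof (cases "p dvd n")
    case True
    then obtain m where m: "n = p * m" by auto
    with less.prems have m0: "m > 0" by auto
    have "n - 1 = (p - 1) * m + (m - 1)"
      using m m0 p_gt_1 by (simp add: algebra_simps)
    hence "nrm (fact n) * rt ^ (n - 1) = nrm (fact m) * rt ^ (m - 1)"
      using p_gt_1 rt_power by (simp add: power_add power_mult m nrm_fact_mult)
    thus ?thesis
      using less.IH[of m] m m0 p_gt_1 by simp
  next
    case False
    then obtain k where k: "n = Suc k"
      using less.prems by (cases n) auto
    have eq: "nrm (fact n) = nrm (fact k)"
      using nrm_of_nat_eq_1[OF False] unfolding k fact_Suc abs_mult by simp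
    show ?thesis
    proof (cases "k = 0")
      case False
      have "rt ^ (k - 1) \<le> rt ^ (n - 1)"
        using rt_gt_1 k by (intro power_increasing) auto
      with less.IH[of k] False k show ?thesis
        unfolding eq by (auto intro: order_trans mult_left_mono)
    qed (auto simp: k)
  qed
qed

lemma nrm_inverse_fact_le: "1 / nrm (fact (Suc k)) \<le> rt ^ k"
  using nrm_fact_ge[of "Suc k"] by (simp add: divide_le_eq mult.commute del: fact_Suc)

text \<open>Writing 1/k! as (k + 1)/(k + 1)! makes the exponent of \<open>rt\<close> equal to k and
  leaves the factor \<open>nrm (of_nat (Suc k))\<close>, which later pays for divisions by k +
  1.\<close>

lemma nrm_gbinomial_le:
  assumes "max 1 (nrm s) \<le> r"
  shows "nrm (s gchoose k) \<le> nrm (of_nat (Suc k)) * (r * rt) ^ k"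
proof -
  have "nrm (s - of_nat i) \<le> r" for i
    using assms nrm_of_nat_le_1[of i] by (intro nrm_diff_le) auto
  hence "(\<Prod>i=0..<k. nrm (s - of_nat i)) \<le> (\<Prod>i=0..<k. r)"
    by (intro prod_mono) auto
  hence "nrm (s gchoose k) \<le> r ^ k / nrm (fact k)"
    unfolding gbinomial_prod_rev nrm_divide nrm_prod by (simp add: divide_right_mono)
  also have "\<dots> = nrm (of_nat (Suc k)) * r ^ k * (1 / nrm (fact (Suc k)))"
    unfolding fact_Suc abs_mult by (simp del: of_nat_Suc)
  also have "\<dots> \<le> nrm (of_nat (Suc k)) * r ^ k * rt ^ k"
    using assms by (intro mult_left_mono nrm_inverse_fact_le) auto
  finally show ?thesis by (simp add: power_mult_distrib mult.assoc)
qed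

lemma disk_gbinomial_bound:
  assumes "s \<in> padic_disk p"
  obtains t where "0 \<le> t" "t < 1"
    "\<And>k. nrm (s gchoose k) \<le> nrm (of_nat (Suc k)) * (t * real q) ^ k"
proof
  \<comment> \<open>The maximum with 1 accounts for the integers subtracted from s in the binomial
    coefficient. Strictness comes from the open disk and from \<open>rad > 1\<close>.\<close>
  let ?t = "max 1 (nrm s) / rad"
  show "0 \<le> ?t" "?t < 1"
    using assms rad_gt_1 by (auto simp: padic_disk_iff)
  have "?t * real q = max 1 (nrm s) * rt"
    using q_gt_1 rt_gt_1 by (simp add: rad_def)
  thus "nrm (s gchoose k) \<le> nrm (of_nat (Suc k)) * (?t * real q) ^ k" for k
    using nrm_gbinomial_le[OF order_refl, of s k] by simp
qed

lemma disk_gbinomial_le: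
  assumes "s \<in> padic_disk p"
  shows "nrm (s gchoose k) \<le> nrm (of_nat (Suc k)) * real q ^ k"
proof -
  obtain t where t: "0 \<le> t" "t < 1"
    "nrm (s gchoose k) \<le> nrm (of_nat (Suc k)) * (t * real q) ^ k"
    using disk_gbinomial_bound[OF assms] by metis
  note t(3)
  also have "nrm (of_nat (Suc k)) * (t * real q) ^ k \<le> nrm (of_nat (Suc k)) * real q ^ k"
    using t by (intro mult_left_mono power_mono mult_left_le_one_le) auto
  finally show ?thesis .
qed

text \<open>
  The factor \<^term>\<open>Suc k\<close> admits the coefficients that arise when a series is divided by its
  argument, through \<^term>\<open>s gchoose Suc k = s / of_nat (Suc k) * ((s - 1) gchoose k)\<close>.
\<close>

definition tame :: "(nat \<Rightarrow> 'a) \<Rightarrow> bool" where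
  "tame d \<longleftrightarrow> (\<exists>M. \<forall>k. nrm (of_nat (Suc k) * d k) \<le> M / real q ^ k)"

definition mahler :: "(nat \<Rightarrow> 'a) \<Rightarrow> 'a \<Rightarrow> 'a" where
  "mahler d s = (\<Sum>k. (s gchoose k) * d k)"

lemma tameI:
  assumes "\<And>k. nrm (d k) \<le> M / real q ^ k"
  shows "tame d"
  unfolding tame_def using assms nrm_mult_le_1[OF nrm_of_nat_le_1] by blast

lemma geometric_tendsto_0:
  assumes "0 \<le> t" "t < 1" "\<And>n. nrm (f n) \<le> M * t ^ n"
  shows "(\<lambda>n. nrm (f n)) \<longlonglongrightarrow> 0"
proof (rule tendsto_sandwich[of "\<lambda>_. 0"])
  show "(\<lambda>n. M * t ^ n) \<longlonglongrightarrow> 0"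
    using LIMSEQ_power_zero[of t] assms by (intro tendsto_mult_right_zero) auto
qed (use assms in auto)

lemma geometric_small:
  assumes "0 \<le> t" "t < 1" "\<And>i k. nrm (f i k) \<le> M * t ^ (i + k)" "e > 0"
  shows "\<exists>N. \<forall>i k. i + k \<ge> N \<longrightarrow> nrm (f i k) \<le> e"
proof -
  have "(\<lambda>n. M * t ^ n) \<longlonglongrightarrow> 0"
    using LIMSEQ_power_zero[of t] assms by (intro tendsto_mult_right_zero) auto
  hence "eventually (\<lambda>n. M * t ^ n < e) sequentially"
    using assms(4) by (rule order_tendstoD)
  thus ?thesis
    unfolding eventually_sequentially using assms(3) by (meson less_imp_le order_trans)
qed

lemma mahler_term_bound:
  assumes "tame d" "s \<in> padic_disk p"
  obtains t M where "0 \<le> t" "t < 1" "0 \<le> M" "\<And>k. nrm ((s gchoose k) * d k) \<le> M * t ^ k"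
proof -
  obtain M where M: "\<And>k. nrm (of_nat (Suc k) * d k) \<le> M / real q ^ k"
    using assms(1) unfolding tame_def by auto
  obtain t where t: "0 \<le> t" "t < 1"
    "\<And>k. nrm (s gchoose k) \<le> nrm (of_nat (Suc k)) * (t * real q) ^ k"
    using disk_gbinomial_bound[OF assms(2)] by metis
  have "nrm ((s gchoose k) * d k) \<le> M * t ^ k" for k
  proof -
    have "nrm ((s gchoose k) * d k) \<le> nrm (of_nat (Suc k)) * (t * real q) ^ k * nrm (d k)"
      unfolding abs_mult by (intro mult_right_mono t) auto
    also have "\<dots> = nrm (of_nat (Suc k) * d k) * (t * real q) ^ k"
      by (simp add: abs_mult)
    also have "\<dots> \<le> M / real q ^ k * (t * real q) ^ k"
      using t by (intro mult_right_mono M) auto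
    also have "\<dots> = M * t ^ k"
      using q_gt_1 by (simp add: power_mult_distrib)
    finally show ?thesis .
  qed
  moreover have "0 \<le> M"
    using order_trans[OF nrm_nonneg M[of 0]] by simp
  ultimately show ?thesis using that t by blast
qed

lemma mahler_sums:
  assumes "tame d" "s \<in> padic_disk p"
  shows "(\<lambda>k. (s gchoose k) * d k) sums mahler d s"
proof -
  obtain t M where "0 \<le> t" "t < 1" "\<And>k. nrm ((s gchoose k) * d k) \<le> M * t ^ k"
    using mahler_term_bound[OF assms] by metis
  from geometric_tendsto_0[OF this] show ?thesis
    unfolding mahler_def by (intro summable_sums padic_summable)
qed

lemma mahler_of_nat: "mahler d (of_nat n) = (\<Sum>k\<le>n. of_nat (n choose k) * d k)"
proof -
  have "(\<lambda>k. (of_nat n gchoose k) * d k) sums (\<Sum>k\<le>n. (of_nat n gchoose k) * d k)"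
    by (rule sums_finite) (auto simp flip: binomial_gbinomial)
  thus ?thesis
    by (simp add: mahler_def sums_iff flip: binomial_gbinomial)
qed

lemma poly_eq_sum_atMost:
  fixes P :: "'a poly"
  assumes "degree P \<le> n"
  shows "poly P x = (\<Sum>i\<le>n. poly.coeff P i * x ^ i)"
  using assms unfolding poly_altdef[of P]
  by (intro sum.mono_neutral_left) (auto simp: coeff_eq_0)

lemma nrm_coeff_falling_poly_le:
  "nrm (poly.coeff (\<Prod>i<n. [:- of_nat i, 1:]) j) \<le> 1"
proof (induction n arbitrary: j)
  case 0
  thus ?case by (cases j) auto
next
  case (Suc n)
  let ?P = "\<Prod>i<n. [:- of_nat i, 1 :: 'a:]"
  have "poly.coeff (?P * [:- of_nat n, 1:]) j
      = - of_nat n * poly.coeff ?P j + (if j = 0 then 0 else poly.coeff ?P (j - 1))"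
    by (cases j) (auto simp: mult_pCons_right)
  also have "nrm \<dots> \<le> 1"
    using Suc nrm_of_nat_le_1[of n] by (intro nrm_add_le nrm_mult_le_1) auto
  finally show ?case by simp
qed

text \<open>The polynomial n! (s gchoose n) has integral coefficients, so the term of index n
  contributes to each power of s at most |d n / n!|, which is bounded by a multiple of rad^(-n).
  With rows indexed by powers of s, the diagonals are the Mahler terms.\<close>

lemma mahler_analytic:
  assumes "tame d"
  shows "analytic_on_padic_disk p (mahler d)"
proof -
  let ?c = "\<lambda>n i. poly.coeff (\<Prod>i<n. [:- of_nat i, 1 :: 'a:]) i"
  \<comment> \<open>\<open>?b i k\<close> is the coefficient of s^i in the Mahler term of index i +
    k.\<close>
  let ?b = "\<lambda>i k. ?c (i + k) i * (d (i + k) / fact (i + k))"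
  obtain M where M: "\<And>k. nrm (of_nat (Suc k) * d k) \<le> M / real q ^ k"
    using assms unfolding tame_def by auto
  have "nrm (d n / fact n) \<le> M * (1 / rad) ^ n" for n
  proof -
    have "d n / fact n = (of_nat (Suc n) * d n) / fact (Suc n)"
      by (simp del: of_nat_Suc)
    hence "nrm (d n / fact n) = nrm (of_nat (Suc n) * d n) * (1 / nrm (fact (Suc n)))"
      by (simp add: nrm_divide del: of_nat_Suc fact_Suc)
    also have "\<dots> \<le> (M / real q ^ n) * rt ^ n"
      using M by (intro mult_mono nrm_inverse_fact_le) (auto intro: order_trans[OF nrm_nonneg])
    finally show ?thesis by (simp add: rad_def power_divide)
  qed
  hence b: "nrm (?b i k) \<le> M * (1 / rad) ^ (i + k)" for i k
    by (intro nrm_mult_le_1 nrm_coeff_falling_poly_le)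
  have M0: "0 \<le> M"
    using order_trans[OF nrm_nonneg M[of 0]] by simp
  have "(\<lambda>k. nrm (?b i k)) \<longlonglongrightarrow> 0" for i
    by (rule geometric_tendsto_0[of "1 / rad" _ "M * (1 / rad) ^ i"])
       (use rad_gt_1 b[of i] in \<open>auto simp: power_add mult.assoc\<close>)
  hence B: "?b i sums suminf (?b i)" for i
    by (intro summable_sums padic_summable)
  show ?thesis
    unfolding analytic_on_padic_disk_def
  proof (intro exI ballI)
    fix s :: 'a assume s: "s \<in> padic_disk p"
    define r where "r = max 1 (nrm s)"
    have r: "r \<ge> 1" "r < rad" "nrm s \<le> r"
      using s rad_gt_1 by (auto simp: padic_disk_iff r_def)
    let ?f = "\<lambda>i k. s ^ i * ?b i k"
    have "nrm (?f i k) \<le> M * (r / rad) ^ (i + k)" for i k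
    proof -
      have "nrm s ^ i \<le> r ^ (i + k)"
        using r by (meson nrm_nonneg order_trans power_increasing power_mono le_add1)
      hence "nrm (?f i k) \<le> r ^ (i + k) * (M * (1 / rad) ^ (i + k))"
        unfolding abs_mult[of "s ^ i"] nrm_power using b[of i k] r by (intro mult_mono) auto
      thus ?thesis by (simp add: power_divide mult.commute)
    qed
    from geometric_small[OF _ _ this]
    have small: "\<exists>N. \<forall>i k. N \<le> i + k \<longrightarrow> nrm (?f i k) \<le> e" if "e > 0" for e
      using that r by simp
    obtain T where T: "(\<lambda>i. s ^ i * suminf (?b i)) sums T" "(\<lambda>n. \<Sum>i\<le>n. ?f i (n - i)) sums T"
      using padic_double_sum[OF small padic_sums_mult[OF B]] by blast
    have "(\<Sum>i\<le>n. ?f i (n - i)) = (s gchoose n) * d n" for n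
    proof -
      have "degree (\<Prod>i<n. [:- of_nat i, 1 :: 'a:]) \<le> n"
        by (rule order_trans[OF degree_prod_sum_le]) auto
      hence "poly (\<Prod>i<n. [:- of_nat i, 1:]) s = (\<Sum>i\<le>n. ?c n i * s ^ i)"
        by (rule poly_eq_sum_atMost)
      moreover have "poly (\<Prod>i<n. [:- of_nat i, 1:]) s = fact n * (s gchoose n)"
        by (simp add: poly_prod gbinomial_prod_rev atLeast0LessThan)
      moreover have "(\<Sum>i\<le>n. ?f i (n - i)) = (\<Sum>i\<le>n. ?c n i * s ^ i) * (d n / fact n)"
        unfolding sum_distrib_right by (rule sum.cong) auto
      ultimately have "(\<Sum>i\<le>n. ?f i (n - i)) = (fact n * (s gchoose n)) * (d n / fact n)"
        by (simp only:)
      thus ?thesis by simp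
    qed
    with T(2) have "(\<lambda>n. (s gchoose n) * d n) sums T" by simp
    hence "mahler d s = T"
      using mahler_sums[OF assms s] sums_unique2 by blast
    thus "(\<lambda>i. suminf (?b i) * s ^ i) sums mahler d s"
      using T(1) by (simp add: mult.commute)
  qed
qed

end

section \<open>The Teichmueller character\<close>

context padic_complex_field
begin

lemma totient_q_pos: "totient q > 0"
  using q_pos by simp

text \<open>This is where q = 4 matters at p = 2: the totient is then 2, and a congruence modulo 2
  would not separate the roots 1 and -1. For odd p the totient is a unit.\<close>

lemma nrm_q_less_nrm_totient: "nrm (of_nat q) < nrm (of_nat (totient q))"
proof (cases "p = 2")
  case True
  have "totient q = 2"
    unfolding q_of_def True using totient_prime_power_Suc[of "2::nat" 1] by simp
  moreover have "nrm (of_nat 2) = 1 / real 2"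
    using abs_p unfolding True .
  ultimately show ?thesis
    using nrm_q by (simp add: q_of_def True)
next
  case False
  have "totient q = p - 1"
    using False prime_p by (simp add: q_of_def totient_prime)
  moreover have "\<not> p dvd p - 1"
    using p_gt_1 by (auto dest: dvd_imp_le)
  ultimately show ?thesis
    using nrm_of_nat_eq_1 nrm_q q_gt_1 by simp
qed

lemma nrm_root_of_unity:
  assumes "z ^ n = 1" "n > 0"
  shows "nrm z = 1"
proof -
  have "nrm z ^ n = 1 ^ n"
    using assms by (simp flip: nrm_power)
  thus ?thesis
    using assms(2) by (metis nrm_nonneg power_eq_imp_eq_base zero_le_one)
qed

text \<open>The cofactor of z - w in z^t - w^t, for t the totient, differs from t w^(t - 1) by at
  most |z - w| <= |q| < |t|, so it cannot vanish.\<close>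

lemma totient_roots_distinct:
  assumes "z ^ totient q = 1" "w ^ totient q = 1" "nrm (z - w) \<le> nrm (of_nat q)"
  shows "z = w"
proof (rule ccontr)
  assume "z \<noteq> w"
  let ?t = "totient q"
  have 1: "nrm z = 1" "nrm w = 1"
    using assms totient_q_pos by (auto intro: nrm_root_of_unity)
  have "(z - w) * (\<Sum>i<?t. w ^ (?t - Suc i) * z ^ i) = z ^ ?t - w ^ ?t"
    by (rule power_diff_sumr2[symmetric])
  hence "(\<Sum>i<?t. w ^ (?t - Suc i) * z ^ i) = 0"
    using assms \<open>z \<noteq> w\<close> by simp
  moreover have "(\<Sum>i<?t. w ^ (?t - Suc i) * (w ^ i - z ^ i))
      = of_nat ?t * w ^ (?t - 1) - (\<Sum>i<?t. w ^ (?t - Suc i) * z ^ i)"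
  proof -
    have "(\<Sum>i<?t. w ^ (?t - Suc i) * w ^ i) = (\<Sum>i<?t. w ^ (?t - 1))"
      by (intro sum.cong) (auto simp flip: power_add)
    thus ?thesis by (simp add: algebra_simps sum_subtractf)
  qed
  ultimately have "nrm (of_nat ?t * w ^ (?t - 1)) = nrm (\<Sum>i<?t. w ^ (?t - Suc i) * (w ^ i - z ^ i))"
    by simp
  also have "\<dots> \<le> nrm (w - z)"
    using 1 by (intro nrm_sum_le nrm_mult_le_1 nrm_power_diff_le) (auto simp: nrm_power)
  finally have "nrm (of_nat ?t) \<le> nrm (of_nat q)"
    using assms(3) 1 by (simp add: abs_mult nrm_power nrm_minus_commute[of w])
  thus False
    using nrm_q_less_nrm_totient by simp
qed

text \<open>For odd p the root is the limit of b^(p^n). Euler's theorem modulo p^(n + 1) does two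
  things at once: it brings consecutive terms together and it forces the (p - 1)-st power of the
  limit to be 1. For p = 2 the roots are the integers 1 and -1.\<close>

lemma teich_exists:
  assumes "\<not> int p dvd a"
  shows "\<exists>z \<in> padic_int_set. z ^ totient q = 1 \<and> nrm (z - of_int a) \<le> nrm (of_nat q)"
proof (cases "p = 2")
  case True
  hence q4: "q = 4" by (simp add: q_of_def)
  have "\<exists>e. [e = a] (mod 4) \<and> e ^ 2 = 1"
  proof (cases "a mod 4 = 1")
    case False
    with assms True have "a mod 4 = 3" by presburger
    hence "[- 1 = a] (mod 4)" by (simp add: cong_def)
    thus ?thesis by (intro exI[of _ "-1"]) simp
  qed (auto simp: cong_def intro!: exI[of _ 1])
  then obtain e :: int where e: "[e = a] (mod 4)" "e ^ 2 = 1" by blast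
  have "totient q = 2"
    unfolding q4 using totient_prime_power_Suc[of "2::nat" 1] by simp
  moreover have "(of_int e :: 'a) ^ 2 = 1"
    using e(2) by (metis of_int_1 of_int_power)
  moreover have "(of_int e :: 'a) \<in> padic_int_set"
    unfolding padic_int_set_def using closure_subset Ints_of_int by blast
  ultimately show ?thesis
    using nrm_of_int_mod_le[OF e(1)] q4 by auto
next
  case False
  hence qp: "q = p" by (simp add: q_of_def)
  define b where "b = nat (a mod int p)"
  have b: "int b = a mod int p"
    using p_gt_1 by (simp add: b_def)
  have "\<not> p dvd b"
    using assms b by (metis dvd_mod_iff dvd_refl of_nat_dvd_iff)
  hence cop: "coprime b (p ^ n)" for n
    using prime_p by (metis coprime_commute coprime_power_right_iff prime_imp_coprime)
  define X :: "nat \<Rightarrow> 'a" where "X n = of_nat (b ^ (p ^ n))" for n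
  have X1: "nrm (X n) \<le> 1" for n
    unfolding X_def by (rule nrm_of_nat_le_1)
  have fermat: "nrm (X n ^ (p - 1) - 1) \<le> (1 / real p) ^ Suc n" for n
  proof -
    have "[b ^ totient (p ^ Suc n) = 1] (mod p ^ Suc n)"
      by (rule euler_theorem[OF cop])
    hence "[(b ^ (p ^ n)) ^ (p - 1) = 1] (mod p ^ Suc n)"
      using totient_prime_power_Suc[OF prime_p, of n] by (simp add: power_mult)
    hence "[int ((b ^ (p ^ n)) ^ (p - 1)) = int 1] (mod int (p ^ Suc n))"
      by (simp only: cong_int_iff)
    from nrm_of_int_mod_le[OF this] show ?thesis
      by (simp add: X_def nrm_power abs_mult abs_p)
  qed
  have diff: "nrm (X (Suc n) - X n) \<le> (1 / real p) ^ Suc n" for n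
  proof -
    have "X (Suc n) = X n * X n ^ (p - 1)"
    proof -
      have "p ^ Suc n = p ^ n + p ^ n * (p - 1)"
        using p_gt_1 by (cases p) auto
      thus ?thesis
        unfolding X_def by (simp only: power_add power_mult of_nat_mult of_nat_power)
    qed
    hence "X (Suc n) - X n = X n * (X n ^ (p - 1) - 1)"
      by (simp add: algebra_simps)
    thus ?thesis
      using nrm_mult_le_1[OF X1 fermat] by simp
  qed
  have pow: "(\<lambda>n. (1 / real p) ^ Suc n) \<longlonglongrightarrow> 0"
    using p_gt_1 by (intro LIMSEQ_Suc LIMSEQ_power_zero) auto
  have "(\<lambda>n. nrm (X (Suc n) - X n)) \<longlonglongrightarrow> 0"
    using diff pow by (intro tendsto_nrm_le[of _ "\<lambda>n. (1 / real p) ^ Suc n" "\<lambda>n. (1 / real p) ^ Suc n"]) auto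
  then obtain d where d: "(\<lambda>n. X (Suc n) - X n) sums d"
    by (metis padic_summable summable_sums)
  define z where "z = X 0 + d"
  have lim: "X \<longlonglongrightarrow> z"
    using d unfolding sums_def tendsto_iff_nrm z_def
    by (simp add: sum_lessThan_telescope algebra_simps)
  have zX: "nrm (z - X 0) \<le> 1 / real p"
  proof -
    have "(1 / real p) ^ Suc n \<le> 1 / real p" for n
      using p_gt_1 power_decreasing[of 1 "Suc n" "1 / real p"] by simp
    hence "nrm d \<le> 1 / real p"
      by (intro nrm_sums_le[OF d] order_trans[OF diff])
    thus ?thesis by (simp add: z_def)
  qed
  have z1: "nrm z \<le> 1"
    using nrm_limit_le[OF lim X1] .
  have "z ^ (p - 1) = 1"
  proof -
    have "(\<lambda>n::nat. nrm (z ^ (p - 1) - 1)) \<longlonglongrightarrow> 0"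
    proof (rule tendsto_nrm_le)
      fix n
      have "nrm (z ^ (p - 1) - 1) \<le> max (nrm (z ^ (p - 1) - X n ^ (p - 1))) (nrm (X n ^ (p - 1) - 1))"
        using abs_ultrametric[of "z ^ (p - 1) - X n ^ (p - 1)" "X n ^ (p - 1) - 1"] by simp
      also have "\<dots> \<le> max (nrm (X n - z)) ((1 / real p) ^ Suc n)"
        using nrm_power_diff_le[OF z1 X1[of n], of "p - 1"] fermat[of n]
        by (intro max.mono) (auto simp: nrm_minus_commute)
      finally show "nrm (z ^ (p - 1) - 1) \<le> \<dots>" .
    qed (use lim pow in \<open>auto simp: tendsto_iff_nrm\<close>)
    hence "nrm (z ^ (p - 1) - 1) = 0"
      by (simp add: LIMSEQ_const_iff)
    thus ?thesis by simp
  qed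
  moreover have "totient q = p - 1"
    using prime_p by (simp add: qp totient_prime)
  moreover have "z \<in> padic_int_set"
    unfolding padic_int_set_def closure_sequential
    using lim by (intro exI[of _ X]) (auto simp: X_def)
  moreover have "nrm (z - of_int a) \<le> nrm (of_nat q)"
  proof -
    have "[int b = a] (mod int p)"
      by (simp add: b cong_def)
    from nrm_of_int_mod_le[OF this] have "nrm (X 0 - of_int a) \<le> 1 / real p"
      by (simp add: X_def abs_p)
    hence "nrm ((z - X 0) + (X 0 - of_int a)) \<le> 1 / real p"
      using zX by (intro nrm_add_le)
    thus ?thesis by (simp add: qp abs_p)
  qed
  ultimately show ?thesis by auto
qed

text \<open>Existence together with the separation of the roots makes the definite description in
  \<open>teich\<close> meaningful.\<close>

lemma teich_root_of_unity: "\<not> int p dvd a \<Longrightarrow> (teich p a :: 'a) ^ totient q = 1" (is "_ \<Longrightarrow> ?A")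
  and nrm_teich_diff_le: "\<not> int p dvd a \<Longrightarrow> nrm (teich p a - of_int a) \<le> 1 / real q" (is "_ \<Longrightarrow> ?B")
proof -
  assume a: "\<not> int p dvd a"
  let ?P = "\<lambda>z. z \<in> padic_int_set \<and> z ^ totient q = 1 \<and> nrm (z - of_int a) \<le> nrm (of_nat q)"
  obtain z where z: "?P z"
    using teich_exists[OF a] by blast
  have "w = z" if "?P w" for w
  proof (rule totient_roots_distinct)
    have "nrm ((w - of_int a) - (z - of_int a)) \<le> nrm (of_nat q)"
      using that z by (blast intro: nrm_diff_le)
    thus "nrm (w - z) \<le> nrm (of_nat q)" by simp
  qed (use that z in auto)
  with z have "?P (THE z. ?P z)"
    by (rule theI)
  thus ?A ?B
    using a nrm_q by (auto simp: teich_def)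
qed

lemma teich_eqI:
  assumes "\<not> int p dvd a" "z ^ totient q = 1" "nrm (z - of_int a) \<le> 1 / real q"
  shows "teich p a = z"
proof (rule totient_roots_distinct)
  have "nrm ((teich p a - of_int a) - (z - of_int a)) \<le> 1 / real q"
    using nrm_teich_diff_le[OF assms(1)] assms(3) by (rule nrm_diff_le)
  thus "nrm (teich p a - z) \<le> nrm (of_nat q)"
    by (simp add: nrm_q)
qed (use assms teich_root_of_unity in auto)

lemma nrm_teich [simp]: "\<not> int p dvd a \<Longrightarrow> nrm (teich p a) = 1"
  using nrm_root_of_unity teich_root_of_unity totient_q_pos by blast

lemma teich_neq_0: "\<not> int p dvd a \<Longrightarrow> (teich p a :: 'a) \<noteq> 0"
  using nrm_teich[of a] by force

lemma p_dvd_mult_iff: "int p dvd a * b \<longleftrightarrow> int p dvd a \<or> int p dvd b"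
  using prime_p by (simp add: prime_dvd_mult_iff)

lemma teich_mult: "(teich p (a * b) :: 'a) = teich p a * teich p b"
proof (cases "int p dvd a \<or> int p dvd b")
  case True
  hence "int p dvd a * b" by auto
  thus ?thesis using True by (auto simp: teich_def)
next
  case False
  show ?thesis
  proof (rule teich_eqI)
    have "teich p a * teich p b - of_int (a * b)
      = teich p a * (teich p b - of_int b) + of_int b * (teich p a - of_int a)"
      by (simp add: algebra_simps)
    also have "nrm \<dots> \<le> 1 / real q"
      using False nrm_teich_diff_le nrm_of_int_le_1 by (intro nrm_add_le nrm_mult_le_1) auto
    finally show "nrm (teich p a * teich p b - of_int (a * b)) \<le> 1 / real q" .
  qed (use False teich_root_of_unity in \<open>auto simp: p_dvd_mult_iff power_mult_distrib\<close>)
qed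

lemma teich_cong:
  assumes "[a = b] (mod int q)"
  shows "(teich p a :: 'a) = teich p b"
proof -
  have "[a = b] (mod int p)"
    using assms p_dvd_q by (meson cong_dvd_modulus of_nat_dvd_iff)
  hence dvd: "int p dvd a \<longleftrightarrow> int p dvd b"
    by (rule cong_dvd_iff)
  show ?thesis
  proof (cases "int p dvd a")
    case True
    thus ?thesis using dvd by (simp add: teich_def)
  next
    case False
    show ?thesis
    proof (rule teich_eqI[OF False])
      have "nrm ((teich p b - of_int b) - (of_int a - of_int b)) \<le> 1 / real q"
      proof (rule nrm_diff_le)
        show "nrm (teich p b - of_int b) \<le> 1 / real q"
          using False dvd by (intro nrm_teich_diff_le) auto
      qed (use nrm_of_int_mod_le[OF assms] nrm_q in auto)
      thus "nrm (teich p b - of_int a) \<le> 1 / real q" by simp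
    qed (use False dvd teich_root_of_unity in auto)
  qed
qed

lemma not_p_dvd_1: "\<not> int p dvd 1"
  using p_gt_1 by simp

lemma teich_1 [simp]: "(teich p 1 :: 'a) = 1"
  by (rule teich_eqI) (use p_gt_1 in auto)

lemma angle_mult: "(angle p (a * b) :: 'a) = angle p a * angle p b"
  by (simp add: angle_def teich_mult)

lemma nrm_angle_minus_1_le:
  assumes "\<not> int p dvd a"
  shows "nrm (angle p a - 1) \<le> 1 / real q"
proof -
  have "angle p a - 1 = (of_int a - teich p a) / (teich p a :: 'a)"
    using teich_neq_0[OF assms] by (simp add: angle_def field_simps)
  thus ?thesis
    using nrm_teich_diff_le[OF assms] assms by (simp add: nrm_divide nrm_minus_commute)
qed

section \<open>Mahler series and powers with exponents in the disk\<close>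

lemma disk_add: "s \<in> padic_disk p \<Longrightarrow> t \<in> padic_disk p \<Longrightarrow> (s + t :: 'a) \<in> padic_disk p"
  using abs_ultrametric[of s t] by (simp add: padic_disk_iff)

lemma disk_minus: "s \<in> padic_disk p \<Longrightarrow> (- s :: 'a) \<in> padic_disk p"
  by (simp add: padic_disk_iff)

lemma disk_unit: "nrm s \<le> 1 \<Longrightarrow> s \<in> padic_disk p"
  using rad_gt_1 by (simp add: padic_disk_iff)

lemma disk_of_nat: "(of_nat n :: 'a) \<in> padic_disk p"
  by (simp add: disk_unit nrm_of_nat_le_1)

lemma disk_diff: "s \<in> padic_disk p \<Longrightarrow> t \<in> padic_disk p \<Longrightarrow> (s - t :: 'a) \<in> padic_disk p"
  using disk_add[OF _ disk_minus] by fastforce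

lemma gbinomial_Suc_eq: "(s gchoose Suc k) = s * (((s - 1) gchoose k) / of_nat (Suc k) :: 'a)"
  using gbinomial_absorption[of k s] by (simp add: field_simps del: of_nat_Suc)

lemma tame_shift:
  assumes "\<And>k. nrm (d k) \<le> M / real q ^ k"
  shows "tame (\<lambda>k. d (Suc k) / of_nat (Suc k))"
proof -
  have "nrm (of_nat (Suc k) * (d (Suc k) / of_nat (Suc k))) \<le> (M / real q) / real q ^ k" for k
    using assms[of "Suc k"] by (simp del: of_nat_Suc)
  thus ?thesis unfolding tame_def by blast
qed

text \<open>Absorption pulls the factor s out of every term but the constant one, and the quotient
  is again a Mahler series, with argument s - 1. Taken at 1 - s, this splits off the pole of the
  L-function; applied to a power of <c>, it later cancels that pole.\<close>

lemma mahler_split: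
  assumes "\<And>k. nrm (d k) \<le> M / real q ^ k" "s \<in> padic_disk p"
  shows "mahler d s = d 0 + s * mahler (\<lambda>k. d (Suc k) / of_nat (Suc k)) (s - 1)"
proof -
  have "(\<lambda>k. s * (((s - 1) gchoose k) * (d (Suc k) / of_nat (Suc k)))) sums
      (s * mahler (\<lambda>k. d (Suc k) / of_nat (Suc k)) (s - 1))"
    using assms disk_unit[of 1]
    by (intro padic_sums_mult mahler_sums tame_shift[of d M] disk_diff) auto
  hence "(\<lambda>k. (s gchoose Suc k) * d (Suc k)) sums
      (s * mahler (\<lambda>k. d (Suc k) / of_nat (Suc k)) (s - 1))"
    unfolding gbinomial_Suc_eq by (simp add: mult.assoc)
  hence "(\<lambda>k. (s gchoose k) * d k) sums
      (d 0 + s * mahler (\<lambda>k. d (Suc k) / of_nat (Suc k)) (s - 1))"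
    using padic_sums_Suc_iff[of "\<lambda>k. (s gchoose k) * d k"] by simp
  thus ?thesis
    using mahler_sums[OF tameI assms(2), of d M] assms(1) sums_unique2 by blast
qed

text \<open>The remainder is estimated after the factor s has been removed, so that the estimate
  survives a later division by s. The denominators of the shifted coefficients cancel against the
  factor \<open>Suc k\<close> in the bound for binomial coefficients.\<close>

lemma mahler_linear_approx:
  assumes "\<And>k. nrm (d k) \<le> M / real q ^ k" "s \<in> padic_disk p"
    and B: "\<And>k. real q ^ Suc k * nrm (d (Suc (Suc k))) \<le> B"
  obtains e where "mahler d s = d 0 + s * (d 1 + e)" "nrm e \<le> B"
proof
  let ?d = "\<lambda>k. d (Suc k) / of_nat (Suc k)"
  let ?e = "mahler ?d (s - 1) - d 1"
  have s1: "s - 1 \<in> padic_disk p"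
    using assms(2) disk_unit[of 1] by (auto intro: disk_diff)
  show "mahler d s = d 0 + s * (d 1 + ?e)"
    using mahler_split[OF assms(1,2)] by simp
  have "(\<lambda>k. ((s - 1) gchoose k) * ?d k) sums (d 1 + ?e)"
    using mahler_sums[OF tame_shift s1, of d M] assms(1) by simp
  hence "(\<lambda>k. ((s - 1) gchoose Suc k) * ?d (Suc k)) sums ?e"
    using padic_sums_Suc_iff[of "\<lambda>k. ((s - 1) gchoose k) * ?d k"] by simp
  thus "nrm ?e \<le> B"
  proof (rule nrm_sums_le)
    fix k
    have "nrm (((s - 1) gchoose Suc k) * ?d (Suc k))
        \<le> nrm (of_nat (Suc (Suc k))) * real q ^ Suc k * nrm (?d (Suc k))"
      unfolding abs_mult by (intro mult_right_mono disk_gbinomial_le s1) auto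
    also have "\<dots> = real q ^ Suc k * nrm (d (Suc (Suc k)))"
      by (simp add: nrm_divide del: of_nat_Suc)
    also note B
    finally show "nrm (((s - 1) gchoose Suc k) * ?d (Suc k)) \<le> B" .
  qed
qed

lemma power_nrm_le:
  assumes "nrm x \<le> 1 / real q"
  shows "nrm (x ^ k) \<le> 1 / real q ^ k"
  using power_mono[OF assms nrm_nonneg, of k] by (simp add: nrm_power power_divide)

lemma tame_power: "nrm x \<le> 1 / real q \<Longrightarrow> tame (\<lambda>k. x ^ k)"
  by (rule tameI) (rule power_nrm_le)

text \<open>This is (1 + x)^s by its binomial series; \<open>angle_pow\<close> is the case
  \<open>x = angle p a - 1\<close>.\<close>

definition binpow :: "'a \<Rightarrow> 'a \<Rightarrow> 'a" where
  "binpow x s = mahler (\<lambda>k. x ^ k) s"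

lemma binpow_sums:
  "nrm x \<le> 1 / real q \<Longrightarrow> s \<in> padic_disk p \<Longrightarrow> (\<lambda>k. (s gchoose k) * x ^ k) sums binpow x s"
  unfolding binpow_def by (intro mahler_sums tame_power)

lemma binpow_of_nat: "binpow x (of_nat n) = (1 + x) ^ n"
  by (simp add: binpow_def mahler_of_nat binomial_ring[of x 1, simplified add.commute[of x]])

text \<open>In the Cauchy product of the two series the diagonals are evaluated by Vandermonde's
  identity.\<close>

lemma binpow_add:
  assumes x: "nrm x \<le> 1 / real q" and s: "s \<in> padic_disk p" and u: "u \<in> padic_disk p"
  shows "binpow x (s + u) = binpow x s * binpow x u"
proof -
  let ?f = "\<lambda>i k. ((s gchoose i) * x ^ i) * ((u gchoose k) * x ^ k)"
  obtain t M where 1: "0 \<le> t" "t < 1" "0 \<le> M" "\<And>k. nrm ((s gchoose k) * x ^ k) \<le> M * t ^ k"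
    using mahler_term_bound[OF tame_power[OF x] s] by metis
  obtain r N where 2: "0 \<le> r" "r < 1" "0 \<le> N" "\<And>k. nrm ((u gchoose k) * x ^ k) \<le> N * r ^ k"
    using mahler_term_bound[OF tame_power[OF x] u] by metis
  have "nrm (?f i k) \<le> (M * N) * (max t r) ^ (i + k)" for i k
  proof -
    have "nrm (?f i k) \<le> (M * t ^ i) * (N * r ^ k)"
      unfolding abs_mult[of "_ * x ^ i"] using 1 2 by (intro mult_mono) auto
    also have "\<dots> \<le> (M * max t r ^ i) * (N * max t r ^ k)"
      using 1 2 by (intro mult_mono mult_left_mono power_mono) auto
    finally show ?thesis by (simp add: power_add mult_ac)
  qed
  from geometric_small[OF _ _ this]
  have small: "\<exists>N. \<forall>i k. N \<le> i + k \<longrightarrow> nrm (?f i k) \<le> e" if "e > 0" for e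
    using that 1 2 by auto
  have rows: "?f i sums ((s gchoose i) * x ^ i * binpow x u)" for i
    by (intro padic_sums_mult binpow_sums x u)
  obtain T where T: "(\<lambda>i. (s gchoose i) * x ^ i * binpow x u) sums T"
      "(\<lambda>n. \<Sum>i\<le>n. ?f i (n - i)) sums T"
    using padic_double_sum[OF small rows] by blast
  have "(\<Sum>i\<le>n. ?f i (n - i)) = ((s + u) gchoose n) * x ^ n" for n
  proof -
    have "(\<Sum>i\<le>n. ?f i (n - i)) = (\<Sum>i\<le>n. (s gchoose i) * (u gchoose (n - i)) * x ^ n)"
      by (intro sum.cong) (auto simp: power_add[symmetric] mult_ac)
    thus ?thesis
      using gbinomial_Vandermonde[of s u n] by (simp add: atLeast0AtMost flip: sum_distrib_right)
  qed
  with T(2) have "T = binpow x (s + u)"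
    using binpow_sums[OF x disk_add[OF s u]] sums_unique2 by auto
  moreover have "T = binpow x s * binpow x u"
    using T(1) padic_sums_mult2[OF binpow_sums[OF x s]] sums_unique2 by blast
  ultimately show ?thesis by simp
qed

lemma binpow_minus_mult:
  assumes "nrm x \<le> 1 / real q" "s \<in> padic_disk p"
  shows "binpow x (- s) * binpow x s = 1"
  using binpow_add[OF assms(1) disk_minus[OF assms(2)] assms(2)] binpow_of_nat[of x 0] by simp

text \<open>The terms are at most 1 in absolute value, both for s and for -s, and the two powers are
  inverse to each other.\<close>

lemma nrm_binpow [simp]:
  assumes "nrm x \<le> 1 / real q" "s \<in> padic_disk p"
  shows "nrm (binpow x s) = 1"
proof -
  have le: "nrm (binpow x s) \<le> 1" if s: "s \<in> padic_disk p" for s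
    using binpow_sums[OF assms(1) s]
  proof (rule nrm_sums_le)
    fix k
    have "nrm ((s gchoose k) * x ^ k) \<le> (nrm (of_nat (Suc k)) * real q ^ k) * (1 / real q ^ k)"
      unfolding abs_mult by (intro mult_mono disk_gbinomial_le s power_nrm_le assms) auto
    also have "\<dots> \<le> 1"
      using q_gt_1 nrm_of_nat_le_1[of "Suc k"] by (simp del: of_nat_Suc)
    finally show "nrm ((s gchoose k) * x ^ k) \<le> 1" .
  qed
  have "1 = nrm (binpow x (- s)) * nrm (binpow x s)"
    using binpow_minus_mult[OF assms] by (simp flip: abs_mult)
  also have "\<dots> \<le> 1 * nrm (binpow x s)"
    by (intro mult_right_mono le disk_minus assms) auto
  finally show ?thesis using le[OF assms(2)] by simp
qed

text \<open>Umbrally, (1 + x)^s (1 + D)^s = (1 + x + (1 + x) D)^s with \<open>d i\<close> in place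
  of D^i. In the i-th term (1 + x)^s is written as (1 + x)^i (1 + x)^(s - i), and trinomial revision
  merges the two binomial coefficients. Powers of y as coefficients give multiplicativity of powers
  in the base; Bernoulli numbers give the series of the closed form.\<close>

lemma binpow_mult_mahler:
  assumes x: "nrm x \<le> 1 / real q" and s: "s \<in> padic_disk p"
    and d: "\<And>k. nrm (d k) \<le> M / real q ^ k"
  shows "binpow x s * mahler d s
    = mahler (\<lambda>n. \<Sum>i\<le>n. of_nat (n choose i) * x ^ (n - i) * ((1 + x) ^ i * d i)) s"
proof -
  let ?f = "\<lambda>i k. ((s gchoose i) * d i * (1 + x) ^ i) * (((s - of_nat i) gchoose k) * x ^ k)"
  let ?m = "\<lambda>n. \<Sum>i\<le>n. of_nat (n choose i) * x ^ (n - i) * ((1 + x) ^ i * d i)"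
  have x1: "nrm (1 + x) \<le> 1"
    using x q_gt_1 by (intro nrm_add_le) (auto intro: order_trans)
  have summand: "nrm (of_nat (n choose i) * x ^ (n - i) * ((1 + x) ^ i * d i)) \<le> M / real q ^ n"
    if "i \<le> n" for i n
  proof -
    have "nrm (x ^ (n - i) * ((1 + x) ^ i * d i)) \<le> (1 / real q ^ (n - i)) * (M / real q ^ i)"
      unfolding abs_mult[of "x ^ (n - i)"] using x1 x d[of i]
      by (intro mult_mono power_nrm_le nrm_mult_le_1) (auto simp: nrm_power power_le_one)
    also have "\<dots> = M / real q ^ n"
      using that by (simp flip: power_add)
    finally show ?thesis
      unfolding mult.assoc by (rule nrm_mult_le_1[OF nrm_of_nat_le_1])
  qed
  have M0: "0 \<le> M"
    using order_trans[OF nrm_nonneg d[of 0]] by simp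
  obtain t where t: "0 \<le> t" "t < 1"
    "\<And>k. nrm (s gchoose k) \<le> nrm (of_nat (Suc k)) * (t * real q) ^ k"
    using disk_gbinomial_bound[OF s] by metis
  have f_eq: "?f i k = (s gchoose (i + k)) *
      (of_nat ((i + k) choose i) * x ^ (i + k - i) * ((1 + x) ^ i * d i))" for i k
    using gbinomial_trinomial_revision[of i "i + k" s]
    by (simp add: binomial_gbinomial mult_ac)
  have "nrm (?f i k) \<le> M * t ^ (i + k)" for i k
  proof -
    have "nrm (?f i k) \<le> (1 * (t * real q) ^ (i + k)) * (M / real q ^ (i + k))"
      unfolding f_eq abs_mult[of "_ gchoose _"] using t(1)
      by (intro mult_mono summand order_trans[OF t(3)] mult_right_mono nrm_of_nat_le_1) auto
    also have "\<dots> = M * t ^ (i + k)"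
      using q_gt_1 by (simp add: power_mult_distrib)
    finally show ?thesis .
  qed
  from geometric_small[OF t(1,2) this]
  have small: "\<exists>N. \<forall>i k. N \<le> i + k \<longrightarrow> nrm (?f i k) \<le> e" if "e > 0" for e
    using that by blast
  have "?f i sums ((s gchoose i) * d i * (1 + x) ^ i * binpow x (s - of_nat i))" for i
    by (intro padic_sums_mult binpow_sums x disk_diff s disk_of_nat)
  moreover have "(1 + x) ^ i * binpow x (s - of_nat i) = binpow x s" for i
    using binpow_add[OF x disk_of_nat[of i] disk_diff[OF s disk_of_nat[of i]]]
    by (simp add: binpow_of_nat)
  ultimately have rows: "?f i sums ((s gchoose i) * d i * binpow x s)" for i
    by (simp only: mult.assoc)
  obtain T where T: "(\<lambda>i. (s gchoose i) * d i * binpow x s) sums T"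
      "(\<lambda>n. \<Sum>i\<le>n. ?f i (n - i)) sums T"
    using padic_double_sum[OF small rows] by blast
  have diag: "(\<Sum>i\<le>n. ?f i (n - i)) = (s gchoose n) * ?m n" for n
    unfolding sum_distrib_left
  proof (rule sum.cong)
    fix i assume "i \<in> {..n}"
    thus "?f i (n - i) = (s gchoose n) * (of_nat (n choose i) * x ^ (n - i) * ((1 + x) ^ i * d i))"
      using f_eq[of i "n - i"] by simp
  qed simp
  have "tame ?m"
    using M0 by (intro tameI[of _ M] nrm_sum_le summand) auto
  from sums_unique2[OF T(2)[unfolded diag] mahler_sums[OF this s]]
  have "T = mahler ?m s" .
  moreover have "T = mahler d s * binpow x s"
    using T(1) padic_sums_mult2[OF mahler_sums[OF tameI[OF d] s]] sums_unique2 by blast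
  ultimately show ?thesis by (simp add: mult.commute)
qed

lemma binpow_mult:
  assumes "nrm x \<le> 1 / real q" "nrm y \<le> 1 / real q" "s \<in> padic_disk p"
  shows "binpow x s * binpow y s = binpow (x + (1 + x) * y) s"
proof -
  have "(\<Sum>i\<le>n. of_nat (n choose i) * x ^ (n - i) * ((1 + x) ^ i * y ^ i)) = (x + (1 + x) * y) ^ n" for n
    unfolding add.commute[of x "(1 + x) * y"] binomial_ring power_mult_distrib
    by (intro sum.cong) (auto simp: mult_ac)
  thus ?thesis
    using binpow_mult_mahler[OF assms(1,3), of "\<lambda>k. y ^ k" 1] power_nrm_le[OF assms(2)]
    by (simp add: binpow_def)
qed

lemma angle_pow_eq: "angle_pow p a s = binpow (angle p a - 1) s"
  by (simp add: angle_pow_def binpow_def mahler_def)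

context
  fixes a :: int
  assumes a: "\<not> int p dvd a"
begin

lemma nrm_angle_pow [simp]: "s \<in> padic_disk p \<Longrightarrow> nrm (angle_pow p a s) = 1"
  using a by (simp add: angle_pow_eq nrm_angle_minus_1_le)

lemma angle_pow_minus: "s \<in> padic_disk p \<Longrightarrow> angle_pow p a (- s) = 1 / (angle_pow p a s :: 'a)"
  unfolding angle_pow_eq using binpow_minus_mult[OF nrm_angle_minus_1_le[OF a], of s]
  by (metis eq_divide_imp mult_zero_right zero_neq_one)

lemma angle_pow_1_plus:
  "s \<in> padic_disk p \<Longrightarrow> angle_pow p a (1 + s) = angle p a * (angle_pow p a s :: 'a)"
  unfolding angle_pow_eq
  using binpow_add[OF nrm_angle_minus_1_le[OF a] disk_of_nat[of 1], of s]
    binpow_of_nat[of "angle p a - 1" 1] by simp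

lemma angle_pow_analytic: "analytic_on_padic_disk p (angle_pow p a :: 'a \<Rightarrow> 'a)"
  unfolding angle_pow_eq[abs_def] binpow_def
  by (intro mahler_analytic tame_power nrm_angle_minus_1_le a)

lemma angle_pow_times_binpow:
  assumes "angle p b = angle p a * (1 + y)" "nrm y \<le> 1 / real q" "s \<in> padic_disk p"
  shows "angle_pow p b s = angle_pow p a s * binpow y s"
proof -
  have "(angle p a - 1) + (1 + (angle p a - 1)) * y = angle p b - 1"
    by (simp add: assms(1) algebra_simps)
  thus ?thesis
    using binpow_mult[OF nrm_angle_minus_1_le[OF a] assms(2,3)] unfolding angle_pow_eq by (simp only:)
qed

lemma angle_pow_mult:
  assumes "\<not> int p dvd b" "s \<in> padic_disk p"
  shows "angle_pow p (a * b) s = angle_pow p a s * (angle_pow p b s :: 'a)"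
  using angle_pow_times_binpow[of "a * b" "angle p b - 1" s] assms nrm_angle_minus_1_le
  by (simp add: angle_mult angle_pow_eq[of b])

end

end

section \<open>Bernoulli numbers\<close>

definition bern :: "nat \<Rightarrow> 'a::field_char_0" where
  "bern n = fact n * fps_nth (fps_X / (fps_exp 1 - 1)) n"

text \<open>
  With the umbral convention \<open>B\<^sup>i = B\<^sub>i\<close>, \<open>umbral n x y\<close> is \<open>(x + y B)\<^sup>n\<close>; in terms of the
  Bernoulli polynomials it is \<open>y\<^sup>n B\<^sub>n(x / y)\<close>.
\<close>

definition umbral :: "nat \<Rightarrow> 'a \<Rightarrow> 'a \<Rightarrow> 'a::field_char_0" where
  "umbral n x y = (\<Sum>i\<le>n. of_nat (n choose i) * x ^ (n - i) * (y ^ i * bern i))"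

text \<open>This is y t / (e^(y t) - 1), given by its coefficients so that y = 0 needs no separate
  treatment.\<close>

definition bern_fps :: "'a \<Rightarrow> 'a::field_char_0 fps" where
  "bern_fps y = Abs_fps (\<lambda>n. bern n * y ^ n / fact n)"

lemma subdegree_fps_exp_minus_1:
  "y \<noteq> 0 \<Longrightarrow> subdegree (fps_exp y - 1 :: 'a::field_char_0 fps) = 1"
  by (rule subdegreeI) auto

lemma fps_exp_minus_1_neq_0: "y \<noteq> 0 \<Longrightarrow> (fps_exp y - 1 :: 'a::field_char_0 fps) \<noteq> 0"
  using subdegree_fps_exp_minus_1[of y] by force

lemma bern_fps_mult_exp:
  "bern_fps y * (fps_exp y - 1) = fps_const y * (fps_X :: 'a::field_char_0 fps)"
proof (rule fps_ext)
  fix n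
  have "(fps_exp 1 - 1 :: 'a fps) dvd fps_X"
    using fps_dvd_iff[of "fps_exp 1 - 1 :: 'a fps" fps_X] subdegree_fps_exp_minus_1[of "1::'a"]
      fps_exp_minus_1_neq_0[of "1::'a"] by simp
  hence 1: "fps_X / (fps_exp 1 - 1) * (fps_exp 1 - 1) = (fps_X :: 'a fps)"
    by (rule dvd_div_mult_self)
  have "fps_nth (bern_fps y * (fps_exp y - 1)) n
      = (\<Sum>i=0..n. y ^ n * (fps_nth (fps_X / (fps_exp 1 - 1)) i * fps_nth (fps_exp 1 - 1) (n - i)))"
    unfolding fps_mult_nth bern_fps_def bern_def
    by (intro sum.cong) (auto simp: power_add[symmetric] algebra_simps)
  also have "\<dots> = y ^ n * fps_nth (fps_X :: 'a fps) n"
    by (subst 1[symmetric]) (simp add: fps_mult_nth sum_distrib_left)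
  finally show "fps_nth (bern_fps y * (fps_exp y - 1)) n = fps_nth (fps_const y * fps_X) n"
    by (cases "n = 1") (auto simp: fps_X_nth)
qed

lemma fact_mult_fps_exp_mult:
  "fact n * fps_nth (fps_exp x * G) n
    = (\<Sum>i\<le>n. of_nat (n choose i) * x ^ (n - i) * (fact i * fps_nth G i :: 'a::field_char_0))"
proof -
  have "fact n * fps_nth (fps_exp x * G) n = (\<Sum>i\<le>n. fact n * (fps_nth G i * (x ^ (n - i) / fact (n - i))))"
    by (simp add: mult.commute[of "fps_exp x"] fps_mult_nth sum_distrib_left atLeast0AtMost)
  also have "\<dots> = (\<Sum>i\<le>n. of_nat (n choose i) * x ^ (n - i) * (fact i * fps_nth G i))"
    by (intro sum.cong) (auto simp: binomial_fact field_simps)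
  finally show ?thesis .
qed

lemma umbral_eq_fps: "umbral n x y = fact n * fps_nth (fps_exp x * bern_fps y) n"
  by (simp add: fact_mult_fps_exp_mult umbral_def bern_fps_def mult_ac)

text \<open>The binomial sum multiplies the generating function by e^t, which shifts x by 1.\<close>

lemma sum_binomial_umbral: "(\<Sum>j\<le>n. of_nat (n choose j) * umbral j x y) = umbral n (1 + x) y"
  using fact_mult_fps_exp_mult[of n 1 "fps_exp x * bern_fps y"]
  by (simp add: umbral_eq_fps fps_exp_add_mult mult.assoc)

lemma umbral_scale: "umbral n (c * x) (c * y) = c ^ n * umbral n x y"
  unfolding umbral_def sum_distrib_left
  by (intro sum.cong) (auto simp: power_mult_distrib mult_ac simp flip: power_add)

text \<open>The geometric sum of the exponentials e^(b y t) is exactly the quotient of the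
  denominators e^(m y t) - 1 and e^(y t) - 1 of the two Bernoulli series.\<close>

lemma umbral_distribution:
  fixes x y :: "'a::field_char_0"
  assumes "y \<noteq> 0"
  shows "(\<Sum>b<m. umbral n (x + of_nat b * y) (of_nat m * y)) = of_nat m * umbral n x y"
proof -
  let ?E = "fps_exp y - 1 :: 'a fps"
  have "(\<Sum>b<m. fps_exp (x + of_nat b * y)) * ?E = fps_exp x * (fps_exp (of_nat m * y) - 1)"
    using power_diff_1_eq[of "fps_exp y" m]
    by (simp add: fps_exp_add_mult fps_exp_power_mult mult_ac flip: sum_distrib_left)
  hence "(\<Sum>b<m. fps_exp (x + of_nat b * y)) * bern_fps (of_nat m * y) * ?E
      = fps_exp x * (bern_fps (of_nat m * y) * (fps_exp (of_nat m * y) - 1))"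
    by (simp add: mult_ac)
  also have "\<dots> = of_nat m * (fps_exp x * bern_fps y) * ?E"
    by (simp add: bern_fps_mult_exp mult.assoc) (simp add: mult_ac fps_of_nat flip: fps_const_mult)
  finally have "(\<Sum>b<m. fps_exp (x + of_nat b * y)) * bern_fps (of_nat m * y)
      = of_nat m * (fps_exp x * bern_fps y)"
    using fps_exp_minus_1_neq_0[OF assms] by simp
  hence "fact n * fps_nth (\<Sum>b<m. fps_exp (x + of_nat b * y) * bern_fps (of_nat m * y)) n
      = fact n * fps_nth (fps_const (of_nat m) * (fps_exp x * bern_fps y)) n"
    by (simp add: sum_distrib_right fps_of_nat)
  thus ?thesis
    unfolding fps_mult_left_const_nth fps_sum_nth umbral_eq_fps sum_distrib_left
    by (simp only: mult.left_commute[of "of_nat m :: 'a"])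
qed

lemma gen_bernoulli_eq_umbral:
  fixes \<psi> :: "int \<Rightarrow> 'a::field_char_0"
  assumes "g > 0"
  shows "gen_bernoulli n g \<psi> = (\<Sum>a=1..g. \<psi> (int a) * umbral n (of_nat a) (of_nat g)) / of_nat g"
proof -
  let ?g = "of_nat g :: 'a"
  have g: "?g \<noteq> 0" using assms by simp
  have key: "fps_const k * fps_X * fps_exp x / (fps_exp ?g - 1)
      = fps_const (k / ?g) * (fps_exp x * bern_fps ?g)" for k x :: 'a
  proof -
    have "fps_const (k / ?g) * (fps_exp x * bern_fps ?g) * (fps_exp ?g - 1)
        = fps_const (k / ?g) * fps_exp x * (bern_fps ?g * (fps_exp ?g - 1))"
      by (simp only: mult_ac)
    also have "\<dots> = fps_const (k / ?g) * fps_const ?g * fps_X * fps_exp x"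
      unfolding bern_fps_mult_exp by (simp only: mult_ac)
    also have "fps_const (k / ?g) * fps_const ?g = fps_const k"
      using g by simp
    finally show ?thesis
      using fps_exp_minus_1_neq_0[OF g] by (metis nonzero_mult_div_cancel_right)
  qed
  show ?thesis
    by (simp only: gen_bernoulli_def key fps_sum_nth fps_mult_left_const_nth sum_distrib_left
        sum_divide_distrib umbral_eq_fps) (simp add: mult_ac)
qed

lemma sum_atLeast1_mult: "(\<Sum>a=1..g * m. h a) = (\<Sum>b<m. \<Sum>a=1..g. h (a + b * g :: nat))"
proof (induction m)
  case (Suc m)
  have "(\<Sum>a=1..g * Suc m. h a) = (\<Sum>a=1..g * m. h a) + (\<Sum>a=g * m + 1..g * m + g. h a)"
    using sum.ub_add_nat[of 1 "g * m" h g] by (simp add: add.commute)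
  also have "(\<Sum>a=g * m + 1..g * m + g. h a) = (\<Sum>a=1..g. h (a + m * g))"
    using sum.shift_bounds_cl_nat_ivl[of h 1 "m * g" g] by (simp add: ac_simps)
  finally show ?case using Suc by simp
qed auto

text \<open>One modulus F can thus serve all twists, although the conductor g varies with n: each
  class modulo g splits into F/g classes modulo F, which the distribution relation
  recombines.\<close>

lemma gen_bernoulli_eq_umbral_multiple:
  fixes \<psi> :: "int \<Rightarrow> 'a::field_char_0"
  assumes "F > 0" "g dvd F" "\<And>a. \<psi> (a + int g) = \<psi> a"
  shows "gen_bernoulli n g \<psi> = (\<Sum>a=1..F. \<psi> (int a) * umbral n (of_nat a) (of_nat F)) / of_nat F"
proof -
  obtain m where m: "F = g * m" using assms(2) by auto
  hence g: "g > 0" and m0: "m > 0" using assms(1) by auto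
  have per: "\<psi> (int (a + b * g)) = \<psi> (int a)" for a b
  proof (induction b)
    case (Suc b)
    thus ?case using assms(3)[of "int (a + b * g)"] by (simp add: algebra_simps)
  qed auto
  have "(\<Sum>a=1..F. \<psi> (int a) * umbral n (of_nat a) (of_nat F))
      = (\<Sum>a=1..g. \<psi> (int a) * (\<Sum>b<m. umbral n (of_nat a + of_nat b * of_nat g) (of_nat m * of_nat g)))"
    unfolding m sum_atLeast1_mult per
    by (subst sum.swap) (simp add: sum_distrib_left mult.commute)
  also have "\<dots> = of_nat m * (\<Sum>a=1..g. \<psi> (int a) * umbral n (of_nat a) (of_nat g))"
    using g by (simp add: umbral_distribution sum_distrib_left mult.left_commute)
  finally show ?thesis
    using g m0 by (simp add: gen_bernoulli_eq_umbral m)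
qed

text \<open>Faulhaber's formula with one factor m attached to the Bernoulli number. For m = p it
  becomes a recursion for p B_n with p-integral coefficients.\<close>

lemma power_sum_bern:
  "(\<Sum>i\<le>n. of_nat (n choose i) * (of_nat m ^ (n - i) / of_nat (Suc (n - i)))
      * (of_nat m * bern i :: 'a::field_char_0)) = (\<Sum>a<m. of_nat a ^ n)"
proof -
  let ?E = "fps_exp 1 - 1 :: 'a fps"
  have "(\<Sum>a<m. fps_exp (of_nat a)) * ?E = fps_exp (of_nat m) - (1 :: 'a fps)"
    using power_diff_1_eq[of "fps_exp (1::'a)" m] by (simp add: fps_exp_power_mult mult.commute)
  hence "bern_fps 1 * (fps_exp (of_nat m) - 1) = (bern_fps 1 * ?E) * (\<Sum>a<m. fps_exp (of_nat a))"
    by (simp add: mult_ac)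
  also have "\<dots> = fps_X * (\<Sum>a<m. fps_exp (of_nat a))"
    by (simp add: bern_fps_mult_exp)
  finally have "fps_nth (bern_fps 1 * (fps_exp (of_nat m) - 1)) (Suc n)
      = fps_nth (\<Sum>a<m. fps_exp (of_nat a :: 'a)) n"
    by simp
  hence eq: "(\<Sum>i\<le>Suc n. bern i / fact i * fps_nth (fps_exp (of_nat m) - 1) (Suc n - i))
      = (\<Sum>a<m. (of_nat a :: 'a) ^ n / fact n)"
    by (simp add: fps_mult_nth fps_sum_nth bern_fps_def atLeast0AtMost)
  have "(\<Sum>a<m. (of_nat a :: 'a) ^ n)
      = fact n * (\<Sum>i\<le>n. bern i / fact i * (of_nat m ^ Suc (n - i) / fact (Suc (n - i))))"
  proof -
    have "(\<Sum>i\<le>Suc n. bern i / fact i * fps_nth (fps_exp (of_nat m) - 1) (Suc n - i))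
        = (\<Sum>i\<le>n. bern i / fact i * (of_nat m ^ Suc (n - i) / fact (Suc (n - i)) :: 'a))"
      by (simp add: Suc_diff_le mult.commute del: fact_Suc power_Suc)
    thus ?thesis
      using eq by (simp add: sum_divide_distrib[symmetric] del: fact_Suc power_Suc)
  qed
  also have "\<dots> = (\<Sum>i\<le>n. of_nat (n choose i) * (of_nat m ^ (n - i) / of_nat (Suc (n - i)))
      * (of_nat m * bern i))"
    unfolding sum_distrib_left
    by (intro sum.cong) (auto simp: binomial_fact field_simps simp del: of_nat_Suc)
  finally show ?thesis ..
qed

context padic_complex_field
begin

lemma nrm_of_nat_ge:
  assumes "n > 0"
  shows "1 / real n \<le> nrm (of_nat n)"
  using assms
proof (induction n rule: less_induct)
  case (less n)
  show ?case
  proof (cases "p dvd n")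
    case True
    then obtain m where m: "n = p * m" by auto
    with less.prems p_gt_1 have "1 / real m \<le> nrm (of_nat m)"
      by (intro less.IH) auto
    thus ?thesis
      using p_gt_1 by (simp add: m abs_mult abs_p field_simps)
  qed (use less.prems nrm_of_nat_eq_1 in auto)
qed

text \<open>A weak form of von Staudt-Clausen. In the power sum over a < p the summand for i = n is
  p B_n, and the others are p-integral by induction, because j + 1 <= p^j makes p^j / (j + 1)
  p-integral.\<close>

lemma nrm_bern_le: "nrm (bern n) \<le> real p"
proof -
  have "nrm (of_nat p * bern n) \<le> 1"
  proof (induction n rule: less_induct)
    case (less n)
    let ?t = "\<lambda>i. of_nat (n choose i) * (of_nat p ^ (n - i) / of_nat (Suc (n - i))) * (of_nat p * bern i) :: 'a"
    have "{..n} = insert n {..<n}" by auto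
    hence "of_nat p * bern n = (\<Sum>a<p. of_nat a ^ n) - (\<Sum>i<n. ?t i)"
      using power_sum_bern[of n p, where ?'a = 'a] by (simp add: algebra_simps)
    moreover have "nrm (\<Sum>a<p. of_nat a ^ n) \<le> 1"
      by (intro nrm_sum_le) (auto simp: nrm_power nrm_of_nat_le_1 power_le_one)
    moreover have "nrm (\<Sum>i<n. ?t i) \<le> 1"
    proof (rule nrm_sum_le)
      fix i assume i: "i \<in> {..<n}"
      let ?j = "n - i"
      have "Suc ?j \<le> p ^ ?j"
        using less_exp[of ?j] power_mono[of 2 p ?j] p_gt_1 by linarith
      hence "1 / real p ^ ?j \<le> 1 / real (Suc ?j)"
        by (intro divide_left_mono) (use p_gt_1 in \<open>auto simp flip: of_nat_power simp del: of_nat_Suc\<close>)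
      also have "\<dots> \<le> nrm (of_nat (Suc ?j))"
        by (rule nrm_of_nat_ge) simp
      finally have "nrm (of_nat p ^ ?j / of_nat (Suc ?j)) \<le> 1"
        using p_gt_1 nrm_pos_iff[of "of_nat (Suc ?j)"]
        by (simp add: nrm_divide nrm_power abs_p power_divide field_simps del: of_nat_Suc nrm_pos_iff)
      thus "nrm (?t i) \<le> 1"
        using less.IH[of i] i by (intro nrm_mult_le_1[OF nrm_mult_le_1[OF nrm_of_nat_le_1]]) auto
    qed auto
    ultimately show ?case
      by (auto intro: nrm_diff_le)
  qed
  thus ?thesis
    using p_gt_1 by (simp add: abs_mult abs_p field_simps)
qed

end

section \<open>The explicit \<open>p\<close>-adic \<open>L\<close>-function\<close>

lemma dirichlet_char_mod_cong:
  assumes "dirichlet_char_mod f chi" "[a = b] (mod int f)"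
  shows "chi a = chi b"
proof -
  have nat: "chi (x + int n * int f) = chi x" for x n
  proof (induction n)
    case (Suc n)
    have "chi (x + int n * int f + int f) = chi (x + int n * int f)"
      using assms(1) unfolding dirichlet_char_mod_def by blast
    thus ?case using Suc by (simp add: algebra_simps)
  qed auto
  obtain k where k: "b = a + k * int f"
    using assms(2) by (auto simp: cong_iff_lin mult.commute)
  show ?thesis
  proof (cases "k \<ge> 0")
    case True
    thus ?thesis using nat[of a "nat k"] k by simp
  next
    case False
    thus ?thesis using nat[of b "nat (- k)"] k by (simp add: algebra_simps)
  qed
qed

lemma dirichlet_char_mod_eq_0_iff:
  assumes "dirichlet_char_mod f chi"
  shows "chi a = 0 \<longleftrightarrow> \<not> coprime a (int f)"
proof
  assume 0: "chi a = 0"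
  show "\<not> coprime a (int f)"
  proof
    assume "coprime a (int f)"
    then obtain b where "[a * b = 1] (mod int f)"
      using cong_solve_coprime_int by blast
    hence "chi (a * b) = chi 1"
      by (rule dirichlet_char_mod_cong[OF assms])
    thus False
      using 0 assms by (auto simp: dirichlet_char_mod_def)
  qed
qed (use assms in \<open>auto simp: dirichlet_char_mod_def\<close>)

text \<open>Otherwise gcd f N is a proper divisor of f, and primitivity supplies some a congruent to
  1 modulo the gcd with \<open>chi a \<noteq> 1\<close>. Such an a can be moved within its class
  modulo f to a number congruent to 1 modulo N, contradicting \<open>triv\<close>.\<close>

lemma dirichlet_char_conductor_dvdI:
  assumes chi: "dirichlet_char f chi"
    and triv: "\<And>a. coprime a (int f) \<Longrightarrow> [a = 1] (mod int N) \<Longrightarrow> chi a = 1"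
  shows "f dvd N"
proof (rule ccontr)
  assume "\<not> f dvd N"
  have mod: "dirichlet_char_mod f chi"
    using chi by (simp add: dirichlet_char_def)
  hence "f > 0" by (simp add: dirichlet_char_mod_def)
  have "gcd f N \<noteq> f"
    using \<open>\<not> f dvd N\<close> by (metis gcd_dvd2)
  hence "gcd f N < f"
    using \<open>f > 0\<close> by (meson dvd_imp_le gcd_dvd1 le_neq_implies_less)
  then obtain a where a: "coprime a (int f)" "[a = 1] (mod int (gcd f N))" "chi a \<noteq> 1"
    using chi unfolding dirichlet_char_def by (meson gcd_dvd1)
  have "gcd (int f) (int N) dvd 1 - a"
    using cong_sym[OF a(2)] by (simp add: cong_iff_dvd_diff gcd_int_int_eq)
  then obtain t where t: "[int f * t = 1 - a] (mod int N)"
    using cong_solve_dvd_int by blast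
  define a' where "a' = a + int f * t"
  have 1: "[a' = 1] (mod int N)"
    using cong_add[OF cong_refl[of a] t] by (simp add: a'_def)
  have 2: "[a = a'] (mod int f)"
    by (simp add: a'_def cong_def)
  have "chi a' = 1"
    using cong_imp_coprime[OF 2 a(1)] 1 by (rule triv)
  thus False
    using dirichlet_char_mod_cong[OF mod 2] a(3) by simp
qed

lemma dirichlet_char_trivial_iff:
  assumes "dirichlet_char f chi"
  shows "chi = (\<lambda>_. 1) \<longleftrightarrow> f = 1"
proof
  have mod: "dirichlet_char_mod f chi"
    using assms by (simp add: dirichlet_char_def)
  show "f = 1" if "chi = (\<lambda>_. 1)"
    using dirichlet_char_mod_eq_0_iff[OF mod, of 0] that by auto
  show "chi = (\<lambda>_. 1)" if "f = 1"
  proof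
    fix a
    have "chi a = chi 1"
      using that by (intro dirichlet_char_mod_cong[OF mod]) auto
    thus "chi a = 1"
      using mod by (simp add: dirichlet_char_mod_def)
  qed
qed

lemma bij_betw_mult_mod:
  fixes c F :: nat
  assumes "coprime c F" "F > 0"
  shows "bij_betw (\<lambda>a. (a * c) mod F) {..<F} {..<F}"
proof -
  have "inj_on (\<lambda>a. (a * c) mod F) {..<F}"
  proof (rule inj_onI)
    fix a b assume ab: "a \<in> {..<F}" "b \<in> {..<F}" "(a * c) mod F = (b * c) mod F"
    hence "[a = b] (mod F)"
      using cong_mult_rcancel_nat[of c F a b] assms(1) by (simp add: cong_def)
    thus "a = b"
      using ab cong_less_modulus_unique_nat by auto
  qed
  thus ?thesis
    using assms(2) by (intro bij_betw_imageI endo_inj_surj) auto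
qed

lemma sum_multiples:
  assumes "l > 0"
  shows "(\<Sum>a | a \<in> {1..l * m} \<and> l dvd a \<and> P a. h a) = (\<Sum>b | b \<in> {1..m} \<and> P (l * b). h (l * b :: nat))"
proof (rule sum.reindex_bij_witness[of _ "\<lambda>b. l * b" "\<lambda>a. a div l"])
qed (use assms in \<open>auto simp: Suc_le_eq div_le_dividend less_mult_imp_div_less
      dest: dvd_imp_le elim!: dvdE\<close>)

lemma sum_lessThan_eq_atLeast1:
  fixes h :: "nat \<Rightarrow> 'a::ab_group_add"
  assumes "h F = h 0"
  shows "(\<Sum>a=1..F. h a) = (\<Sum>a<F. h a)"
proof -
  have "h 0 + (\<Sum>a=1..F. h a) = (\<Sum>a\<le>F. h a)"
    by (simp add: sum.atLeast_Suc_atMost[of 0 F h] atMost_atLeast0)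
  also have "\<dots> = (\<Sum>a<F. h a) + h F"
    by (simp flip: lessThan_Suc_atMost)
  finally show ?thesis
    using assms by (simp add: add.commute)
qed

text \<open>Multiplication by a unit b with \<open>chi b \<noteq> 1\<close> permutes the residues
  and multiplies the sum by \<open>chi b\<close>; primitivity with d = 1 provides b. This is why the
  pole disappears for nontrivial chi.\<close>

lemma sum_dirichlet_char:
  fixes chi :: "int \<Rightarrow> 'a::field_char_0"
  assumes chi: "dirichlet_char f chi" and "f \<noteq> 1" "f dvd N"
  shows "(\<Sum>a=1..N. chi (int a)) = 0"
proof -
  have mod: "dirichlet_char_mod f chi"
    using chi by (simp add: dirichlet_char_def)
  hence f: "f > 1"
    using assms(2) by (auto simp: dirichlet_char_mod_def)
  obtain b where b: "coprime b (int f)" "chi b \<noteq> 1"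
    using chi f unfolding dirichlet_char_def by (metis one_dvd)
  define c where "c = nat (b mod int f)"
  have cb: "[int c = b] (mod int f)"
    using f by (simp add: c_def cong_def)
  have cop: "coprime c f"
    using cong_imp_coprime[OF cong_sym[OF cb] b(1)] by simp
  have "(\<Sum>a<f. chi (int a)) = (\<Sum>a<f. chi (int ((a * c) mod f)))"
    using sum.reindex_bij_betw[OF bij_betw_mult_mod[OF cop], of "\<lambda>a. chi (int a)"] f by simp
  also have "\<dots> = (\<Sum>a<f. chi b * chi (int a))"
  proof (rule sum.cong)
    fix a
    have "[int ((a * c) mod f) = int a * b] (mod int f)"
      using cong_mult[OF cong_refl[of "int a"] cb] by (simp add: zmod_int)
    hence "chi (int ((a * c) mod f)) = chi (int a * b)"
      by (rule dirichlet_char_mod_cong[OF mod])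
    thus "chi (int ((a * c) mod f)) = chi b * chi (int a)"
      using mod by (simp add: dirichlet_char_mod_def)
  qed simp
  also have "\<dots> = chi b * (\<Sum>a<f. chi (int a))"
    by (simp add: sum_distrib_left)
  finally have 0: "(\<Sum>a<f. chi (int a)) = 0"
    using b(2) by simp
  have per: "chi (int (a + k * f)) = chi (int a)" for a k
    by (rule dirichlet_char_mod_cong[OF mod]) (simp add: cong_def)
  have "(\<Sum>a=1..f. chi (int a)) = 0"
    using sum_lessThan_eq_atLeast1[of "\<lambda>a. chi (int a)" f] 0 per[of 0 1] by simp
  moreover obtain m where "N = f * m"
    using assms(3) by auto
  ultimately show ?thesis
    by (simp only: sum_atLeast1_mult per) simp
qed

lemma bern_0: "bern 0 = (1 :: 'a::field_char_0)"
  and bern_1: "bern 1 = (- 1 / 2 :: 'a::field_char_0)"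
proof -
  have eq: "fps_nth (bern_fps 1 * (fps_exp 1 - 1)) n = fps_nth (fps_X :: 'a fps) n" for n
    by (simp add: bern_fps_mult_exp)
  show 0: "bern 0 = (1 :: 'a)"
    using eq[of 1] by (simp add: fps_mult_nth bern_fps_def)
  have "{0..2} = {0, 1, 2 :: nat}" by auto
  with 0 eq[of 2] have "bern 1 + 1 / 2 = (0 :: 'a)"
    by (simp add: fps_mult_nth bern_fps_def fact_2 add.commute)
  thus "bern 1 = (- 1 / 2 :: 'a)"
    by (simp only: eq_neg_iff_add_eq_0 minus_divide_left[symmetric])
qed

context padic_complex_field
begin

text \<open>Nonzero values are roots of unity, by Euler's theorem.\<close>

lemma nrm_dirichlet_char_le_1:
  assumes "dirichlet_char_mod f chi"
  shows "nrm (chi a) \<le> 1"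
proof (cases "coprime a (int f)")
  case True
  have f: "f > 0"
    using assms by (simp add: dirichlet_char_mod_def)
  define c where "c = nat (a mod int f)"
  have ca: "[a = int c] (mod int f)"
    using f by (simp add: c_def cong_def)
  have "coprime c f"
    using cong_imp_coprime[OF ca True] by simp
  hence "[int (c ^ totient f) = int 1] (mod int f)"
    by (simp only: cong_int_iff euler_theorem)
  hence "chi (int c ^ totient f) = chi 1"
    using dirichlet_char_mod_cong[OF assms] by simp
  moreover have "chi (x ^ n) = chi x ^ n" for x n
    using assms by (induction n) (auto simp: dirichlet_char_mod_def)
  ultimately have "chi a ^ totient f = 1"
    using assms dirichlet_char_mod_cong[OF assms ca] by (simp add: dirichlet_char_mod_def)
  hence "nrm (chi a) = 1"
    using f by (intro nrm_root_of_unity[of _ "totient f"]) auto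
  thus ?thesis by simp
qed (use assms in \<open>simp add: dirichlet_char_mod_def\<close>)

lemma nrm_umbral_le:
  assumes "nrm x \<le> r" "nrm y \<le> r"
  shows "nrm (umbral n x y) \<le> real p * r ^ n"
  unfolding umbral_def
proof (rule nrm_sum_le)
  have r: "0 \<le> r"
    using order_trans[OF nrm_nonneg assms(1)] .
  thus "0 \<le> real p * r ^ n" by simp
  fix i assume i: "i \<in> {..n}"
  have "nrm (x ^ (n - i) * (y ^ i * bern i)) \<le> r ^ (n - i) * (r ^ i * real p)"
    unfolding abs_mult nrm_power using assms r
    by (intro mult_mono power_mono nrm_bern_le mult_nonneg_nonneg) auto
  also have "\<dots> = real p * r ^ n"
    using i by (simp add: power_add[symmetric] mult_ac)
  finally show "nrm (of_nat (n choose i) * x ^ (n - i) * (y ^ i * bern i)) \<le> real p * r ^ n"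
    unfolding mult.assoc by (rule nrm_mult_le_1[OF nrm_of_nat_le_1])
qed

lemma nrm_of_nat_multiple_le: "m dvd n \<Longrightarrow> nrm (of_nat n) \<le> nrm (of_nat m)"
  using nrm_of_int_mod_le[of "int n" 0 "int m"]
  by (simp add: cong_0_iff)

text \<open>
  The explicit formula for \<open>L\<^sub>p(s, chi)\<close>: the product of \<open>\<langle>a\<rangle>\<^sup>1\<^sup>-\<^sup>s\<close> and
  \<open>\<Sum>j. (1 - s gchoose j) * (F / a) ^ j * bern j\<close> is the single Mahler series in \<open>1 - s\<close> whose
  coefficients are \<open>(\<langle>a\<rangle> - 1 + F B / \<omega>(a))\<^sup>j\<close>, and the quotient by \<open>s - 1\<close> is taken termwise.
\<close>

definition L_coeff :: "(int \<Rightarrow> 'a) \<Rightarrow> nat \<Rightarrow> nat \<Rightarrow> 'a" where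
  "L_coeff chi F j = (\<Sum>a | a \<in> {1..F} \<and> \<not> p dvd a.
     chi (int a) * umbral j (angle p (int a) - 1) (of_nat F / teich p (int a)))"

definition L_explicit :: "(int \<Rightarrow> 'a) \<Rightarrow> nat \<Rightarrow> 'a \<Rightarrow> 'a" where
  "L_explicit chi F s = L_coeff chi F 0 / of_nat F / (s - 1)
     - mahler (\<lambda>k. L_coeff chi F (Suc k) / of_nat (Suc k)) (- s) / of_nat F"

lemma analytic_reflect_scale:
  assumes "analytic_on_padic_disk p (g :: 'a \<Rightarrow> 'a)"
  shows "analytic_on_padic_disk p (\<lambda>s. c * g (- s))"
proof -
  obtain b where b: "\<And>s. s \<in> padic_disk p \<Longrightarrow> (\<lambda>j. b j * s ^ j) sums g s"
    using assms unfolding analytic_on_padic_disk_def by blast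
  have "(\<lambda>j. (c * ((-1) ^ j * b j)) * s ^ j) sums (c * g (- s))" if "s \<in> padic_disk p" for s
    using padic_sums_mult[OF b[OF disk_minus[OF that]], of c]
    by (simp add: mult_ac power_minus[of s])
  thus ?thesis
    unfolding analytic_on_padic_disk_def by (intro exI[of _ "\<lambda>j. c * ((-1) ^ j * b j)"]) blast
qed

context
  fixes f F :: nat and chi :: "int \<Rightarrow> 'a"
  assumes chi: "dirichlet_char f chi"
    and F: "F > 0" "q dvd F" "f dvd F"
begin

private lemma chi_mod: "dirichlet_char_mod f chi"
  using chi by (simp add: dirichlet_char_def)

private lemma chi_mult: "chi (a * b) = chi a * chi b"
  using chi_mod by (simp add: dirichlet_char_mod_def)

private lemma p_dvd_F: "p dvd F"
  using F(2) p_dvd_q by (rule dvd_trans[rotated])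

private lemma nrm_F_le: "nrm (of_nat F) \<le> 1 / real q"
  using nrm_of_nat_multiple_le[OF F(2)] nrm_q by simp

lemma nrm_L_coeff_le: "nrm (L_coeff chi F j) \<le> real p / real q ^ j"
  unfolding L_coeff_def
proof (rule nrm_sum_le)
  fix a assume "a \<in> {a. a \<in> {1..F} \<and> \<not> p dvd a}"
  hence a: "\<not> int p dvd int a" by simp
  have "nrm (umbral j (angle p (int a) - 1) (of_nat F / teich p (int a)))
      \<le> real p * (1 / real q) ^ j"
    using nrm_angle_minus_1_le[OF a] nrm_F_le a by (intro nrm_umbral_le) (auto simp: nrm_divide)
  thus "nrm (chi (int a) * umbral j (angle p (int a) - 1) (of_nat F / teich p (int a)))
      \<le> real p / real q ^ j"
    by (intro nrm_mult_le_1 nrm_dirichlet_char_le_1[OF chi_mod]) (simp add: power_divide)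
qed auto

text \<open>The definition separates the pole, whereas estimates and special values need the closed
  form with denominator F (s - 1); \<open>mahler_split\<close> at 1 - s relates the two.\<close>

lemma L_explicit_eq:
  assumes "s \<in> padic_disk p" "s \<noteq> 1"
  shows "L_explicit chi F s = mahler (L_coeff chi F) (1 - s) / (of_nat F * (s - 1))"
proof -
  have "mahler (L_coeff chi F) (1 - s) = L_coeff chi F 0
      + (1 - s) * mahler (\<lambda>k. L_coeff chi F (Suc k) / of_nat (Suc k)) (- s)"
    using mahler_split[OF nrm_L_coeff_le, of "1 - s"] disk_diff[OF disk_unit[of 1] assms(1)] by simp
  moreover have "x / y / (s - 1) - z / y = (x + (1 - s) * z) / (y * (s - 1))" if "y \<noteq> 0" for x y z
    using assms(2) that by (simp add: divide_simps) (simp add: algebra_simps)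
  ultimately show ?thesis
    using F(1) by (simp only: L_explicit_def) simp
qed

lemma L_explicit_analytic_part:
  "analytic_on_padic_disk p
     (\<lambda>s. - mahler (\<lambda>k. L_coeff chi F (Suc k) / of_nat (Suc k)) (- s) / of_nat F)"
  using analytic_reflect_scale[OF mahler_analytic[OF tame_shift[OF nrm_L_coeff_le]], of "- 1 / of_nat F"]
  by simp

text \<open>The subtracted sum over multiples of p is the origin of the Euler factor at p.\<close>

lemma sum_not_p_dvd:
  "(\<Sum>a | a \<in> {1..F} \<and> \<not> p dvd a. h a) = (\<Sum>a=1..F. h a) - (\<Sum>b=1..F div p. h (p * b) :: 'a)"
proof -
  have "(\<Sum>a=1..F. h a) = (\<Sum>a | a \<in> {1..F} \<and> \<not> p dvd a. h a) + (\<Sum>a | a \<in> {1..F} \<and> p dvd a. h a)"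
    by (subst sum.union_disjoint[symmetric]) (auto intro!: sum.cong)
  moreover have "(\<Sum>a | a \<in> {1..F} \<and> p dvd a. h a) = (\<Sum>b=1..F div p. h (p * b))"
    using sum_multiples[where l = p and m = "F div p" and P = "\<lambda>_. True" and h = h] p_gt_1 p_dvd_F
    by (simp only: simp_thms Collect_mem_eq dvd_mult_div_cancel)
  ultimately show ?thesis by simp
qed

text \<open>A nonzero value at p makes g prime to p. So the sum over multiples of p either vanishes
  or runs over full periods of \<psi>.\<close>

lemma conductor_dvd_div_p:
  assumes "dirichlet_char g \<psi>" "g dvd F" "\<psi> (int p) \<noteq> (0 :: 'a)"
  shows "g dvd F div p"
proof -
  have "coprime (int p) (int g)"
    using assms(1,3) dirichlet_char_mod_eq_0_iff unfolding dirichlet_char_def by blast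
  hence "coprime g p"
    by (simp add: coprime_commute)
  moreover have "g dvd p * (F div p)"
    using assms(2) p_dvd_F by simp
  ultimately show ?thesis
    by (simp add: coprime_dvd_mult_right_iff)
qed

text \<open>Up to the factor F this is the residue at 1. For trivial chi it counts the a up to F
  that are prime to p; otherwise it consists of character sums that vanish.\<close>

lemma L_coeff_0: "L_coeff chi F 0 = (if f = 1 then of_nat F * (1 - 1 / of_nat p) else 0)"
proof -
  have "umbral 0 x y = (1 :: 'a)" for x y
    by (simp add: umbral_def bern_0)
  hence eq: "L_coeff chi F 0 = (\<Sum>a=1..F. chi (int a)) - chi (int p) * (\<Sum>b=1..F div p. chi (int b))"
    unfolding L_coeff_def sum_not_p_dvd by (simp add: chi_mult sum_distrib_left)
  show ?thesis
  proof (cases "f = 1")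
    case True
    hence "chi = (\<lambda>_. 1)"
      using dirichlet_char_trivial_iff[OF chi] by simp
    moreover obtain k where "F = p * k"
      using p_dvd_F by auto
    ultimately show ?thesis
      using eq True p_gt_1 by (simp add: right_diff_distrib)
  next
    case False
    thus ?thesis
      using eq sum_dirichlet_char[OF chi False] F(3) conductor_dvd_div_p[OF chi F(3)]
      by (cases "chi (int p) = 0") auto
  qed
qed

text \<open>At the argument n the Mahler series is a finite binomial sum, which turns the powers
  (<a> - 1 + F B / omega(a))^j into (<a> + F B / omega(a))^n = omega(a)^(-n) (a + F B)^n. So the
  twist appears, and generalized Bernoulli numbers remain, computed modulo F and, for the multiples
  of p, modulo F/p.\<close>

lemma L_explicit_special_value:
  assumes n: "n \<ge> 1" and tw: "primitive_twist p chi n g \<psi>"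
  shows "L_explicit chi F (1 - of_nat n)
    = - (1 - \<psi> (int p) * of_nat p ^ (n - 1)) * (gen_bernoulli n g \<psi> / of_nat n)"
proof -
  have psi: "dirichlet_char g \<psi>"
    and tw': "\<And>a. \<not> int p dvd a \<Longrightarrow> chi a \<noteq> 0 \<Longrightarrow> \<psi> a = chi a / teich p a ^ n"
    using tw by (auto simp: primitive_twist_def)
  have psi_mod: "dirichlet_char_mod g \<psi>"
    using psi by (simp add: dirichlet_char_def)
  have chi1: "chi 1 = 1" and psi1: "\<psi> 1 = 1"
    using chi_mod psi_mod by (auto simp: dirichlet_char_mod_def)
  have not_dvd: "\<not> int p dvd a" if "[a = 1] (mod int N)" "p dvd N" for a N
    using cong_dvd_iff[OF cong_dvd_modulus[OF that(1), of "int p"]] that(2) not_p_dvd_1 by simp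
  have gF: "g dvd F"
  proof (rule dirichlet_char_conductor_dvdI[OF psi])
    fix a assume a: "[a = 1] (mod int F)"
    have "[a = 1] (mod int q)" "[a = 1] (mod int f)"
      using a F by (auto intro: cong_dvd_modulus)
    hence "teich p a = (1 :: 'a)" "chi a = 1"
      using teich_cong[of a 1] dirichlet_char_mod_cong[OF chi_mod] chi1 by auto
    thus "\<psi> a = 1"
      using tw'[OF not_dvd[OF a p_dvd_F]] by simp
  qed
  have fg: "f dvd g * q"
  proof (rule dirichlet_char_conductor_dvdI[OF chi])
    fix a assume cop: "coprime a (int f)" and a: "[a = 1] (mod int (g * q))"
    have "[a = 1] (mod int q)" "[a = 1] (mod int g)"
      using a by (auto intro: cong_dvd_modulus)
    hence "teich p a = (1 :: 'a)" "\<psi> a = 1"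
      using teich_cong[of a 1] dirichlet_char_mod_cong[OF psi_mod] psi1 by auto
    thus "chi a = 1"
      using tw'[OF not_dvd[OF a dvd_mult[OF p_dvd_q]]] cop dirichlet_char_mod_eq_0_iff[OF chi_mod]
      by simp
  qed
  \<comment> \<open>The definition of \<open>primitive_twist\<close> leaves open the values at a
    prime to p with \<open>chi a = 0\<close>. Such an a shares a factor with f, hence with g q;
    being prime to q it shares one with g, so both sides vanish.\<close>
  have psi_eq: "\<psi> a = chi a / teich p a ^ n" if a: "\<not> int p dvd a" for a
  proof (cases "chi a = 0")
    case True
    have "coprime a (int p)"
      using a prime_p by (metis coprime_commute prime_imp_coprime prime_nat_int_transfer)
    hence "coprime a (int p ^ 2)"
      by simp
    moreover have "int q dvd int p ^ 2"
      by (auto simp: q_of_def)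
    ultimately have "coprime a (int q)"
      by (meson coprime_divisors dvd_refl)
    moreover have "\<not> coprime a (int f)"
      using True dirichlet_char_mod_eq_0_iff[OF chi_mod] by simp
    moreover have "int f dvd int g * int q"
      using fg by (metis of_nat_dvd_iff of_nat_mult)
    ultimately have "\<not> coprime a (int g)"
      using coprime_divisors[of a a "int f" "int g * int q"] by auto
    thus ?thesis
      using True dirichlet_char_mod_eq_0_iff[OF psi_mod] by simp
  qed (use tw' a in auto)
  have "mahler (L_coeff chi F) (of_nat n) = (\<Sum>a | a \<in> {1..F} \<and> \<not> p dvd a.
      chi (int a) * (\<Sum>j\<le>n. of_nat (n choose j) * umbral j (angle p (int a) - 1) (of_nat F / teich p (int a))))"
    unfolding mahler_of_nat L_coeff_def sum_distrib_left
    by (subst sum.swap) (simp add: mult_ac)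
  also have "\<dots> = (\<Sum>a | a \<in> {1..F} \<and> \<not> p dvd a. \<psi> (int a) * umbral n (of_nat a) (of_nat F))"
  proof (rule sum.cong)
    fix a assume "a \<in> {a. a \<in> {1..F} \<and> \<not> p dvd a}"
    hence a: "\<not> int p dvd int a" by simp
    have "(\<Sum>j\<le>n. of_nat (n choose j) * umbral j (angle p (int a) - 1) (of_nat F / teich p (int a)))
        = umbral n (inverse (teich p (int a)) * of_nat a) (inverse (teich p (int a)) * of_nat F :: 'a)"
      unfolding sum_binomial_umbral by (simp add: angle_def field_simps)
    from trans[OF this umbral_scale]
    show "chi (int a) * (\<Sum>j\<le>n. of_nat (n choose j) * umbral j (angle p (int a) - 1) (of_nat F / teich p (int a)))
        = \<psi> (int a) * umbral n (of_nat a) (of_nat F)"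
      by (simp add: psi_eq[OF a] power_inverse field_simps)
  qed simp
  also have "\<dots> = (\<Sum>a=1..F. \<psi> (int a) * umbral n (of_nat a) (of_nat F))
      - \<psi> (int p) * (\<Sum>b=1..F div p. \<psi> (int b) * umbral n (of_nat p * of_nat b) (of_nat F))"
    unfolding sum_not_p_dvd
    using psi_mod by (simp add: sum_distrib_left dirichlet_char_mod_def mult_ac)
  also have "(\<Sum>a=1..F. \<psi> (int a) * umbral n (of_nat a) (of_nat F)) = of_nat F * gen_bernoulli n g \<psi>"
    using gen_bernoulli_eq_umbral_multiple[OF F(1) gF, of \<psi> n] psi_mod F(1)
    by (simp add: dirichlet_char_mod_def)
  also have "\<psi> (int p) * (\<Sum>b=1..F div p. \<psi> (int b) * umbral n (of_nat p * of_nat b) (of_nat F))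
      = \<psi> (int p) * of_nat p ^ (n - 1) * (of_nat F * gen_bernoulli n g \<psi>)"
  proof (cases "\<psi> (int p) = 0")
    case False
    let ?F = "F div p"
    have FF: "F = p * ?F" "?F > 0"
      using p_dvd_F F(1) p_gt_1 by (auto elim!: dvdE)
    have "(\<Sum>b=1..?F. \<psi> (int b) * umbral n (of_nat p * of_nat b) (of_nat F))
        = of_nat p ^ n * (\<Sum>b=1..?F. \<psi> (int b) * umbral n (of_nat b) (of_nat ?F))"
      by (subst FF(1)) (simp only: of_nat_mult umbral_scale sum_distrib_left mult.left_commute)
    also have "\<dots> = of_nat p ^ n * (of_nat ?F * gen_bernoulli n g \<psi>)"
      using gen_bernoulli_eq_umbral_multiple[OF FF(2) conductor_dvd_div_p[OF psi gF False], of \<psi> n]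
        psi_mod FF(2) by (simp add: dirichlet_char_mod_def)
    also have "\<dots> = of_nat p ^ (n - 1) * (of_nat F * gen_bernoulli n g \<psi>)"
      using n by (subst (2) FF(1)) (cases n; simp add: mult_ac)
    finally show ?thesis by simp
  qed simp
  finally have "mahler (L_coeff chi F) (of_nat n)
      = (1 - \<psi> (int p) * of_nat p ^ (n - 1)) * (of_nat F * gen_bernoulli n g \<psi>)"
    by (simp add: algebra_simps)
  hence "mahler (L_coeff chi F) (1 - (1 - of_nat n)) / (of_nat F * (1 - of_nat n - 1))
      = (1 - \<psi> (int p) * of_nat p ^ (n - 1)) * (of_nat F * gen_bernoulli n g \<psi>)
        / (of_nat F * (1 - of_nat n - 1))"
    by simp
  moreover have arith: "k * (y * z) / (y * (1 - m - 1)) = - k * (z / m)" if "y \<noteq> 0" for k m y z :: 'a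
    using that by simp
  have "(1 - \<psi> (int p) * of_nat p ^ (n - 1)) * (of_nat F * gen_bernoulli n g \<psi>)
        / (of_nat F * (1 - of_nat n - 1))
      = - (1 - \<psi> (int p) * of_nat p ^ (n - 1)) * (gen_bernoulli n g \<psi> / of_nat n)"
    using F(1) by (intro arith) simp
  moreover have "(1 - of_nat n :: 'a) \<in> padic_disk p"
    by (intro disk_diff disk_of_nat disk_unit) simp
  ultimately show ?thesis
    using L_explicit_eq[of "1 - of_nat n"] n by (simp only:) simp
qed

lemma is_padic_L_explicit: "is_padic_L p chi (L_explicit chi F)"
  unfolding is_padic_L_def
proof (intro conjI allI impI)
  let ?g = "\<lambda>s. - mahler (\<lambda>k. L_coeff chi F (Suc k) / of_nat (Suc k)) (- s) / of_nat F"
  have eq: "L_explicit chi F s = L_coeff chi F 0 / of_nat F / (s - 1) + ?g s" for s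
    by (simp add: L_explicit_def)
  show "if chi = (\<lambda>_. 1)
      then \<exists>r g. r \<noteq> 0 \<and> analytic_on_padic_disk p g \<and>
                 (\<forall>s \<in> padic_disk p. s \<noteq> 1 \<longrightarrow> L_explicit chi F s = r / (s - 1) + g s)
      else analytic_on_padic_disk p (L_explicit chi F)"
  proof (cases "chi = (\<lambda>_. 1)")
    case True
    hence r: "L_coeff chi F 0 / of_nat F = 1 - 1 / of_nat p"
      using F(1) dirichlet_char_trivial_iff[OF chi] by (simp only: L_coeff_0) simp
    have "L_coeff chi F 0 / of_nat F \<noteq> 0"
      unfolding r using p_gt_1 by (simp add: field_simps)
    thus ?thesis
      using True eq L_explicit_analytic_part
      by (simp only: if_True simp_thms) (rule exI[of _ "L_coeff _ F 0 / of_nat F"], blast)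
  next
    case False
    hence "L_explicit chi F = ?g"
      using eq L_coeff_0 dirichlet_char_trivial_iff[OF chi] by auto
    thus ?thesis
      using False L_explicit_analytic_part by simp
  qed
qed (use L_explicit_special_value in auto)

end

end

section \<open>Uniqueness\<close>

context padic_complex_field
begin

text \<open>Convergence at s = 1 alone makes the coefficients tend to 0.\<close>

lemma power_series_bounded:
  assumes "\<And>s. s \<in> padic_disk p \<Longrightarrow> (\<lambda>j. b j * s ^ j) sums (g s :: 'a)"
  obtains B where "0 \<le> B" "\<And>j. nrm (b j) \<le> B"
proof -
  have "(\<lambda>j. nrm (b j)) \<longlonglongrightarrow> 0"
    using padic_sums_imp_tendsto_0[OF assms[OF disk_unit[of 1]]] by simp
  hence "Bseq (\<lambda>j. nrm (b j))"
    by (intro convergent_imp_Bseq convergentI)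
  then obtain B where "\<And>j. nrm (b j) \<le> B"
    by (auto simp: Bseq_def)
  moreover have "0 \<le> B"
    using order_trans[OF nrm_nonneg calculation[of 0]] .
  ultimately show ?thesis using that by blast
qed

lemma analytic_lipschitz_at_1:
  assumes "analytic_on_padic_disk p (g :: 'a \<Rightarrow> 'a)"
  obtains B where "0 \<le> B" "\<And>s. nrm s \<le> 1 \<Longrightarrow> nrm (g s - g 1) \<le> B * nrm (s - 1)"
proof -
  obtain b where b: "\<And>s. s \<in> padic_disk p \<Longrightarrow> (\<lambda>j. b j * s ^ j) sums g s"
    using assms unfolding analytic_on_padic_disk_def by blast
  obtain B where B: "0 \<le> B" "\<And>j. nrm (b j) \<le> B"
    using power_series_bounded[OF b] by metis
  have "nrm (g s - g 1) \<le> B * nrm (s - 1)" if s: "nrm s \<le> 1" for s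
  proof (rule nrm_sums_le)
    show "(\<lambda>j. b j * s ^ j - b j * 1 ^ j) sums (g s - g 1)"
      by (intro padic_sums_diff b disk_unit s) simp
    fix j
    have "nrm (b j * (s ^ j - 1 ^ j)) \<le> B * nrm (s - 1)"
      unfolding abs_mult using B s by (intro mult_mono nrm_power_diff_le) auto
    thus "nrm (b j * s ^ j - b j * 1 ^ j) \<le> B * nrm (s - 1)"
      by (simp add: right_diff_distrib)
  qed
  thus ?thesis using that B by blast
qed

text \<open>As 1 lies in the disk, s - 1 ranges over the same disk, and the binomial expansion of
  s^n about 1 can be rearranged there without loss of radius.\<close>

lemma power_series_recenter:
  assumes "analytic_on_padic_disk p (g :: 'a \<Rightarrow> 'a)"
  obtains e where "\<And>s. s \<in> padic_disk p \<Longrightarrow> (\<lambda>j. e j * (s - 1) ^ j) sums g s"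
proof -
  obtain b where b: "\<And>s. s \<in> padic_disk p \<Longrightarrow> (\<lambda>j. b j * s ^ j) sums g s"
    using assms unfolding analytic_on_padic_disk_def by blast
  let ?c = "\<lambda>i k. b (i + k) * of_nat ((i + k) choose i)"
  have b0: "(\<lambda>j. nrm (b j)) \<longlonglongrightarrow> 0"
    using padic_sums_imp_tendsto_0[OF b[OF disk_unit[of 1]]] by simp
  have c: "?c i sums suminf (?c i)" for i
  proof -
    have lim: "(\<lambda>k. nrm (b (i + k))) \<longlonglongrightarrow> 0"
      using LIMSEQ_ignore_initial_segment[OF b0, of i] by (simp add: add.commute)
    have "nrm (?c i k) \<le> max (nrm (b (i + k))) (nrm (b (i + k)))" for k
      using nrm_mult_le_1[OF nrm_of_nat_le_1 order_refl] by (simp add: mult.commute)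
    from tendsto_nrm_le[OF this lim lim] show ?thesis
      by (intro summable_sums padic_summable)
  qed
  have "(\<lambda>i. suminf (?c i) * (s - 1) ^ i) sums g s" if s: "s \<in> padic_disk p" for s
  proof -
    let ?f = "\<lambda>i k. (s - 1) ^ i * ?c i k"
    \<comment> \<open>A comparison point with |z| >= 1, so that |s - 1|^i is at most |z|^(i + k),
      and at which the original series still converges.\<close>
    define z where "z = (if nrm (s - 1) \<le> 1 then 1 else s - 1)"
    have z: "z \<in> padic_disk p" "nrm (s - 1) \<le> nrm z" "1 \<le> nrm z"
      using disk_diff[OF s disk_unit[of 1]] disk_unit[of 1] by (auto simp: z_def)
    have le: "nrm (?f i k) \<le> nrm (b (i + k) * z ^ (i + k))" for i k
    proof -
      have "nrm (s - 1) ^ i \<le> nrm z ^ (i + k)"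
        using power_mono[OF z(2) nrm_nonneg, of i] power_increasing[OF _ z(3), of i "i + k"] by simp
      hence "nrm (?f i k) \<le> nrm z ^ (i + k) * nrm (b (i + k))"
        unfolding abs_mult[of "(s - 1) ^ i"] nrm_power
        using nrm_mult_le_1[OF nrm_of_nat_le_1 order_refl] by (intro mult_mono) (auto simp: mult.commute)
      thus ?thesis by (simp add: abs_mult nrm_power mult.commute)
    qed
    have small: "\<exists>N. \<forall>i k. N \<le> i + k \<longrightarrow> nrm (?f i k) \<le> r" if "r > 0" for r
    proof -
      have "eventually (\<lambda>n. nrm (b n * z ^ n) < r) sequentially"
        using padic_sums_imp_tendsto_0[OF b[OF z(1)]] that by (rule order_tendstoD)
      thus ?thesis
        unfolding eventually_sequentially using le by (meson less_imp_le order_trans)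
    qed
    obtain T where T: "(\<lambda>i. (s - 1) ^ i * suminf (?c i)) sums T" "(\<lambda>n. \<Sum>i\<le>n. ?f i (n - i)) sums T"
      using padic_double_sum[OF small padic_sums_mult[OF c]] by blast
    have "(\<Sum>i\<le>n. ?f i (n - i)) = b n * s ^ n" for n
    proof -
      have "s ^ n = (\<Sum>i\<le>n. of_nat (n choose i) * (s - 1) ^ i)"
        using binomial_ring[of "s - 1" 1 n] by simp
      thus ?thesis
        by (auto simp: sum_distrib_left mult_ac intro!: sum.cong)
    qed
    hence "T = g s"
      using T(2) b[OF s] sums_unique2 by auto
    thus ?thesis
      using T(1) by (simp add: mult.commute)
  qed
  thus ?thesis by (rule that)
qed

text \<open>Once the coefficients below i vanish, dividing the series at \<open>x m\<close> by the
  i-th power of \<open>x m\<close> bounds \<open>e i\<close> by B |x m|, which tends to 0.\<close>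

lemma power_series_zero:
  assumes bounded: "\<And>j. nrm (e j) \<le> B"
    and x: "\<And>m. x m \<noteq> 0" "\<And>m. nrm (x m) \<le> 1" "(\<lambda>m. nrm (x m)) \<longlonglongrightarrow> 0"
    and zero: "\<And>m. (\<lambda>j. e j * x m ^ j) sums (0 :: 'a)"
  shows "e i = 0"
proof (induction i rule: less_induct)
  case (less i)
  have B0: "0 \<le> B"
    using order_trans[OF nrm_nonneg bounded[of 0]] .
  have "nrm (e i) \<le> B * nrm (x m)" for m
  proof -
    have "(\<lambda>j. e j * x m ^ j - (if j = i then e j * x m ^ j else 0)) sums (0 - e i * x m ^ i)"
      by (intro padic_sums_diff zero sums_single)
    hence "nrm (0 - e i * x m ^ i) \<le> B * nrm (x m) ^ Suc i"
    proof (rule nrm_sums_le)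
      fix j
      show "nrm (e j * x m ^ j - (if j = i then e j * x m ^ j else 0)) \<le> B * nrm (x m) ^ Suc i"
      proof (cases j i rule: linorder_cases)
        case greater
        hence "nrm (x m) ^ j \<le> nrm (x m) ^ Suc i"
          using x(2) by (intro power_decreasing) auto
        thus ?thesis
          using greater bounded B0 by (auto simp: abs_mult nrm_power intro!: mult_mono)
      qed (use less.IH B0 in auto)
    qed
    hence "nrm (e i) * nrm (x m) ^ i \<le> (B * nrm (x m)) * nrm (x m) ^ i"
      by (simp add: abs_mult nrm_power mult_ac)
    thus ?thesis
      using x(1)[of m] by (simp add: mult_le_cancel_right)
  qed
  moreover have "(\<lambda>m. B * nrm (x m)) \<longlonglongrightarrow> 0"
    using x(3) by (rule tendsto_mult_right_zero)
  ultimately have "nrm (e i) \<le> 0"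
    by (intro LIMSEQ_le_const[where a = "nrm (e i)"]) auto
  thus ?case
    using nrm_nonneg[of "e i"] by (metis antisym nrm_eq_0_iff)
qed

text \<open>Multiplication by x turns r/x + D(1 + x) into a power series with constant coefficient
  r, so the identity theorem covers the pole and the analytic part together.\<close>

lemma pole_plus_analytic_unique:
  assumes D: "analytic_on_padic_disk p D"
    and x: "\<And>m. x m \<noteq> 0" "\<And>m. nrm (x m) \<le> 1" "(\<lambda>m. nrm (x m)) \<longlonglongrightarrow> 0"
    and zero: "\<And>m. r / x m + D (1 + x m) = (0 :: 'a)"
  shows "r = 0" "s \<in> padic_disk p \<Longrightarrow> D s = 0"
proof -
  obtain e where e: "\<And>s. s \<in> padic_disk p \<Longrightarrow> (\<lambda>j. e j * (s - 1) ^ j) sums D s"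
    using power_series_recenter[OF D] by metis
  have "(\<lambda>j. e j * s ^ j) sums D (s + 1)" if "s \<in> padic_disk p" for s
    using e[OF disk_add[OF that disk_unit[of 1]]] by simp
  then obtain B where B: "0 \<le> B" "\<And>j. nrm (e j) \<le> B"
    using power_series_bounded[of e "\<lambda>s. D (s + 1)"] by metis
  define e' where "e' j = (case j of 0 \<Rightarrow> r | Suc k \<Rightarrow> e k)" for j
  have "(\<lambda>j. e' j * x m ^ j) sums 0" for m
  proof -
    have "(\<lambda>j. x m * (e j * (1 + x m - 1) ^ j)) sums (x m * D (1 + x m))"
      by (intro padic_sums_mult e disk_add disk_unit x) simp
    hence "(\<lambda>j. e' (Suc j) * x m ^ Suc j) sums (x m * D (1 + x m))"
      by (simp add: e'_def mult_ac)
    hence "(\<lambda>j. e' j * x m ^ j) sums (r + x m * D (1 + x m))"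
      using padic_sums_Suc_iff[of "\<lambda>j. e' j * x m ^ j"] by (simp add: e'_def)
    moreover have "r + x m * D (1 + x m) = x m * (r / x m + D (1 + x m))"
      using x(1)[of m] by (simp add: field_simps)
    ultimately show ?thesis by (simp only: zero mult_zero_right)
  qed
  moreover have "nrm (e' j) \<le> max B (nrm r)" for j
    using B by (cases j) (auto simp: e'_def le_max_iff_disj)
  ultimately have *: "e' j = 0" for j
    using power_series_zero[of e' "max B (nrm r)" x j] x by blast
  show "r = 0"
    using *[of 0] by (simp add: e'_def)
  have "e j = 0" for j
    using *[of "Suc j"] by (simp add: e'_def)
  thus "D s = 0" if "s \<in> padic_disk p"
    using e[OF that] sums_unique2[OF sums_zero] by auto
qed

lemma is_padic_L_pole_form:
  assumes "is_padic_L p chi (L :: 'a \<Rightarrow> 'a)"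
  obtains r g where "analytic_on_padic_disk p g"
    "\<And>s. s \<in> padic_disk p \<Longrightarrow> s \<noteq> 1 \<Longrightarrow> L s = r / (s - 1) + g s"
proof (cases "chi = (\<lambda>_. 1)")
  case True
  thus ?thesis
    using assms that unfolding is_padic_L_def by auto
next
  case False
  thus ?thesis
    using assms that[of L 0] unfolding is_padic_L_def by auto
qed

lemma primitive_twist_self:
  assumes "dirichlet_char f chi" "totient q dvd n"
  shows "primitive_twist p chi n f (chi :: int \<Rightarrow> 'a)"
proof -
  obtain k where "n = totient q * k"
    using assms(2) by auto
  thus ?thesis
    using assms(1) unfolding primitive_twist_def by (auto simp: power_mult teich_root_of_unity)
qed

lemma analytic_diff:
  assumes "analytic_on_padic_disk p (g :: 'a \<Rightarrow> 'a)" "analytic_on_padic_disk p h"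
  shows "analytic_on_padic_disk p (\<lambda>s. g s - h s)"
proof -
  obtain b c where bc: "\<And>s. s \<in> padic_disk p \<Longrightarrow> (\<lambda>j. b j * s ^ j) sums g s"
     "\<And>s. s \<in> padic_disk p \<Longrightarrow> (\<lambda>j. c j * s ^ j) sums h s"
    using assms unfolding analytic_on_padic_disk_def by metis
  have "(\<lambda>j. (b j - c j) * s ^ j) sums (g s - h s)" if "s \<in> padic_disk p" for s
    using padic_sums_diff[OF bc[OF that]] by (simp add: left_diff_distrib)
  thus ?thesis
    unfolding analytic_on_padic_disk_def by (intro exI[of _ "\<lambda>j. b j - c j"] ballI)
qed

text \<open>
  The points \<open>1 - n\<close> with \<open>n\<close> divisible by the order of \<open>\<omega>\<close>, where the twist is \<open>chi\<close> itself,
  accumulate at \<open>1\<close>.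
\<close>

lemma is_padic_L_unique:
  assumes chi: "dirichlet_char f chi"
    and L: "is_padic_L p chi L" "is_padic_L p chi (L' :: 'a \<Rightarrow> 'a)"
    and s: "s \<in> padic_disk p" "s \<noteq> 1"
  shows "L s = L' s"
proof -
  obtain r g where g: "analytic_on_padic_disk p g"
    "\<And>s. s \<in> padic_disk p \<Longrightarrow> s \<noteq> 1 \<Longrightarrow> L s = r / (s - 1) + g s"
    using is_padic_L_pole_form[OF L(1)] by metis
  obtain r' g' where g': "analytic_on_padic_disk p g'"
    "\<And>s. s \<in> padic_disk p \<Longrightarrow> s \<noteq> 1 \<Longrightarrow> L' s = r' / (s - 1) + g' s"
    using is_padic_L_pole_form[OF L(2)] by metis
  define n where "n m = totient q * p ^ m" for m
  define x where "x m = (- of_nat (n m) :: 'a)" for m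
  have n1: "n m \<ge> 1" for m
    using q_pos p_gt_1 by (simp add: n_def Suc_le_eq)
  have x0: "x m \<noteq> 0" for m
    using n1[of m] by (simp add: x_def)
  have x1: "nrm (x m) \<le> 1" for m
    using nrm_of_nat_le_1 by (simp add: x_def)
  have "nrm (x m) \<le> max ((1 / real p) ^ m) ((1 / real p) ^ m)" for m
    using nrm_mult_le_1[OF nrm_of_nat_le_1, of "of_nat p ^ m" "(1 / real p) ^ m" "totient q"]
    by (simp add: x_def n_def nrm_power abs_p)
  note le = this
  have "(\<lambda>m. (1 / real p) ^ m) \<longlonglongrightarrow> 0"
    using p_gt_1 by (intro LIMSEQ_power_zero) auto
  from tendsto_nrm_le[OF le this this] have xlim: "(\<lambda>m. nrm (x m)) \<longlonglongrightarrow> 0" .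
  have "(r - r') / x m + (g (1 + x m) - g' (1 + x m)) = 0" for m
  proof -
    have tw: "primitive_twist p chi (n m) f chi"
      using chi by (rule primitive_twist_self) (simp add: n_def)
    have "L (1 - of_nat (n m)) = L' (1 - of_nat (n m))"
      using L n1[of m] tw unfolding is_padic_L_def by metis
    moreover have "1 + x m \<in> padic_disk p"
      by (intro disk_add disk_unit x1) simp
    moreover have "1 + x m \<noteq> 1" "1 + x m = 1 - of_nat (n m)"
      using x0 by (auto simp: x_def)
    ultimately have "r / x m + g (1 + x m) = r' / x m + g' (1 + x m)"
      using g(2)[of "1 + x m"] g'(2)[of "1 + x m"] by simp
    thus ?thesis
      unfolding diff_divide_distrib add_diff_add[symmetric] by simp
  qed
  note * = pole_plus_analytic_unique[OF analytic_diff[OF g(1) g'(1)] x0 x1 xlim this]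
  show ?thesis
    using g(2)[OF s] g'(2)[OF s] *(1) *(2)[OF s(1)] by simp
qed

lemma padic_L_eq_explicit:
  assumes "dirichlet_char f (chi :: int \<Rightarrow> 'a)" "F > 0" "q dvd F" "f dvd F"
    and "s \<in> padic_disk p" "s \<noteq> 1"
  shows "padic_L p chi s = L_explicit chi F s"
proof -
  have ex: "is_padic_L p chi (L_explicit chi F)"
    using assms by (intro is_padic_L_explicit)
  hence "is_padic_L p chi (padic_L p chi)"
    unfolding padic_L_def by (rule someI[where P = "is_padic_L p chi"])
  from is_padic_L_unique[OF assms(1) this ex assms(5,6)] show ?thesis .
qed

end

section \<open>First-order approximation\<close>

context padic_complex_field
begin

text \<open>\<open>Lim\<close> at 1 is determined only if 1 is not isolated; the points 1 + p^m
  approach it.\<close>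

lemma at_1_neq_bot: "at (1 :: 'a) \<noteq> bot"
proof
  assume "at (1 :: 'a) = bot"
  hence "\<exists>d>0. \<forall>x::'a. x = 1 \<or> \<not> dist x 1 < d"
    using eventually_at[of "\<lambda>_. False" "1 :: 'a" UNIV] by simp
  then obtain d where d: "d > 0" "\<And>x::'a. x \<noteq> 1 \<Longrightarrow> d \<le> nrm (x - 1)"
    by (auto simp: dist_abs not_less)
  obtain m where "(1 / real p) ^ m < d"
    using real_arch_pow_inv[OF d(1), of "1 / real p"] p_gt_1 by auto
  thus False
    using d(2)[of "1 + of_nat p ^ m"] p_gt_1 by (simp add: nrm_power abs_p)
qed

text \<open>A substitute for continuity at 1 that follows directly from bounded power series
  coefficients and is preserved by sums and products. The unit ball suffices, being a neighbourhood
  of 1.\<close>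

definition lip_at_1 :: "('a \<Rightarrow> 'a) \<Rightarrow> bool" where
  "lip_at_1 g \<longleftrightarrow> (\<exists>B. 0 \<le> B \<and> (\<forall>t. nrm t \<le> 1 \<longrightarrow> nrm (g t - g 1) \<le> B * nrm (t - 1)))"

lemma lip_at_1_analytic: "analytic_on_padic_disk p (g :: 'a \<Rightarrow> 'a) \<Longrightarrow> lip_at_1 g"
  unfolding lip_at_1_def using analytic_lipschitz_at_1[of g] by metis

lemma lip_at_1_const: "lip_at_1 (\<lambda>_. c)"
  unfolding lip_at_1_def by (rule exI[of _ 0]) simp

lemma lip_at_1_add:
  assumes "lip_at_1 g" "lip_at_1 h"
  shows "lip_at_1 (\<lambda>t. g t + h t)"
proof -
  obtain B where B: "0 \<le> B" "\<And>t. nrm t \<le> 1 \<Longrightarrow> nrm (g t - g 1) \<le> B * nrm (t - 1)"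
    using assms(1) unfolding lip_at_1_def by blast
  obtain C where C: "0 \<le> C" "\<And>t. nrm t \<le> 1 \<Longrightarrow> nrm (h t - h 1) \<le> C * nrm (t - 1)"
    using assms(2) unfolding lip_at_1_def by blast
  have "nrm ((g t - g 1) + (h t - h 1)) \<le> max B C * nrm (t - 1)" if "nrm t \<le> 1" for t
    by (intro nrm_add_le order_trans[OF B(2)[OF that]] order_trans[OF C(2)[OF that]] mult_right_mono)
       auto
  hence "\<And>t. nrm t \<le> 1 \<Longrightarrow> nrm ((g t + h t) - (g 1 + h 1)) \<le> max B C * nrm (t - 1)"
    by (simp add: add_diff_add)
  thus ?thesis
    unfolding lip_at_1_def using B(1) by (intro exI[of _ "max B C"]) auto
qed

lemma lip_at_1_mult:
  assumes "lip_at_1 g" "lip_at_1 h"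
  shows "lip_at_1 (\<lambda>t. g t * h t)"
proof -
  obtain B where B: "0 \<le> B" "\<And>t. nrm t \<le> 1 \<Longrightarrow> nrm (g t - g 1) \<le> B * nrm (t - 1)"
    using assms(1) unfolding lip_at_1_def by blast
  obtain C where C: "0 \<le> C" "\<And>t. nrm t \<le> 1 \<Longrightarrow> nrm (h t - h 1) \<le> C * nrm (t - 1)"
    using assms(2) unfolding lip_at_1_def by blast
  define D where "D = max (nrm (g 1)) B"
  have "nrm (g t * h t - g 1 * h 1) \<le> max (D * C) (nrm (h 1) * B) * nrm (t - 1)"
    if t: "nrm t \<le> 1" for t
  proof -
    have t1: "nrm (t - 1) \<le> 1"
      using t by (intro nrm_diff_le) auto
    have "nrm (g t - g 1) \<le> B"
      using B(2)[OF t] mult_left_mono[OF t1 B(1)] by simp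
    hence "nrm ((g t - g 1) + g 1) \<le> D"
      unfolding D_def by (intro nrm_add_le) auto
    hence 1: "nrm (g t * (h t - h 1)) \<le> (D * C) * nrm (t - 1)"
      unfolding abs_mult mult.assoc using C(2)[OF t] by (intro mult_mono) (auto simp: D_def le_max_iff_disj)
    have 2: "nrm (h 1 * (g t - g 1)) \<le> (nrm (h 1) * B) * nrm (t - 1)"
      unfolding abs_mult mult.assoc using B(2)[OF t] by (intro mult_left_mono) auto
    have "nrm (g t * (h t - h 1) + h 1 * (g t - g 1)) \<le> max (D * C) (nrm (h 1) * B) * nrm (t - 1)"
      by (intro nrm_add_le order_trans[OF 1] order_trans[OF 2] mult_right_mono) auto
    thus ?thesis by (simp add: algebra_simps)
  qed
  moreover have "0 \<le> max (D * C) (nrm (h 1) * B)"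
    using B(1) by (simp add: le_max_iff_disj)
  ultimately show ?thesis
    unfolding lip_at_1_def by blast
qed

lemma lip_at_1_sum: "(\<And>a. a \<in> A \<Longrightarrow> lip_at_1 (g a)) \<Longrightarrow> lip_at_1 (\<lambda>t. \<Sum>a\<in>A. g a t)"
  by (induction A rule: infinite_finite_induct) (auto intro: lip_at_1_const lip_at_1_add)

lemma lip_at_1_tendsto:
  assumes "lip_at_1 g" and eq: "\<And>t. nrm t \<le> 1 \<Longrightarrow> t \<noteq> 1 \<Longrightarrow> H t = g t"
  shows "(H \<longlongrightarrow> g 1) (at 1)"
proof (rule metric_LIM_I)
  fix r :: real assume r: "r > 0"
  obtain B where B: "0 \<le> B" "\<And>t. nrm t \<le> 1 \<Longrightarrow> nrm (g t - g 1) \<le> B * nrm (t - 1)"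
    using assms(1) unfolding lip_at_1_def by blast
  define d where "d = min 1 (r / (B + 1))"
  have "dist (H t) (g 1) < r" if t: "t \<noteq> 1" "dist t 1 < d" for t
  proof -
    have t1: "nrm (t - 1) < d"
      using t by (simp add: dist_abs)
    have "nrm ((t - 1) + 1) \<le> 1"
      using t1 by (intro nrm_add_le) (auto simp: d_def)
    hence "nrm (H t - g 1) \<le> B * nrm (t - 1)"
      using B(2) eq t(1) by simp
    also have "\<dots> \<le> (B + 1) * nrm (t - 1)"
      by (intro mult_right_mono) auto
    also have "\<dots> < r"
      using t1 B(1) by (simp add: d_def less_divide_eq mult.commute)
    finally show ?thesis by (simp add: dist_abs)
  qed
  moreover have "d > 0"
    using r B(1) by (simp add: d_def)
  ultimately show "\<exists>s>0. \<forall>x. x \<noteq> 1 \<and> dist x 1 < s \<longrightarrow> dist (H x) (g 1) < r"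
    by blast
qed

text \<open>The constant C is not enlarged: at t = 1 + p^m with m large both g t and g t - g 1 are
  at most C in absolute value, and ultrametrically so is their difference.\<close>

lemma lip_at_1_nrm_le:
  assumes "lip_at_1 g" "0 < C" and le: "\<And>t. nrm t \<le> 1 \<Longrightarrow> t \<noteq> 1 \<Longrightarrow> nrm (g t) \<le> C"
  shows "nrm (g 1) \<le> C"
proof -
  obtain B where B: "0 \<le> B" "\<And>t. nrm t \<le> 1 \<Longrightarrow> nrm (g t - g 1) \<le> B * nrm (t - 1)"
    using assms(1) unfolding lip_at_1_def by blast
  have "0 < C / (B + 1)"
    using assms(2) B(1) by simp
  then obtain m where m: "(1 / real p) ^ m < C / (B + 1)"
    using real_arch_pow_inv[of "C / (B + 1)" "1 / real p"] p_gt_1 by auto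
  define t :: 'a where "t = 1 + of_nat p ^ m"
  have t1: "nrm (t - 1) = (1 / real p) ^ m"
    by (simp add: t_def nrm_power abs_p)
  have t: "nrm t \<le> 1" "t \<noteq> 1"
    using p_gt_1 nrm_of_nat_le_1[of "1 + p ^ m"] by (auto simp: t_def)
  have "nrm (g t - g 1) \<le> (B + 1) * nrm (t - 1)"
    using B(2)[OF t(1)] by (simp add: distrib_right add_increasing2)
  also have "\<dots> \<le> C"
    using m B(1) by (simp add: t1 less_divide_eq mult.commute)
  finally have "nrm (g t - (g t - g 1)) \<le> C"
    by (rule nrm_diff_le[OF le[OF t]])
  thus ?thesis by simp
qed

text \<open>From a c = r + F k it follows that -r = F k modulo c. So k is the digit itself, as a < F
  gives 0 <= k < c.\<close>

lemma eps_digit: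
  fixes a c F :: nat
  assumes "coprime c F" "c > 1" "a < F"
  shows "(eps (int ((a * c) mod F)) (int c) (int F) :: 'a)
    = (of_nat c - 1) / 2 - of_nat ((a * c) div F)"
proof -
  define r k where "r = (a * c) mod F" and "k = (a * c) div F"
  let ?i = "modular_inverse (int c) (int F)"
  have ac: "a * c = r + F * k"
    by (simp add: r_def k_def)
  have k: "k < c"
    using assms by (simp add: k_def less_mult_imp_div_less mult.commute)
  have "[- int r = int F * int k] (mod int c)"
  proof -
    have "- int r - int F * int k = - (int a * int c)"
      using arg_cong[OF ac, of int] by simp
    thus ?thesis by (simp add: cong_iff_dvd_diff)
  qed
  hence "[- int r * ?i = int F * int k * ?i] (mod int c)"
    by (intro cong_mult cong_refl)
  also have "int F * int k * ?i = int k * (int F * ?i)"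
    by (simp add: mult_ac)
  also have "[int k * (int F * ?i) = int k * 1] (mod int c)"
    using assms(1) by (intro cong_mult cong_refl cong_modular_inverse1) (simp add: coprime_commute)
  finally have "(- int r * ?i) mod int c = int k"
    using k by (simp add: cong_def)
  thus ?thesis
    unfolding eps_def r_def[symmetric] k_def[symmetric] by simp
qed

lemma nrm_half_le: "nrm (1 / 2) \<le> real p"
proof (cases "p = 2")
  case True
  have "nrm (of_nat 2) = 1 / real 2"
    using abs_p unfolding True .
  hence half: "nrm 2 = 1 / 2" by simp
  show ?thesis
    unfolding nrm_divide half using True by simp
next
  case False
  hence "\<not> p dvd 2"
    using p_gt_1 by (auto dest: dvd_imp_le)
  hence "nrm (of_nat 2) = 1"
    by (rule nrm_of_nat_eq_1)
  thus ?thesis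
    using p_gt_1 by (simp add: nrm_divide)
qed

lemma rad_le_q: "rad \<le> real q"
  using rt_gt_1 q_gt_1 by (simp add: rad_def field_simps)

lemma mahler_sum:
  assumes "\<And>a. a \<in> A \<Longrightarrow> tame (d a)" "s \<in> padic_disk p"
  shows "mahler (\<lambda>k. \<Sum>a\<in>A. c a * d a k) s = (\<Sum>a\<in>A. c a * mahler (d a) s)"
proof -
  have "(\<lambda>k. \<Sum>a\<in>A. c a * ((s gchoose k) * d a k)) sums (\<Sum>a\<in>A. c a * mahler (d a) s)"
    using assms by (intro padic_sums_sum padic_sums_mult mahler_sums)
  hence "(\<lambda>k. (s gchoose k) * (\<Sum>a\<in>A. c a * d a k)) sums (\<Sum>a\<in>A. c a * mahler (d a) s)"
    by (simp add: sum_distrib_left mult_ac)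
  thus ?thesis
    by (simp add: mahler_def sums_iff)
qed

text \<open>The bounds for the terms from second order on are q h^2 times powers of q h <=
  1.\<close>

lemma binpow_linear_approx:
  assumes y: "nrm y \<le> h" and h: "h \<le> 1 / real q" and s: "s \<in> padic_disk p"
  obtains e where "binpow y s = 1 + s * (y + e)" "nrm e \<le> real q * h\<^sup>2"
proof -
  have h0: "0 \<le> h"
    using order_trans[OF nrm_nonneg y] .
  have le: "nrm (y ^ k) \<le> 1 / real q ^ k" for k
    using y h by (intro power_nrm_le) simp
  have "real q ^ Suc k * nrm (y ^ Suc (Suc k)) \<le> real q * h\<^sup>2" for k
  proof -
    have "real q ^ Suc k * nrm (y ^ Suc (Suc k)) \<le> real q ^ Suc k * h ^ Suc (Suc k)"
      unfolding nrm_power using y by (intro mult_left_mono power_mono) auto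
    also have "\<dots> = (real q * h) ^ k * (real q * h\<^sup>2)"
      by (simp add: power_mult_distrib power2_eq_square mult_ac)
    also have "\<dots> \<le> 1 * (real q * h\<^sup>2)"
      using h h0 q_gt_1 by (intro mult_right_mono power_le_one) (auto simp: field_simps)
    finally show ?thesis by simp
  qed
  then obtain e where "mahler (\<lambda>k. y ^ k) s = y ^ 0 + s * (y ^ 1 + e)" "nrm e \<le> real q * h\<^sup>2"
    by (rule mahler_linear_approx[of "\<lambda>k. y ^ k" 1 s, OF le s])
  thus ?thesis
    by (intro that) (simp_all add: binpow_def)
qed

context
  fixes F :: nat
  assumes F: "F > 0" "q dvd F"
begin

text \<open>Read backwards, \<open>binpow_mult_mahler\<close> takes the factor <a>^s out and leaves
  the series with coefficients (F/a)^j B_j. The factor p in the error is the bound for the Bernoulli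
  numbers.\<close>

lemma umbral_linear_approx:
  assumes a: "\<not> int p dvd a" and s: "s \<in> padic_disk p"
  obtains e where
    "mahler (\<lambda>j. umbral j (angle p a - 1) (of_nat F / teich p a)) s
      = angle_pow p a s * (1 + s * (- (of_nat F / (2 * of_int a)) + e))"
    "nrm e \<le> real p * real q * (nrm (of_nat F))\<^sup>2"
proof -
  let ?h = "nrm (of_nat F)"
  let ?d = "\<lambda>j. (of_nat F / of_int a) ^ j * bern j :: 'a"
  have h: "?h \<le> 1 / real q"
    using nrm_of_nat_multiple_le[OF F(2)] nrm_q by simp
  have a0: "(of_int a :: 'a) \<noteq> 0" "nrm (of_int a) = 1"
    using nrm_of_int_eq_1[OF a] by auto
  have d: "nrm (?d k) \<le> ?h ^ k * real p" for k
    unfolding abs_mult nrm_power nrm_divide using a0 by (intro mult_mono nrm_bern_le) auto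
  have le: "nrm (?d k) \<le> real p / real q ^ k" for k
  proof -
    have "?h ^ k * real p \<le> (1 / real q) ^ k * real p"
      using h by (intro mult_right_mono power_mono) auto
    thus ?thesis
      using d[of k] by (simp add: power_divide)
  qed
  have "real q ^ Suc k * nrm (?d (Suc (Suc k))) \<le> real p * real q * ?h\<^sup>2" for k
  proof -
    have "real q ^ Suc k * nrm (?d (Suc (Suc k))) \<le> real q ^ Suc k * (?h ^ Suc (Suc k) * real p)"
      by (intro mult_left_mono d) auto
    also have "\<dots> = (real q * ?h) ^ k * (real p * real q * ?h\<^sup>2)"
      by (simp add: power_mult_distrib power2_eq_square mult_ac)
    also have "\<dots> \<le> 1 * (real p * real q * ?h\<^sup>2)"
      using h q_gt_1 by (intro mult_right_mono power_le_one) (auto simp: field_simps)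
    finally show ?thesis by simp
  qed
  then obtain e where e: "mahler ?d s = ?d 0 + s * (?d 1 + e)" "nrm e \<le> real p * real q * ?h\<^sup>2"
    by (rule mahler_linear_approx[of ?d "real p" s, OF le s])
  have "?d 0 = 1" "?d 1 = - (of_nat F / (2 * of_int a))"
    unfolding bern_0 bern_1 by simp_all
  note e(1)[unfolded this]
  have "(1 + (angle p a - 1)) ^ i * ?d i = (of_nat F / teich p a) ^ i * bern i" for i
    using a0 by (simp add: angle_def power_divide)
  hence "angle_pow p a s * mahler ?d s = mahler (\<lambda>j. umbral j (angle p a - 1) (of_nat F / teich p a)) s"
    unfolding angle_pow_eq binpow_mult_mahler[OF nrm_angle_minus_1_le[OF a] s le]
    by (simp only: umbral_def)
  with \<open>mahler ?d s = 1 + s * (- (of_nat F / (2 * of_int a)) + e)\<close> show ?thesis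
    by (intro that[OF _ e(2)]) simp
qed

end

context
  fixes f F c :: nat and chi :: "int \<Rightarrow> 'a"
  assumes chi: "dirichlet_char f chi"
    and F: "F > 0" "q dvd F" "f dvd F"
    and c: "c > 1" "coprime c F"
begin

private lemma mod: "dirichlet_char_mod f chi"
  using chi by (simp add: dirichlet_char_def)

private lemma pF: "p dvd F"
  using F(2) p_dvd_q by (rule dvd_trans[rotated])

private lemma p_c: "\<not> p dvd c"
  using c(2) pF prime_p by (metis coprime_common_divisor_nat not_prime_1)

private lemma bij_units: "bij_betw (\<lambda>a. (a * c) mod F) {a. a \<in> {1..F} \<and> \<not> p dvd a} {a. a \<in> {1..F} \<and> \<not> p dvd a}"
proof -
  let ?A = "{a. a \<in> {1..F} \<and> \<not> p dvd a}"
  have A: "?A = {a. a < F \<and> \<not> p dvd a}"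
  proof -
    have "1 \<le> a \<and> a \<le> F \<longleftrightarrow> a < F" if "\<not> p dvd a" for a
      using that pF by (cases "a = 0"; cases "a = F") auto
    thus ?thesis unfolding atLeastAtMost_iff by blast
  qed
  have "inj_on (\<lambda>a. (a * c) mod F) ?A"
    unfolding A using bij_betw_imp_inj_on[OF bij_betw_mult_mod[OF c(2) F(1)]]
    by (rule inj_on_subset) auto
  moreover have "(\<lambda>a. (a * c) mod F) ` ?A \<subseteq> ?A"
    unfolding A using pF p_c prime_p F(1) by (auto simp: dvd_mod_iff prime_dvd_mult_iff)
  ultimately show ?thesis
    by (intro bij_betw_imageI endo_inj_surj) auto
qed

private lemma nrm_chi_angle_pow_le_1:
  "\<not> int p dvd a \<Longrightarrow> s \<in> padic_disk p \<Longrightarrow> nrm (chi a * angle_pow p a s) \<le> 1"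
  using nrm_dirichlet_char_le_1[OF mod] by (simp add: abs_mult)

text \<open>With u = 1 - s and W(a) = chi(a) <a>^u, the factor 1 - chi(c) <c>^u turns the closed
  form into a sum over W(a) - W(a c). Moving the main part in W(a) to the residue r of a c allows
  the comparison with W(a c) = W(r) (1 + y)^u, where the singular terms W(r)/(F u) cancel.\<close>

lemma regularized_sum_bound_neq_1:
  assumes s: "s \<in> padic_disk p" "s \<noteq> 1"
  shows "nrm (- ((1 - chi (int c) * angle_pow p (int c) (1 - s)) * padic_L p chi s)
      - (\<Sum>a | a \<in> {1..F} \<and> \<not> p dvd a. chi (int a) / teich p (int a) *
          (eps (int a) (int c) (int F) / angle_pow p (int a) s)))
    \<le> real q * real p * nrm (of_nat F)"
proof -
  let ?A = "{a. a \<in> {1..F} \<and> \<not> p dvd a}"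
  define h where "h = nrm (of_nat F)"
  define u where "u = 1 - s"
  define r where "r a = (a * c) mod F" for a
  define k where "k a = (a * c) div F" for a
  define y where "y a = (of_nat F * of_nat (k a) / of_nat (r a) :: 'a)" for a
  define W where "W a = chi (int a) * angle_pow p (int a) u" for a
  define G where "G a = chi (int a) / teich p (int a) *
          (eps (int a) (int c) (int F) / angle_pow p (int a) s)" for a
  have h: "0 < h" "h \<le> 1 / real q"
    using F(1) nrm_of_nat_multiple_le[OF F(2)] nrm_q by (auto simp: h_def)
  have u: "u \<in> padic_disk p" "u \<noteq> 0"
    using s disk_diff[OF disk_unit[of 1] s(1)] by (auto simp: u_def)
  have ms: "- s \<in> padic_disk p"
    using s(1) by (rule disk_minus)
  have F0: "(of_nat F :: 'a) \<noteq> 0"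
    using F(1) by simp
  have p_a: "\<not> int p dvd int a" "(of_nat a :: 'a) \<noteq> 0" "nrm (of_nat a) = 1" if "a \<in> ?A" for a
    using that nrm_of_nat_eq_1 by auto
  have r: "r a \<in> ?A" if "a \<in> ?A" for a
    using bij_betwE[OF bij_units] that by (auto simp: r_def)
  have reindex: "(\<Sum>a\<in>?A. g (r a)) = (\<Sum>a\<in>?A. g a)" for g :: "nat \<Rightarrow> 'a"
    unfolding r_def by (rule sum.reindex_bij_betw[OF bij_units])
  have ac: "(of_nat a * of_nat c :: 'a) = of_nat (r a) * (1 + y a)" if "a \<in> ?A" for a
  proof -
    have "a * c = r a + F * k a"
      by (simp add: r_def k_def)
    hence "(of_nat a * of_nat c :: 'a) = of_nat (r a) + of_nat F * of_nat (k a)"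
      by (metis of_nat_add of_nat_mult)
    thus ?thesis
      using p_a(2)[OF r[OF that]] by (simp add: y_def field_simps)
  qed
  have cong: "[int (a * c) = int (r a)] (mod int F)" for a
    by (simp add: r_def cong_def zmod_int)
  have y: "nrm (y a) \<le> h" if "a \<in> ?A" for a
    using p_a(3)[OF r[OF that]] nrm_mult_le_1[OF nrm_of_nat_le_1[of "k a"], of "of_nat F" h]
    by (simp add: y_def nrm_divide h_def mult.commute)
  have Wac: "W (a * c) = W (r a) * binpow (y a) u" if a: "a \<in> ?A" for a
  proof -
    have "teich p (int (a * c)) = (teich p (int (r a)) :: 'a)"
      using cong_dvd_modulus[OF cong[of a], of "int q"] F(2) by (intro teich_cong) auto
    hence "angle p (int (a * c)) = angle p (int (r a)) * (1 + y a)"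
      using ac[OF a] by (simp add: angle_def)
    moreover have "chi (int (a * c)) = chi (int (r a))"
      using cong_dvd_modulus[OF cong[of a], of "int f"] F(3)
      by (intro dirichlet_char_mod_cong[OF mod]) auto
    moreover have "nrm (y a) \<le> 1 / real q"
      using y[OF a] h by simp
    ultimately show ?thesis
      using angle_pow_times_binpow[OF p_a(1)[OF r[OF a]] _ _ u(1)] by (simp add: W_def)
  qed
  have Wac': "W (a * c) = chi (int c) * angle_pow p (int c) u * W a" if "a \<in> ?A" for a
    using mod angle_pow_mult[OF p_a(1)[OF that] _ u(1), of "int c"] p_c
    by (simp add: W_def dirichlet_char_mod_def)
  have W1: "nrm (W a) \<le> 1" if "\<not> p dvd a" for a
    unfolding W_def using that by (intro nrm_chi_angle_pow_le_1 u) auto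

  define E where "E a e \<longleftrightarrow>
      mahler (\<lambda>j. umbral j (angle p (int a) - 1) (of_nat F / teich p (int a))) u
        = angle_pow p (int a) u * (1 + u * (- (of_nat F / (2 * of_nat a)) + e)) \<and>
      nrm e \<le> real p * real q * h\<^sup>2" for a e
  have "\<exists>e. E a e" if "a \<in> ?A" for a
    by (rule umbral_linear_approx[OF F(1,2) p_a(1)[OF that] u(1)]) (auto simp: h_def E_def)
  then obtain e where "\<And>a. a \<in> ?A \<Longrightarrow> E a (e a)"
    by metis
  hence e: "\<And>a. a \<in> ?A \<Longrightarrow>
      mahler (\<lambda>j. umbral j (angle p (int a) - 1) (of_nat F / teich p (int a))) u
      = angle_pow p (int a) u * (1 + u * (- (of_nat F / (2 * of_nat a)) + e a))"
      "\<And>a. a \<in> ?A \<Longrightarrow> nrm (e a) \<le> real p * real q * h\<^sup>2"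
    unfolding E_def by blast+
  define E1 where "E1 a e \<longleftrightarrow> binpow (y a) u = 1 + u * (y a + e) \<and> nrm e \<le> real q * h\<^sup>2" for a e
  have "\<exists>e. E1 a e" if "a \<in> ?A" for a
    by (rule binpow_linear_approx[OF y[OF that] h(2) u(1)]) (auto simp: E1_def)
  then obtain e1 where "\<And>a. a \<in> ?A \<Longrightarrow> E1 a (e1 a)"
    by metis
  hence e1: "\<And>a. a \<in> ?A \<Longrightarrow> binpow (y a) u = 1 + u * (y a + e1 a)"
      "\<And>a. a \<in> ?A \<Longrightarrow> nrm (e1 a) \<le> real q * h\<^sup>2"
    unfolding E1_def by blast+
  \<comment> \<open>The term with 1/(2 a) no longer has F in its denominator, so a first-order bound
    suffices here; the factor q in it bounds |s|.\<close>
  define e2 where "e2 a = binpow (y a) (- s) - 1" for a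
  have qh: "real q * h \<le> 1"
    using h q_gt_1 by (simp add: field_simps)
  have e2: "nrm (e2 a) \<le> real q * h" if a: "a \<in> ?A" for a
  proof -
    obtain e where e: "binpow (y a) (- s) = 1 + - s * (y a + e)" "nrm e \<le> real q * h\<^sup>2"
      by (rule binpow_linear_approx[OF y[OF a] h(2) ms])
    note e(2)
    also have "real q * h\<^sup>2 = real q * h * h"
      by (simp add: power2_eq_square)
    also have "\<dots> \<le> 1 * h"
      using qh h by (intro mult_right_mono) auto
    finally have "nrm e \<le> h" by simp
    hence "nrm (- s) * nrm (y a + e) \<le> real q * h"
      using y[OF a] s(1) rad_le_q by (intro mult_mono nrm_add_le) (auto simp: padic_disk_iff)
    thus ?thesis
      unfolding e2_def e(1) by (simp add: abs_mult)
  qed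

  have "L_coeff chi F = (\<lambda>j. \<Sum>a\<in>?A. chi (int a) *
      umbral j (angle p (int a) - 1) (of_nat F / teich p (int a)))"
    by (simp add: L_coeff_def fun_eq_iff)
  hence "mahler (L_coeff chi F) u = (\<Sum>a\<in>?A. chi (int a) *
      mahler (\<lambda>j. umbral j (angle p (int a) - 1) (of_nat F / teich p (int a))) u)"
  proof (simp only:, intro mahler_sum tameI u)
    fix a j assume a: "a \<in> ?A"
    have "nrm (umbral j (angle p (int a) - 1) (of_nat F / teich p (int a))) \<le> real p * (1 / real q) ^ j"
      using nrm_angle_minus_1_le[OF p_a(1)[OF a]] h(2) p_a(1)[OF a]
      by (intro nrm_umbral_le) (auto simp: nrm_divide h_def)
    thus "nrm (umbral j (angle p (int a) - 1) (of_nat F / teich p (int a))) \<le> real p / real q ^ j"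
      by (simp add: power_divide)
  qed
  also have "\<dots> = (\<Sum>a\<in>?A. W a * (1 + u * (- (of_nat F / (2 * of_nat a)) + e a)))"
    by (intro sum.cong) (simp_all add: e(1) W_def)
  finally have M: "mahler (L_coeff chi F) u = \<dots>" .
  have "padic_L p chi s = mahler (L_coeff chi F) u / (of_nat F * (s - 1))"
    using padic_L_eq_explicit[OF chi F s] L_explicit_eq[OF chi F s] by (simp add: u_def)
  also have "s - 1 = - u"
    by (simp add: u_def)
  finally have "- ((1 - chi (int c) * angle_pow p (int c) u) * padic_L p chi s)
      = (1 - chi (int c) * angle_pow p (int c) u) * mahler (L_coeff chi F) u / (of_nat F * u)"
    by simp
  also have "\<dots> = (\<Sum>a\<in>?A. (W a - W (a * c)) * (1 + u * (- (of_nat F / (2 * of_nat a)) + e a)) / (of_nat F * u))"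
    unfolding M sum_distrib_left sum_divide_distrib
  proof (rule sum.cong)
    fix a assume "a \<in> ?A"
    hence W: "W a - W (a * c) = (1 - chi (int c) * angle_pow p (int c) u) * W a"
      by (simp add: Wac' left_diff_distrib)
    show "(1 - chi (int c) * angle_pow p (int c) u) * (W a * (1 + u * (- (of_nat F / (2 * of_nat a)) + e a))) / (of_nat F * u)
        = (W a - W (a * c)) * (1 + u * (- (of_nat F / (2 * of_nat a)) + e a)) / (of_nat F * u)"
      unfolding W by (simp only: mult.assoc)
  qed simp
  also have "\<dots> = (\<Sum>a\<in>?A. (W a / (of_nat F * u) - W a / (2 * of_nat a))
      + (- (W (a * c) / (of_nat F * u)) + W (a * c) / (2 * of_nat a) + (W a - W (a * c)) * e a / of_nat F))"
    using u(2) F0 p_a(2) by (intro sum.cong) (simp_all add: field_simps)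
  \<comment> \<open>Only the main terms in \<open>W a\<close> alone are re-indexed by
    \<open>r\<close>; the rest, including the Bernoulli error, stays at a.\<close>
  also have "\<dots> = (\<Sum>a\<in>?A. (W (r a) / (of_nat F * u) - W (r a) / (2 * of_nat (r a)))
      + (- (W (a * c) / (of_nat F * u)) + W (a * c) / (2 * of_nat a) + (W a - W (a * c)) * e a / of_nat F))"
    unfolding sum.distrib reindex[of "\<lambda>a. W a / (of_nat F * u) - W a / (2 * of_nat a)"] ..
  finally have "- ((1 - chi (int c) * angle_pow p (int c) u) * padic_L p chi s) - (\<Sum>a\<in>?A. G a)
      = (\<Sum>a\<in>?A. (W (r a) / (of_nat F * u) - W (r a) / (2 * of_nat (r a)))
      + (- (W (a * c) / (of_nat F * u)) + W (a * c) / (2 * of_nat a) + (W a - W (a * c)) * e a / of_nat F)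
      - G (r a))" (is "?lhs = sum ?T _")
    by (simp only: reindex[of G, symmetric] sum_subtractf)
  moreover have "nrm (?T a) \<le> real q * real p * h" if a: "a \<in> ?A" for a
  proof -
    note ra = p_a[OF r[OF a]]
    have "G (r a) = W (r a) / of_nat (r a) * ((of_nat c - 1) / 2 - of_nat (k a))"
    proof -
      have "angle_pow p (int (r a)) u = angle p (int (r a)) * (1 / angle_pow p (int (r a)) s)"
        using angle_pow_1_plus[OF ra(1) ms] angle_pow_minus[OF ra(1) s(1)] by (simp add: u_def)
      hence "W (r a) / of_nat (r a) = chi (int (r a)) / teich p (int (r a)) / angle_pow p (int (r a)) s"
        using ra by (simp add: W_def angle_def)
      moreover have "a < F"
        using a pF by (auto simp: le_less)
      ultimately show ?thesis
        using eps_digit[OF c(2,1), of a] by (simp add: G_def r_def k_def)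
    qed
    moreover have "W (a * c) / (of_nat F * u)
        = W (r a) / (of_nat F * u) + W (r a) * (of_nat (k a) / of_nat (r a)) + W (r a) * e1 a / of_nat F"
      unfolding Wac[OF a] e1(1)[OF a] using u(2) F0 ra(2) by (simp add: y_def field_simps)
    \<comment> \<open>Since a = r (1 + y)/c and (1 + y)^u = (1 + y) (1 + y)^(-s), the factor 1 + y
      cancels and only \<open>e2\<close> is left as error.\<close>
    moreover have "W (a * c) / (2 * of_nat a)
        = of_nat c / 2 * (W (r a) / of_nat (r a)) * (1 + e2 a)"
    proof -
      have y1: "1 + y a \<noteq> 0"
        using ac[OF a] p_a(2)[OF a] c(1) by auto
      have "binpow (y a) (1 + - s) = binpow (y a) (of_nat 1) * binpow (y a) (- s)"
        using y[OF a] h(2) binpow_add[OF _ disk_of_nat[of 1] ms, of "y a"] by simp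
      hence "binpow (y a) u = (1 + y a) * (1 + e2 a)"
        unfolding binpow_of_nat by (simp add: u_def e2_def)
      moreover have "of_nat a = of_nat (r a) * (1 + y a) / of_nat c"
        using ac[OF a] c(1) by (simp add: field_simps)
      ultimately show ?thesis
        unfolding Wac[OF a] using y1 ra(2) c(1) by simp
    qed
    \<comment> \<open>The main terms add up to zero, as -1/2 + c/2 - k is the value of
      \<open>eps\<close> at r. The remaining errors stem from (1 + y)^u, from replacing 1/(2 a) by
      c/(2 r), and from the Bernoulli series.\<close>
    ultimately have "?T a = - (W (r a) * e1 a / of_nat F)
        + of_nat c * (1 / 2) * (W (r a) / of_nat (r a)) * e2 a + (W a - W (a * c)) * e a / of_nat F"
      using F0 by (simp add: algebra_simps add_divide_distrib diff_divide_distrib)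
    also have "nrm \<dots> \<le> real q * real p * h"
    proof (intro nrm_add_le)
      have "nrm (W (r a) * e1 a / of_nat F) \<le> real q * h\<^sup>2 / h"
        using nrm_mult_le_1[OF W1 e1(2)[OF a]] r[OF a] h by (auto simp: nrm_divide h_def divide_right_mono)
      also have "\<dots> = real q * 1 * h"
        using h by (simp add: power2_eq_square)
      also have "\<dots> \<le> real q * real p * h"
        using h p_gt_1 by (intro mult_right_mono mult_left_mono) auto
      finally show "nrm (- (W (r a) * e1 a / of_nat F)) \<le> real q * real p * h"
        by simp
      have "nrm (of_nat c * (1 / 2 * ((W (r a) / of_nat (r a)) * e2 a))) \<le> real p * (real q * h)"
      proof (intro nrm_mult_le_1[OF nrm_of_nat_le_1])
        have "nrm ((W (r a) / of_nat (r a)) * e2 a) \<le> real q * h"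
          using W1 r[OF a] ra by (intro nrm_mult_le_1 e2 a) (auto simp: nrm_divide)
        thus "nrm (1 / 2 * ((W (r a) / of_nat (r a)) * e2 a)) \<le> real p * (real q * h)"
          unfolding abs_mult[of "1 / 2"] using h by (intro mult_mono nrm_half_le) auto
      qed
      thus "nrm (of_nat c * (1 / 2) * (W (r a) / of_nat (r a)) * e2 a) \<le> real q * real p * h"
        by (simp only: mult_ac)
      have "\<not> p dvd a * c"
        using a p_c prime_p by (auto simp: prime_dvd_mult_iff)
      hence "nrm (W a - W (a * c)) \<le> 1"
        using W1 a by (intro nrm_diff_le) auto
      hence "nrm ((W a - W (a * c)) * e a / of_nat F) \<le> real p * real q * h\<^sup>2 / h"
        using nrm_mult_le_1[OF _ e(2)[OF a]] h by (auto simp: nrm_divide h_def divide_right_mono)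
      also have "\<dots> = real q * real p * h"
        using h by (simp add: power2_eq_square)
      finally show "nrm ((W a - W (a * c)) * e a / of_nat F) \<le> real q * real p * h" .
    qed
    finally show ?thesis .
  qed
  ultimately have "nrm ?lhs \<le> real q * real p * h"
    using h by (simp only:) (intro nrm_sum_le; simp)
  thus ?thesis
    unfolding u_def G_def h_def .
qed

text \<open>At 1 the bound is inherited from nearby points: \<open>\<phi>\<close> and
  \<open>\<sigma>\<close> are Lipschitz at 1 and agree on the punctured unit ball with the
  regularized function and the finite sum.\<close>

lemma regularized_sum_bound:
  assumes s: "s \<in> padic_disk p"
  shows "nrm (- regularized_padic_L p chi (int c) s
      - (\<Sum>a | a \<in> {1..F} \<and> \<not> p dvd a. chi (int a) / teich p (int a) *
          (eps (int a) (int c) (int F) / angle_pow p (int a) s)))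
    \<le> real q * real p * nrm (of_nat F)"
proof (cases "s = 1")
  case False
  thus ?thesis
    using regularized_sum_bound_neq_1[OF s False] by (simp add: regularized_padic_L_def)
next
  case True
  let ?A = "{a. a \<in> {1..F} \<and> \<not> p dvd a}"
  let ?H = "\<lambda>t. (1 - chi (int c) * angle_pow p (int c) (1 - t)) * padic_L p chi t"
  let ?S = "\<lambda>t. \<Sum>a\<in>?A. chi (int a) / teich p (int a) *
          (eps (int a) (int c) (int F) / angle_pow p (int a) t)"
  define R where "R = L_coeff chi F 0 / of_nat F"
  define g where "g t = - mahler (\<lambda>k. L_coeff chi F (Suc k) / of_nat (Suc k)) (- t) / of_nat F" for t
  define x :: 'a where "x = angle p (int c) - 1"
  \<comment> \<open>\<open>X (- t)\<close> is (<c>^(1 - t) - 1)/(1 - t), as a Mahler series that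
    makes sense at t = 1 too.\<close>
  define X where "X t = mahler (\<lambda>k. x ^ Suc k / of_nat (Suc k)) t" for t
  define \<phi> where "\<phi> t = R * X (- t) + (1 + (- (chi (int c) * angle p (int c))) * angle_pow p (int c) (- t)) * g t" for t
  define \<sigma> where "\<sigma> t = (\<Sum>a\<in>?A. (chi (int a) / teich p (int a) * eps (int a) (int c) (int F))
          * angle_pow p (int a) (- t))" for t
  have pc: "\<not> int p dvd int c"
    using p_c by simp
  have x: "nrm (x ^ k) \<le> 1 / real q ^ k" for k
    unfolding x_def by (intro power_nrm_le nrm_angle_minus_1_le pc)
  have lip_phi: "lip_at_1 \<phi>"
    unfolding \<phi>_def X_def g_def
    by (intro lip_at_1_add lip_at_1_mult lip_at_1_const lip_at_1_analytic L_explicit_analytic_part[OF chi F]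
          analytic_reflect_scale mahler_analytic tame_shift[OF x] angle_pow_analytic pc)
  have lip_sigma: "lip_at_1 \<sigma>"
    unfolding \<sigma>_def
    by (intro lip_at_1_sum lip_at_1_analytic analytic_reflect_scale angle_pow_analytic) auto
  have H: "?H t = \<phi> t" if t: "nrm t \<le> 1" "t \<noteq> 1" for t
  proof -
    have td: "t \<in> padic_disk p"
      using t(1) by (rule disk_unit)
    have L: "padic_L p chi t = R / (t - 1) + g t"
      using padic_L_eq_explicit[OF chi F td t(2)] by (simp add: L_explicit_def R_def g_def)
    \<comment> \<open>For trivial chi the value at c is 1, and otherwise the residue R is 0. So the
      pole always meets the factor 1 - <c>^(1 - t), which has a zero at 1.\<close>
    have Rc: "R * chi (int c) = R"
      using L_coeff_0[OF chi F] dirichlet_char_trivial_iff[OF chi] by (auto simp: R_def)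
    have pow: "angle_pow p (int c) (1 - t) = 1 + (1 - t) * X (- t)"
      using mahler_split[OF x, of "1 - t"] disk_diff[OF disk_unit[of 1] td]
      by (simp add: angle_pow_eq binpow_def X_def x_def)
    have "(1 - chi (int c) * angle_pow p (int c) (1 - t)) * (R / (t - 1))
        = (R - (R * chi (int c)) * angle_pow p (int c) (1 - t)) / (t - 1)"
      by (simp add: left_diff_distrib right_diff_distrib diff_divide_distrib mult_ac)
    also have "\<dots> = R * ((t - 1) * X (- t)) / (t - 1)"
      unfolding Rc pow by (simp add: algebra_simps)
    also have "\<dots> = R * X (- t)"
      using t(2) by simp
    finally have "?H t = R * X (- t) + (1 - chi (int c) * angle_pow p (int c) (1 + - t)) * g t"
      unfolding L by (simp add: distrib_left)
    thus ?thesis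
      unfolding angle_pow_1_plus[OF pc disk_minus[OF td]] by (simp add: \<phi>_def)
  qed
  have S: "?S t = \<sigma> t" if "nrm t \<le> 1" for t
    unfolding \<sigma>_def using that by (intro sum.cong) (auto simp: angle_pow_minus disk_unit)
  have "regularized_padic_L p chi (int c) 1 = \<phi> 1"
    using tendsto_Lim[OF _ lip_at_1_tendsto[OF lip_phi H]] at_1_neq_bot
    by (simp add: regularized_padic_L_def)
  moreover have "nrm ((- 1) * \<phi> 1 + (- 1) * \<sigma> 1) \<le> real q * real p * nrm (of_nat F)"
  proof (rule lip_at_1_nrm_le[of "\<lambda>t. (- 1) * \<phi> t + (- 1) * \<sigma> t"])
    show "lip_at_1 (\<lambda>t. (- 1) * \<phi> t + (- 1) * \<sigma> t)"
      by (intro lip_at_1_add lip_at_1_mult lip_at_1_const lip_phi lip_sigma)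
    show "0 < real q * real p * nrm (of_nat F)"
      using q_gt_1 p_gt_1 F(1) by simp
    fix t :: 'a assume t: "nrm t \<le> 1" "t \<noteq> 1"
    show "nrm ((- 1) * \<phi> t + (- 1) * \<sigma> t) \<le> real q * real p * nrm (of_nat F)"
      using regularized_sum_bound_neq_1[OF disk_unit[OF t(1)] t(2)]
      unfolding H[OF t] S[OF t(1)] by simp
  qed
  ultimately show ?thesis
    using True S[of 1] by simp
qed

end

end

section \<open>Euler factors\<close>

text \<open>The factor l cancels in -l b (l m)^(-1) modulo c. So the digits of the multiples of l
  for F = l m are the digits for m.\<close>

lemma eps_cancel:
  assumes "coprime c (l * m)" "c > 0"
  shows "eps (l * b) c (l * m) = (eps b c m :: 'a::field_char_0)"
proof -
  let ?i = "modular_inverse c (l * m)" and ?j = "modular_inverse c m"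
  have 1: "[l * m * ?i = 1] (mod c)" and 2: "[m * ?j = 1] (mod c)"
    using assms by (auto intro!: cong_modular_inverse1 simp: coprime_commute)
  have "[l * ?i * 1 = l * ?i * (m * ?j)] (mod c)"
    using cong_sym[OF 2] by (intro cong_mult cong_refl)
  also have "l * ?i * (m * ?j) = (l * m * ?i) * ?j"
    by (simp add: mult_ac)
  also have "[(l * m * ?i) * ?j = 1 * ?j] (mod c)"
    using 1 by (intro cong_mult cong_refl)
  finally have "[- b * (l * ?i) = - b * ?j] (mod c)"
    by (intro cong_mult cong_refl) simp
  hence "(- (l * b) * ?i) mod c = (- b * ?j) mod c"
    by (simp add: cong_def mult_ac)
  thus ?thesis
    by (simp add: eps_def)
qed

context padic_complex_field
begin

text \<open>F varies in the induction because the multiples of l reproduce, up to the factor chi(l)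
  omega(l)^(-1) <l>^(-s), the sum for F/l. As l is prime to p, |F/l| = |F|, and the errors for F and
  F/l do not add up, so the bound is independent of S.\<close>

lemma euler_factors_bound:
  fixes f F c :: nat and chi :: "int \<Rightarrow> 'a"
  assumes "finite S" and chi: "dirichlet_char f chi" and c: "c > 1" and s: "s \<in> padic_disk p"
    and "F > 0" "q dvd F" "f dvd F" "coprime c F"
    and "\<forall>l\<in>S. prime l \<and> l \<noteq> p \<and> l dvd F"
  shows "nrm (- regularized_padic_L p chi (int c) s *
        (\<Prod>l\<in>S. 1 - chi (int l) / teich p (int l) * angle_pow p (int l) (- s))
      - (\<Sum>a | a \<in> {1..F} \<and> (\<forall>l \<in> insert p S. \<not> l dvd a). chi (int a) / teich p (int a) *
          (eps (int a) (int c) (int F) / angle_pow p (int a) s)))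
    \<le> real q * real p * nrm (of_nat F)"
  using assms(1,5-)
proof (induction S arbitrary: F rule: finite_induct)
  case empty
  thus ?case
    using regularized_sum_bound[OF chi empty(1-3) c empty(4) s] by simp
next
  case (insert l S)
  define T where "T = - regularized_padic_L p chi (int c) s *
        (\<Prod>l\<in>S. 1 - chi (int l) / teich p (int l) * angle_pow p (int l) (- s))"
  define X where "X = chi (int l) / teich p (int l) * (angle_pow p (int l) (- s) :: 'a)"
  define g where "g F a = chi (int a) / teich p (int a) *
          (eps (int a) (int c) (int F) / (angle_pow p (int a) s :: 'a))" for F a
  define U where "U F = (\<Sum>a | a \<in> {1..F} \<and> (\<forall>l \<in> insert p S. \<not> l dvd a). g F a)" for F
  let ?B = "real q * real p * nrm (of_nat F)"
  have mod: "dirichlet_char_mod f chi"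
    using chi by (simp add: dirichlet_char_def)
  have l: "prime l" "l \<noteq> p" "l dvd F"
    using insert.prems by auto
  have pl: "\<not> int p dvd int l"
    using l prime_p by (simp add: primes_dvd_imp_eq) (use primes_dvd_imp_eq in blast)
  have "nrm (angle_pow p (int l) (- s)) = 1"
    using pl s by (intro nrm_angle_pow disk_minus)
  hence X1: "nrm X \<le> 1"
    using nrm_dirichlet_char_le_1[OF mod] pl by (simp add: X_def abs_mult nrm_divide)
  define m where "m = F div l"
  have m: "F = l * m"
    using l(3) by (simp add: m_def)
  have l0: "l > 0"
    using l(1) prime_gt_0_nat by blast
  have other: "l' dvd l * b \<longleftrightarrow> l' dvd b" if "l' \<in> insert p S" for l' b
  proof -
    have "prime l'" "l' \<noteq> l"
      using that insert.prems insert.hyps l(2) prime_p by auto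
    thus ?thesis
      using l(1) by (metis prime_dvd_mult_iff primes_dvd_imp_eq)
  qed
  have split: "U F = (\<Sum>a | a \<in> {1..F} \<and> (\<forall>l' \<in> insert p (insert l S). \<not> l' dvd a). g F a)
      + (\<Sum>b | b \<in> {1..m} \<and> (\<forall>l' \<in> insert p S. \<not> l' dvd b). g F (l * b))"
  proof -
    have "U F = (\<Sum>a | a \<in> {1..F} \<and> (\<forall>l' \<in> insert p (insert l S). \<not> l' dvd a). g F a)
        + (\<Sum>a | a \<in> {1..F} \<and> l dvd a \<and> (\<forall>l' \<in> insert p S. \<not> l' dvd a). g F a)"
      unfolding U_def by (subst sum.union_disjoint[symmetric]) (auto intro!: sum.cong)
    also have "(\<Sum>a | a \<in> {1..F} \<and> l dvd a \<and> (\<forall>l' \<in> insert p S. \<not> l' dvd a). g F a)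
        = (\<Sum>b | b \<in> {1..m} \<and> (\<forall>l' \<in> insert p S. \<not> l' dvd l * b). g F (l * b))"
      using sum_multiples[OF l0, of "g F" m "\<lambda>a. \<forall>l' \<in> insert p S. \<not> l' dvd a"] by (simp only: m)
    also have "\<dots> = (\<Sum>b | b \<in> {1..m} \<and> (\<forall>l' \<in> insert p S. \<not> l' dvd b). g F (l * b))"
      using other by (intro sum.cong) auto
    finally show ?thesis .
  qed
  have bound: "nrm (T - U F) \<le> ?B"
    unfolding T_def U_def g_def using insert.prems by (intro insert.IH) auto
  have "nrm (T * (1 - X) - (\<Sum>a | a \<in> {1..F} \<and> (\<forall>l' \<in> insert p (insert l S). \<not> l' dvd a). g F a)) \<le> ?B"
  \<comment> \<open>If chi(l) = 0, the Euler factor is 1 and the multiples of l contribute nothing.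
    The case is kept apart because F/l need not be divisible by f then.\<close>
  proof (cases "chi (int l) = 0")
    case True
    have "g F (l * b) = 0" for b
      using True mod by (simp add: g_def dirichlet_char_mod_def)
    thus ?thesis
      using bound split True by (simp add: X_def)
  next
    case False
    have lf: "coprime l f"
      using False dirichlet_char_mod_eq_0_iff[OF mod, of "int l"] by simp
    have lq: "coprime l q"
    proof -
      have "coprime l (p ^ 2)"
        using l prime_p by (simp add: primes_coprime)
      moreover have "q dvd p ^ 2"
        by (auto simp: q_of_def)
      ultimately show ?thesis
        by (meson coprime_divisors dvd_refl)
    qed
    have "nrm (T - U m) \<le> real q * real p * nrm (of_nat m)"
      unfolding T_def U_def g_def
    proof (rule insert.IH)
      show "m > 0"
        using insert.prems(1) m by (cases m) auto
      show "q dvd m" "f dvd m"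
        using insert.prems(2,3) lq lf unfolding m by (auto simp: coprime_dvd_mult_right_iff coprime_commute)
      show "coprime c m"
        using insert.prems(4) unfolding m by simp
      show "\<forall>l\<in>S. prime l \<and> l \<noteq> p \<and> l dvd m"
        using insert.prems(5) other m by auto
    qed
    also have "nrm (of_nat m) = nrm (of_nat F)"
      using pl nrm_of_nat_eq_1[of l] unfolding m by (simp add: abs_mult)
    finally have bound': "nrm (X * (T - U m)) \<le> ?B"
      by (rule nrm_mult_le_1[OF X1])
    have "(\<Sum>b | b \<in> {1..m} \<and> (\<forall>l' \<in> insert p S. \<not> l' dvd b). g F (l * b)) = X * U m"
      unfolding U_def sum_distrib_left
    proof (rule sum.cong)
      fix b assume b: "b \<in> {b. b \<in> {1..m} \<and> (\<forall>l' \<in> insert p S. \<not> l' dvd b)}"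
      have "eps (int l * int b) (int c) (int l * int m) = (eps (int b) (int c) (int m) :: 'a)"
        using insert.prems(4) c unfolding m by (intro eps_cancel) (auto simp flip: of_nat_mult)
      moreover have "angle_pow p (int l * int b) s = angle_pow p (int l) s * (angle_pow p (int b) s :: 'a)"
        using b s pl by (intro angle_pow_mult) auto
      ultimately show "g F (l * b) = X * g m b"
        using mod angle_pow_minus[OF pl s]
        by (simp add: g_def X_def m teich_mult dirichlet_char_mod_def mult_ac)
    qed simp
    hence "T * (1 - X) - (\<Sum>a | a \<in> {1..F} \<and> (\<forall>l' \<in> insert p (insert l S). \<not> l' dvd a). g F a)
        = (T - U F) - X * (T - U m)"
      using split by (simp add: algebra_simps)
    thus ?thesis
      using nrm_diff_le[OF bound bound'] by simp
  qed
  moreover have "T * (1 - X) = - regularized_padic_L p chi (int c) s *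
        (\<Prod>l\<in>insert l S. 1 - chi (int l) / teich p (int l) * angle_pow p (int l) (- s))"
    using insert.hyps by (simp add: T_def X_def mult_ac)
  ultimately show ?case
    unfolding g_def by simp
qed

end

theorem theorem2p6:
  fixes p f F c :: nat
    and S :: "nat set"
    and chi :: "int \<Rightarrow> 'a::{field_char_0,complete_space}"
    and s :: 'a
  assumes "padic_complex_field TYPE('a) p"
    and "dirichlet_char f chi" and "chi (- 1) = 1"
    and "finite S" and "\<forall>l\<in>S. prime l" and "p \<notin> S"
    and "F > 0" and "q_of p dvd F" and "f dvd F" and "\<forall>l\<in>S. l dvd F"
    and "c > 1" and "coprime c F"
    and "pabs s < real (q_of p) * real p powr (- 1 / (real p - 1))"
  shows "\<exists>\<delta>::'a. pabs \<delta> \<le> pabs (of_nat F / of_nat (q_of p * p) :: 'a) \<and>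
     - regularized_padic_L p chi (int c) s *
       (\<Prod>l\<in>S. 1 - chi (int l) / teich p (int l) * angle_pow p (int l) (- s)) =
     (\<Sum>a | a \<in> {1..F} \<and> (\<forall>l \<in> insert p S. \<not> l dvd a).
        chi (int a) / teich p (int a) *
        (eps (int a) (int c) (int F) / angle_pow p (int a) s)) + \<delta>"
    (is "\<exists>\<delta>. _ \<and> ?lhs = ?sum + \<delta>")
proof (intro exI conjI)
  note field = \<open>padic_complex_field TYPE('a) p\<close>
  have "pabs (?lhs - ?sum) \<le> real (q_of p) * real p * pabs (of_nat F :: 'a)"
    using assms by (intro padic_complex_field.euler_factors_bound[where f = f]) (auto simp: padic_disk_def)
  \<comment> \<open>Here |q p| = 1/(q p), so multiplying by q p amounts to dividing by |q
    p|.\<close>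
  also have "\<dots> = pabs (of_nat F / of_nat (q_of p * p) :: 'a)"
    by (simp add: padic_complex_field.nrm_divide[OF field] padic_complex_field.abs_mult[OF field]
        padic_complex_field.nrm_q[OF field] padic_complex_field.abs_p[OF field])
  finally show "pabs (?lhs - ?sum) \<le> pabs (of_nat F / of_nat (q_of p * p) :: 'a)" .
qed simp

end
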